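(* Let $0<\varepsilon\ll 1$, let $c,f$ be smooth functions on $[0,1]$ with $c(x)\ge \tilde\gamma^2>0$ on $[0,1]$, and let $u$ be the solution of $$-\varepsilon^2u''+c\,u=f \text{ in } (0,1),\qquad u(0)=u(1)=0 .$$ Fix $\gamma\in(0,\tilde\gamma)$ and a polynomial degree $k\ge 1$. Let $u^N\in V^N$ be the NIPG solution, i.e. $a(u^N,v^N)=l(v^N)$ for all $v^N\in V^N$, computed on the Shishkin-type layer-adapted mesh described in the context with the penalty parameters $$\sigma_i=\begin{cases}\varepsilon, & x_i\in\{x_0,x_N\},\\ \varepsilon N, & x_i\in\Omega_c=(\lambda,1-\lambda),\\ \varepsilon N(\max|\psi'|)^{-1}, & x_i\in\overline{\Omega_f}\setminus\{x_0,x_N\},\end{cases}$$ where $\Omega_f=(0,\lambda)\cup(1-\lambda,1)$. Then $$\|u-u^N\|_{dG}\le CN^{-(k+1)}+C\varepsilon^{1/2}N^{-k}\max|\psi'|^{k+1},$$ where $C$ is a positive constant independent of $\varepsilon$ and $N$.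
   Context: Mesh and spaces: $N\ge 4$ is an integer divisible by $4$; $0=x_0<x_1<\dots<x_N=1$, $I_i=(x_{i-1},x_i)$, $h_i=x_i-x_{i-1}$. $V=\{v\in L^2(0,1): v|_{I_i}\in H^1(I_i)\ \forall i\}$ and $V^N=\{v\in L^2(0,1): v|_{I_i}\in\mathbb P_k(I_i)\ \forall i\}$ (discontinuous piecewise polynomials of degree $\le k$). For $v\in V$: $[v]_i=v(x_i+0)-v(x_i-0)$, $\langle v\rangle_i=\tfrac12(v(x_i+0)+v(x_i-0))$ for $1\le i\le N-1$; $[v]_0=\langle v\rangle_0=v(x_0+0)$; $[v]_N=-\langle v\rangle_N=-v(x_N-0)$. NIPG method: for $w,v\in V$, $$a(w,v)=\sum_{i=1}^N\int_{I_i}(\varepsilon^2w'v'+cwv)\,dx+\sum_{i=0}^N\big(\varepsilon^2\langle w'\rangle_i[v]_i-\varepsilon^2[w]_i\langle v'\rangle_i+\sigma_i[w]_i[v]_i\big),\qquad l(v)=\sum_{i=1}^N\int_{I_i}fv\,dx,$$ with penalty parameters $\sigma_i>0$. Energy norm: $\|w\|_{dG}^2=a(w,w)$. Shishkin-type mesh: assume $\varepsilon\le CN^{-1}$ and set $\lambda=(k+1)\frac{\varepsilon}{\gamma}\ln N<1/4$. Let $\phi_1$ on $[0,1/4]$ and $\phi_2$ on $[3/4,1]$ be continuous, piecewise continuously differentiable mesh generating functions, $\phi_1$ monotonically increasing, $\phi_2$ monotonically decreasing, $\phi_1(0)=\phi_2(1)=0$, $\phi_1(1/4)=\phi_2(3/4)=\ln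 N$, satisfying (for $\phi=\phi_1,\phi_2$) $N^{-1}\max|\phi'|\le C$ and $\min_j|\phi(j/N)-\phi((j-1)/N)|\ge CN^{-1}$. The mesh points are $$x_i=\begin{cases}(k+1)\frac{\varepsilon}{\gamma}\phi_1(i/N), & i=0,\dots,N/4,\\ \lambda+2(1-2\lambda)(i/N-\tfrac14), & i=N/4+1,\dots,3N/4,\\ 1-(k+1)\frac{\varepsilon}{\gamma}\phi_2(i/N), & i=3N/4+1,\dots,N.\end{cases}$$ Mesh characterizing functions $\psi_j=e^{-\phi_j}$, and $\max|\psi'|$ denotes the maximum of $|\psi_1'|$ on $[0,1/4]$ and $|\psi_2'|$ on $[3/4,1]$. (Examples: Shishkin mesh $\psi_1(t)=N^{-4t}$, Bakhvalov–Shishkin mesh $\psi_1(t)=1-4(1-N^{-1})t$.) *)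

theory Defs
  imports "HOL-Analysis.Analysis" "HOL-Computational_Algebra.Polynomial"
begin

definition smooth_on :: "real set \<Rightarrow> (real \<Rightarrow> real) \<Rightarrow> bool" where
  "smooth_on S g \<longleftrightarrow> (\<forall>n. \<forall>x\<in>S. ((deriv ^^ n) g) differentiable (at x))"

definition trans_pt :: "nat \<Rightarrow> real \<Rightarrow> real \<Rightarrow> nat \<Rightarrow> real" where
  "trans_pt k \<epsilon> \<gamma> N = (real k + 1) * \<epsilon> / \<gamma> * ln (real N)"

definition mesh_pt :: "nat \<Rightarrow> real \<Rightarrow> real \<Rightarrow> nat \<Rightarrow> (real \<Rightarrow> real) \<Rightarrow> (real \<Rightarrow> real)
    \<Rightarrow> nat \<Rightarrow> real" where
  "mesh_pt k \<epsilon> \<gamma> N \<phi>1 \<phi>2 i =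
     (if i \<le> N div 4 then (real k + 1) * \<epsilon> / \<gamma> * \<phi>1 (real i / real N)
      else if i \<le> 3 * N div 4 then
        trans_pt k \<epsilon> \<gamma> N + 2 * (1 - 2 * trans_pt k \<epsilon> \<gamma> N) * (real i / real N - 1/4)
      else 1 - (real k + 1) * \<epsilon> / \<gamma> * \<phi>2 (real i / real N))"

text \<open>Admissible mesh generating function on [a,b] (increasing for \<phi>1, decreasing for \<phi>2
  is imposed separately), with the two mesh conditions having constants Cd and Cl.\<close>
definition mesh_gen_conds :: "real \<Rightarrow> real \<Rightarrow> nat \<Rightarrow> real \<Rightarrow> real \<Rightarrow> (real \<Rightarrow> real) \<Rightarrow> bool" where
  "mesh_gen_conds a b N Cd Cl \<phi> \<longleftrightarrow>
     \<phi> piecewise_C1_differentiable_on {a..b} \<and>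
     (\<forall>t\<in>{a<..<b}. \<phi> differentiable (at t) \<longrightarrow> \<bar>deriv \<phi> t\<bar> / real N \<le> Cd) \<and>
     (\<forall>j::nat. a \<le> real (j - 1) / real N \<and> 1 \<le> j \<and> real j / real N \<le> b \<longrightarrow>
        \<bar>\<phi> (real j / real N) - \<phi> (real (j - 1) / real N)\<bar> \<ge> Cl / real N)"

text \<open>max |\<psi>'| with \<psi>_j = exp(-\<phi>_j): maximum of |\<psi>1'| on [0,1/4] and |\<psi>2'| on [3/4,1]
  (taken as a supremum over the points where the derivative exists).\<close>
definition max_dpsi :: "(real \<Rightarrow> real) \<Rightarrow> (real \<Rightarrow> real) \<Rightarrow> real" where
  "max_dpsi \<phi>1 \<phi>2 =
     max (Sup {\<bar>deriv (\<lambda>s. exp (- \<phi>1 s)) t\<bar> | t. t \<in> {0<..<1/4} \<and>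
                  (\<lambda>s. exp (- \<phi>1 s)) differentiable (at t)})
         (Sup {\<bar>deriv (\<lambda>s. exp (- \<phi>2 s)) t\<bar> | t. t \<in> {3/4<..<1} \<and>
                  (\<lambda>s. exp (- \<phi>2 s)) differentiable (at t)})"

text \<open>Broken functions: w i is the restriction of w to the closed element [x_{i-1},x_i],
  i = 1..N.  Derivatives on element i are taken within that element (one-sided at its ends).\<close>
type_synonym broken = "nat \<Rightarrow> real \<Rightarrow> real"

definition bder :: "(nat \<Rightarrow> real) \<Rightarrow> broken \<Rightarrow> nat \<Rightarrow> real \<Rightarrow> real" where
  "bder x w i t = vector_derivative (w i) (at t within {x (i - 1) .. x i})"

definition jump :: "(nat \<Rightarrow> real) \<Rightarrow> nat \<Rightarrow> broken \<Rightarrow> nat \<Rightarrow> real" where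
  "jump x N w i =
     (if i = 0 then w 1 (x 0)
      else if i = N then - w N (x N)
      else w (i + 1) (x i) - w i (x i))"

definition avg_der :: "(nat \<Rightarrow> real) \<Rightarrow> nat \<Rightarrow> broken \<Rightarrow> nat \<Rightarrow> real" where
  "avg_der x N w i =
     (if i = 0 then bder x w 1 (x 0)
      else if i = N then bder x w N (x N)
      else (bder x w (i + 1) (x i) + bder x w i (x i)) / 2)"

definition nipg_a :: "(nat \<Rightarrow> real) \<Rightarrow> nat \<Rightarrow> real \<Rightarrow> (real \<Rightarrow> real) \<Rightarrow> (nat \<Rightarrow> real)
    \<Rightarrow> broken \<Rightarrow> broken \<Rightarrow> real" where
  "nipg_a x N \<epsilon> c \<sigma> w v =
     (\<Sum>i=1..N. integral {x (i - 1) .. x i}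
        (\<lambda>t. \<epsilon>\<^sup>2 * bder x w i t * bder x v i t + c t * w i t * v i t))
   + (\<Sum>i=0..N. \<epsilon>\<^sup>2 * avg_der x N w i * jump x N v i
               - \<epsilon>\<^sup>2 * jump x N w i * avg_der x N v i
               + \<sigma> i * jump x N w i * jump x N v i)"

definition nipg_l :: "(nat \<Rightarrow> real) \<Rightarrow> nat \<Rightarrow> (real \<Rightarrow> real) \<Rightarrow> broken \<Rightarrow> real" where
  "nipg_l x N f v = (\<Sum>i=1..N. integral {x (i - 1) .. x i} (\<lambda>t. f t * v i t))"

definition dG_norm :: "(nat \<Rightarrow> real) \<Rightarrow> nat \<Rightarrow> real \<Rightarrow> (real \<Rightarrow> real) \<Rightarrow> (nat \<Rightarrow> real)
    \<Rightarrow> broken \<Rightarrow> real" where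
  "dG_norm x N \<epsilon> c \<sigma> w = sqrt (nipg_a x N \<epsilon> c \<sigma> w w)"

text \<open>Element of V^N: discontinuous piecewise polynomials of degree \<le> k, given by one
  polynomial per element i = 1..N.\<close>
definition in_VN :: "nat \<Rightarrow> nat \<Rightarrow> (nat \<Rightarrow> real poly) \<Rightarrow> bool" where
  "in_VN N k P \<longleftrightarrow> (\<forall>i\<in>{1..N}. degree (P i) \<le> k)"

definition pw_fun :: "(nat \<Rightarrow> real poly) \<Rightarrow> broken" where
  "pw_fun P = (\<lambda>i t. poly (P i) t)"

definition penalty :: "nat \<Rightarrow> real \<Rightarrow> real \<Rightarrow> real \<Rightarrow> (nat \<Rightarrow> real) \<Rightarrow> nat \<Rightarrow> real" where
  "penalty N \<epsilon> lam mpsi x i =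
     (if i = 0 \<or> i = N then \<epsilon>
      else if lam < x i \<and> x i < 1 - lam then \<epsilon> * real N
      else \<epsilon> * real N / mpsi)"

end

theory Submission
  imports Defs
begin

text \<open>A power series ansatz in \<open>\<epsilon>\<^sup>2\<close> gives a smooth approximate solution \<open>S\<close> with residual
  \<open>O(\<epsilon>\<^bsup>2k+2\<^esup>)\<close>. The remainder \<open>E = u - S\<close> is bounded by the boundary layer functions plus
  \<open>\<epsilon>\<^bsup>2k+2\<^esup>\<close> by the maximum principle, and bootstrapping the equation extends this to all
  \<open>\<epsilon>\<^sup>jE\<^sup>(\<^sup>j\<^sup>)\<close>. On layer elements \<open>u\<close> is approximated by its Taylor polynomial plus a linear
  correction matching both end points; on coarse elements this is done for \<open>S\<close> only and \<open>E\<close> is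
  replaced by its linear interpolant. The resulting interpolation error \<open>\<eta>\<close> has no jumps, so Galerkin
  orthogonality and Young's inequality bound the NIPG error by the volume norms of \<open>\<eta>\<close> and the
  weighted traces \<open>\<epsilon>\<^sup>4\<langle>\<eta>'\<rangle>\<^sup>2 / \<sigma>\<close>. On the layer part of the mesh
  \<open>h\<^sub>i exp (- \<phi>\<^sub>i\<^sub>-\<^sub>1) \<le> C \<epsilon> N\<^sup>-\<^sup>1 max |\<psi>'|\<close>; one factor of this kind is summed over the
  elements, which is why the extra power of \<open>max |\<psi>'|\<close> absorbs all logarithms.\<close>

section \<open>Regularity on the unit interval and weighted derivative bounds\<close>

text \<open>The obstacle is that element widths and e are decoupled. In the layers h is at most a
  multiple of e, so scaled derivatives of all of u are usable; on coarse elements h / e is unbounded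
  and only the size of E helps. It suffices there because the factor (k+1)/gamma in the transition
  point makes the layer functions at most N^-(k+1). The floor e^(2k+2) of the bound on E has that
  order too, as e <= Ceps/N, so an expansion with k+1 terms is long enough. Nothing forces e <= 1.
  The constants therefore carry an upper bound \<open>e0\<close> for e, finally Ceps, and all of
  them are fixed before e, N, the mesh and u. Matching u at the mesh points matters because a jump
  of eta would leave the term e^2 [eta] <xi'>, which calls for an inverse inequality. With M = max
  |psi'|, the layer elements together contribute e M (M/N)^(2k) to the squared error; M >= 1 turns
  the single M into M^2, and this is the origin of the power k+1 in the rate.\<close>

primrec Ck :: "nat \<Rightarrow> (real \<Rightarrow> real) \<Rightarrow> bool" where
  "Ck 0 g = continuous_on {0..1} g"
| "Ck (Suc n) g = (\<exists>g'. (\<forall>x\<in>{0..1}. (g has_real_derivative g' x) (at x within {0..1})) \<and> Ck n g')"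

lemma continuous_on_if_has_real_derivative:
  assumes "\<And>x. x \<in> S \<Longrightarrow> (g has_real_derivative g' x) (at x within S)"
  shows "continuous_on S g"
  using assms DERIV_continuous continuous_on_eq_continuous_within by blast

lemma has_real_derivative_within_unique:
  fixes g :: "real \<Rightarrow> real"
  assumes "a < b" "x \<in> {a..b}"
    and "(g has_real_derivative d) (at x within {a..b})"
    and "(g has_real_derivative d') (at x within {a..b})"
  shows "d = d'"
  using assms vector_derivative_unique_within_closed_interval[of a b x g d d']
  by (simp add: has_real_derivative_iff_has_vector_derivative)

lemma Ck_cong:
  assumes "\<And>x. x \<in> {0..1} \<Longrightarrow> g x = h x"
  shows "Ck n g \<longleftrightarrow> Ck n h"
proof (cases n)
  case 0
  then show ?thesis using assms continuous_on_cong[of "{0..1}" "{0..1}" g h] by simp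
next
  case (Suc m)
  have "(\<forall>x\<in>{0..1}. (g has_real_derivative g' x) (at x within {0..1}))
    \<longleftrightarrow> (\<forall>x\<in>{0..1}. (h has_real_derivative g' x) (at x within {0..1}))" for g'
    using assms has_field_derivative_transform_within[where d = 1 and S = "{0..1}"]
    by (metis zero_less_one)
  then show ?thesis by (simp add: Suc)
qed

lemma Ck_continuous: "Ck n g \<Longrightarrow> continuous_on {0..1} g"
  by (cases n) (auto intro: continuous_on_if_has_real_derivative)

text \<open>The derivative in \<open>Ck\<close> is an existential witness. One-sided derivatives on
  a nondegenerate interval are unique, so any derivative of g on [0,1] inherits the regularity of
  the witness.\<close>

lemma Ck_SucD:
  assumes "Ck (Suc n) g" "\<And>x. x \<in> {0..1} \<Longrightarrow> (g has_real_derivative g' x) (at x within {0..1})"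
  shows "Ck n g'"
proof -
  obtain h where h: "\<forall>x\<in>{0..1}. (g has_real_derivative h x) (at x within {0..1})" "Ck n h"
    using assms(1) by auto
  have "h x = g' x" if "x \<in> {0..1}" for x
    using has_real_derivative_within_unique[of 0 1 x g] h(1) assms(2) that by auto
  then show ?thesis using h(2) Ck_cong by blast
qed

lemma Ck_mono: "Ck (Suc n) g \<Longrightarrow> Ck n g"
proof (induction n arbitrary: g)
  case 0
  then have "continuous_on {0..1} g" by (rule Ck_continuous)
  then show ?case by simp
next
  case (Suc n) then show ?case by (metis Ck.simps(2))
qed

lemma Ck_add: "Ck n f \<Longrightarrow> Ck n g \<Longrightarrow> Ck n (\<lambda>x. f x + g x)"
proof (induction n arbitrary: f g)
  case 0 then show ?case by (auto intro!: continuous_intros)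
next
  case (Suc n)
  obtain f' g' where "\<forall>x\<in>{0..1}. (f has_real_derivative f' x) (at x within {0..1})" "Ck n f'"
    "\<forall>x\<in>{0..1}. (g has_real_derivative g' x) (at x within {0..1})" "Ck n g'"
    using Suc.prems by auto
  then show ?case
    using Suc.IH by (auto intro!: exI[of _ "\<lambda>x. f' x + g' x"] DERIV_add)
qed

lemma Ck_const: "Ck n (\<lambda>x. r)"
proof (induction n arbitrary: r)
  case 0 then show ?case by auto
next
  case (Suc n) then show ?case by (auto intro!: exI[of _ "\<lambda>x. 0"])
qed

lemma Ck_mult: "Ck n f \<Longrightarrow> Ck n g \<Longrightarrow> Ck n (\<lambda>x. f x * g x)"
proof (induction n arbitrary: f g)
  case 0 then show ?case by (auto intro!: continuous_intros)
next
  case (Suc n)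
  obtain f' g' where fg: "\<forall>x\<in>{0..1}. (f has_real_derivative f' x) (at x within {0..1})" "Ck n f'"
    "\<forall>x\<in>{0..1}. (g has_real_derivative g' x) (at x within {0..1})" "Ck n g'"
    using Suc.prems by auto
  have "Ck n (\<lambda>x. f x * g' x + f' x * g x)"
    using Ck_add Suc.IH Suc.prems Ck_mono fg by blast
  moreover have "((\<lambda>x. f x * g x) has_real_derivative f x * g' x + f' x * g x) (at x within {0..1})"
    if "x \<in> {0..1}" for x
    using fg that by (intro DERIV_mult') auto
  ultimately show ?case
    unfolding Ck.simps by (intro exI[of _ "\<lambda>x. f x * g' x + f' x * g x"]) auto
qed

lemma Ck_inverse: "Ck n c \<Longrightarrow> (\<And>x. x \<in> {0..1} \<Longrightarrow> c x \<noteq> 0) \<Longrightarrow> Ck n (\<lambda>x. inverse (c x))"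
proof (induction n)
  case 0 then show ?case by (auto intro!: continuous_intros)
next
  case (Suc n)
  obtain c' where c: "\<forall>x\<in>{0..1}. (c has_real_derivative c' x) (at x within {0..1})" "Ck n c'"
    using Suc.prems by auto
  have "Ck n (\<lambda>x. inverse (c x))" using Suc Ck_mono by blast
  then have "Ck n (\<lambda>x. (-1) * (inverse (c x) * c' x * inverse (c x)))"
    by (intro Ck_mult Ck_const c(2))
  moreover have "((\<lambda>x. inverse (c x)) has_real_derivative (-1) * (inverse (c x) * c' x * inverse (c x)))
      (at x within {0..1})" if "x \<in> {0..1}" for x
    using DERIV_inverse'[of c "c' x" x "{0..1}"] c that Suc.prems(2) by simp
  ultimately show ?case
    unfolding Ck.simps by (intro exI[of _ "\<lambda>x. (-1) * (inverse (c x) * c' x * inverse (c x))"]) auto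
qed

text \<open>The data are smooth in terms of iterated two-sided \<open>deriv\<close>; derivatives
  within [0,1] are the form that suits functions known only on the closed interval. Inducting for
  all iterates j at once makes the next iterate the witness.\<close>

lemma smooth_on_Ck:
  assumes "smooth_on S g" "{0..1} \<subseteq> S"
  shows "Ck n g"
proof -
  have "Ck n ((deriv ^^ j) g)" for j
  proof (induction n arbitrary: j)
    case 0
    show ?case using assms unfolding smooth_on_def
      by (auto intro!: differentiable_imp_continuous_on differentiable_at_imp_differentiable_on)
  next
    case (Suc n)
    have "((deriv ^^ j) g has_real_derivative (deriv ^^ Suc j) g x) (at x within {0..1})"
      if "x \<in> {0..1}" for x
    proof -
      have "(deriv ^^ j) g differentiable (at x)" using assms that unfolding smooth_on_def by blast
      then show ?thesis
        by (simp add: DERIV_deriv_iff_real_differentiable has_field_derivative_at_within)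
    qed
    then show ?case using Suc.IH[of "Suc j"] unfolding Ck.simps by blast
  qed
  from this[of 0] show ?thesis by simp
qed

section \<open>Calculus of weighted derivative bounds\<close>

text \<open>\<open>Wd e w n a g\<close>: the scaled derivatives \<open>e\<^sup>j g\<^sup>(\<^sup>j\<^sup>)\<close>, \<open>j \<le> n\<close>, are all bounded by \<open>a * w\<close> on \<open>[0, 1]\<close>.\<close>

primrec Wd :: "real \<Rightarrow> (real \<Rightarrow> real) \<Rightarrow> nat \<Rightarrow> real \<Rightarrow> (real \<Rightarrow> real) \<Rightarrow> bool" where
  "Wd e w 0 a g = (\<forall>x\<in>{0..1}. \<bar>g x\<bar> \<le> a * w x)"
| "Wd e w (Suc n) a g = (\<exists>g'. (\<forall>x\<in>{0..1}. (g has_real_derivative g' x) (at x within {0..1}) \<and>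
       \<bar>g x\<bar> \<le> a * w x) \<and> Wd e w n a (\<lambda>x. e * g' x))"

lemma Wd_bound: "Wd e w n a g \<Longrightarrow> x \<in> {0..1} \<Longrightarrow> \<bar>g x\<bar> \<le> a * w x"
  by (cases n) auto

lemma Wd_le:
  assumes "Wd e w n a g" "a \<le> b" "\<And>x. x \<in> {0..1} \<Longrightarrow> 0 \<le> w x"
  shows "Wd e w n b g"
proof -
  have *: "z \<le> a * w x \<Longrightarrow> z \<le> b * w x" if "x \<in> {0..1}" for x z
    using mult_right_mono[OF assms(2) assms(3)[OF that]] by linarith
  show ?thesis using assms(1)
  proof (induction n arbitrary: g)
    case 0 then show ?case using * by auto
  next
    case (Suc n) then show ?case using * by (simp, metis)
  qed
qed

lemma Wd_weight_le:
  assumes "Wd e w n a g" "0 \<le> a" "\<And>x. x \<in> {0..1} \<Longrightarrow> w x \<le> v x"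
  shows "Wd e v n a g"
proof -
  have *: "z \<le> a * w x \<Longrightarrow> z \<le> a * v x" if "x \<in> {0..1}" for x z
    using mult_left_mono[OF assms(3)[OF that] assms(2)] by linarith
  show ?thesis using assms(1)
  proof (induction n arbitrary: g)
    case 0 then show ?case using * by auto
  next
    case (Suc n) then show ?case using * by (simp, metis)
  qed
qed

lemma Wd_mono: "Wd e w (Suc n) a g \<Longrightarrow> Wd e w n a g"
proof (induction n arbitrary: g)
  case 0 then show ?case by auto
next
  case (Suc n) then show ?case by (metis Wd.simps(2))
qed

lemma Wd_add: "Wd e w n a f \<Longrightarrow> Wd e w n b g \<Longrightarrow> Wd e w n (a + b) (\<lambda>x. f x + g x)"
proof (induction n arbitrary: f g)
  case 0 then show ?case by (fastforce simp: distrib_right)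
next
  case (Suc n)
  obtain f' g' where fg: "\<forall>x\<in>{0..1}. (f has_real_derivative f' x) (at x within {0..1}) \<and> \<bar>f x\<bar> \<le> a * w x"
    "Wd e w n a (\<lambda>x. e * f' x)"
    "\<forall>x\<in>{0..1}. (g has_real_derivative g' x) (at x within {0..1}) \<and> \<bar>g x\<bar> \<le> b * w x"
    "Wd e w n b (\<lambda>x. e * g' x)"
    using Suc.prems by auto
  have "Wd e w n (a + b) (\<lambda>x. e * (f' x + g' x))"
    using Suc.IH[OF fg(2,4)] by (simp add: distrib_left)
  moreover have "\<bar>f x + g x\<bar> \<le> (a + b) * w x" if "x \<in> {0..1}" for x
    using fg that by (fastforce simp: distrib_right)
  moreover have "((\<lambda>x. f x + g x) has_real_derivative f' x + g' x) (at x within {0..1})"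
    if "x \<in> {0..1}" for x using fg that by (intro DERIV_add) auto
  ultimately show ?case by (auto intro!: exI[of _ "\<lambda>x. f' x + g' x"])
qed

lemma Wd_cmult: "Wd e w n a f \<Longrightarrow> Wd e w n (\<bar>r\<bar> * a) (\<lambda>x. r * f x)"
proof (induction n arbitrary: f)
  case 0 then show ?case by (auto simp: abs_mult mult_left_mono mult.assoc)
next
  case (Suc n)
  obtain f' where f: "\<forall>x\<in>{0..1}. (f has_real_derivative f' x) (at x within {0..1}) \<and> \<bar>f x\<bar> \<le> a * w x"
    "Wd e w n a (\<lambda>x. e * f' x)"
    using Suc.prems by auto
  have "Wd e w n (\<bar>r\<bar> * a) (\<lambda>x. e * (r * f' x))"
    using Suc.IH[OF f(2)] by (simp add: algebra_simps)
  then show ?case using f(1)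
    by (auto intro!: exI[of _ "\<lambda>x. r * f' x"] DERIV_cmult simp: abs_mult mult_left_mono mult.assoc)
qed

text \<open>Leibniz rule without binomials: each differentiation splits a product into two, hence
  the factor 2^n. Only g carries the weight w; f, later the coefficient c, is bounded by a
  constant.\<close>

lemma Wd_mult:
  assumes "0 \<le> a"
  shows "Wd e (\<lambda>x. 1) n a f \<Longrightarrow> Wd e w n b g \<Longrightarrow> Wd e w n (2 ^ n * (a * b)) (\<lambda>x. f x * g x)"
proof (induction n arbitrary: f g)
  case 0
  show ?case
  proof (simp, intro ballI)
    fix x :: real assume x: "x \<in> {0..1}"
    have "\<bar>f x\<bar> \<le> a" "\<bar>g x\<bar> \<le> b * w x" using 0 x by auto
    then have "\<bar>f x\<bar> * \<bar>g x\<bar> \<le> a * (b * w x)" using assms by (intro mult_mono) auto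
    then show "\<bar>f x * g x\<bar> \<le> a * b * w x" by (simp add: abs_mult mult.assoc)
  qed
next
  case (Suc n)
  obtain f' g' where fg: "\<forall>x\<in>{0..1}. (f has_real_derivative f' x) (at x within {0..1}) \<and> \<bar>f x\<bar> \<le> a"
    "Wd e (\<lambda>x. 1) n a (\<lambda>x. e * f' x)"
    "\<forall>x\<in>{0..1}. (g has_real_derivative g' x) (at x within {0..1}) \<and> \<bar>g x\<bar> \<le> b * w x"
    "Wd e w n b (\<lambda>x. e * g' x)"
    using Suc.prems by auto
  have "Wd e w n (2 ^ n * (a * b) + 2 ^ n * (a * b)) (\<lambda>x. f x * (e * g' x) + (e * f' x) * g x)"
    using Wd_add Suc.IH fg(2,4) Wd_mono[OF Suc.prems(1)] Wd_mono[OF Suc.prems(2)] by blast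
  then have 1: "Wd e w n (2 ^ Suc n * (a * b)) (\<lambda>x. e * (f x * g' x + f' x * g x))"
    by (simp add: algebra_simps)
  have 2: "\<bar>f x * g x\<bar> \<le> 2 ^ Suc n * (a * b) * w x" if "x \<in> {0..1}" for x
  proof -
    have "\<bar>f x\<bar> \<le> a" "\<bar>g x\<bar> \<le> b * w x" using fg that by auto
    then have "\<bar>f x\<bar> * \<bar>g x\<bar> \<le> a * (b * w x)" using assms by (intro mult_mono) auto
    moreover have "0 \<le> \<bar>g x\<bar>" "\<bar>g x\<bar> \<le> b * w x" using fg that by auto
    ultimately have "\<bar>f x\<bar> * \<bar>g x\<bar> \<le> 1 * (a * (b * w x))" "0 \<le> a * (b * w x)" using assms by auto
    moreover have "1 * (a * (b * w x)) \<le> 2 ^ Suc n * (a * (b * w x))"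
      using calculation(2) one_le_power[of "2::real" "Suc n"] by (intro mult_right_mono) simp_all
    ultimately show ?thesis by (simp add: abs_mult algebra_simps)
  qed
  have 3: "((\<lambda>x. f x * g x) has_real_derivative f x * g' x + f' x * g x) (at x within {0..1})"
    if "x \<in> {0..1}" for x
    using fg that by (intro DERIV_mult') auto
  show ?case using 1 2 3 unfolding Wd.simps by (intro exI[of _ "\<lambda>x. f x * g' x + f' x * g x"]) auto
qed

text \<open>The derivatives of a fixed function do not depend on e, and each further factor e is
  paid by \<open>e0\<close>; so a single constant serves all admissible e.\<close>

lemma Ck_Wd:
  assumes "Ck n g" "0 < e0"
  shows "\<exists>a\<ge>0. \<forall>e. 0 < e \<longrightarrow> e \<le> e0 \<longrightarrow> Wd e (\<lambda>x. 1) n a g"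
proof -
  have bd: "\<exists>b\<ge>0. \<forall>x\<in>{0..1}. \<bar>g x\<bar> \<le> b" if "continuous_on {0..1} g" for g :: "real \<Rightarrow> real"
  proof -
    have "bounded (g ` {0..1})" using that compact_continuous_image compact_imp_bounded by blast
    then show ?thesis by (metis bounded_pos image_eqI less_imp_le real_norm_def)
  qed
  show ?thesis using assms(1)
  proof (induction n arbitrary: g)
    case 0 then show ?case using bd by auto
  next
    case (Suc n)
    obtain b where b: "b \<ge> 0" "\<forall>x\<in>{0..1}. \<bar>g x\<bar> \<le> b" using bd Suc.prems Ck_continuous by blast
    obtain g' where g': "\<forall>x\<in>{0..1}. (g has_real_derivative g' x) (at x within {0..1})" "Ck n g'"
      using Suc.prems by auto
    obtain a where a: "a \<ge> 0" "\<And>e. 0 < e \<Longrightarrow> e \<le> e0 \<Longrightarrow> Wd e (\<lambda>x. 1) n a g'"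
      using Suc.IH[OF g'(2)] by auto
    show ?case
    proof (intro exI[of _ "b + e0 * a"] conjI allI impI)
      show "0 \<le> b + e0 * a" using a b assms by auto
      fix e :: real assume e: "0 < e" "e \<le> e0"
      have "\<bar>e\<bar> * a \<le> b + e0 * a" using e a b by (simp add: mult_right_mono add_increasing)
      then have "Wd e (\<lambda>x. 1) n (b + e0 * a) (\<lambda>x. e * g' x)"
        using Wd_le[OF Wd_cmult[OF a(2)[OF e], of e]] by auto
      moreover have "b \<le> b + e0 * a" using a assms by auto
      ultimately show "Wd e (\<lambda>x. 1) (Suc n) (b + e0 * a) g"
        using g' b by (auto intro!: exI[of _ g'] simp del: mult_minus_left intro: order_trans)
    qed
  qed
qed

text \<open>Unrolls the nested existentials of \<open>Wd\<close> into one sequence of derivatives,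
  the form needed for Taylor's theorem.\<close>

lemma Wd_chain:
  assumes "Wd e w n a g" "0 < e"
  shows "\<exists>D. D 0 = g \<and> (\<forall>j<n. \<forall>x\<in>{0..1}. (D j has_real_derivative D (Suc j) x) (at x within {0..1}))
     \<and> (\<forall>j\<le>n. \<forall>x\<in>{0..1}. e ^ j * \<bar>D j x\<bar> \<le> a * w x)"
  using assms(1)
proof (induction n arbitrary: g)
  case 0 then show ?case by (intro exI[of _ "\<lambda>_. g"]) auto
next
  case (Suc n)
  obtain g' where g': "\<forall>x\<in>{0..1}. (g has_real_derivative g' x) (at x within {0..1}) \<and> \<bar>g x\<bar> \<le> a * w x"
    "Wd e w n a (\<lambda>x. e * g' x)" using Suc.prems by auto
  obtain D where D: "D 0 = (\<lambda>x. e * g' x)"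
    "\<And>j x. j < n \<Longrightarrow> x \<in> {0..1} \<Longrightarrow> (D j has_real_derivative D (Suc j) x) (at x within {0..1})"
    "\<And>j x. j \<le> n \<Longrightarrow> x\<in>{0..1} \<Longrightarrow> e ^ j * \<bar>D j x\<bar> \<le> a * w x" using Suc.IH[OF g'(2)] by auto
  \<comment> \<open>The recursive sequence belongs to \<open>e * g'\<close>, so its members are
    divided by e before the shift by one index.\<close>
  define F where "F j = (case j of 0 \<Rightarrow> g | Suc i \<Rightarrow> (\<lambda>x. inverse e * D i x))" for j
  have "(F j has_real_derivative F (Suc j) x) (at x within {0..1})" if "j < Suc n" "x \<in> {0..1}" for j x
  proof (cases j)
    case 0
    then show ?thesis using g' D(1) that assms(2) by (simp add: F_def field_simps)
  next
    case (Suc i)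
    then show ?thesis using that by (simp add: F_def) (intro DERIV_cmult D; simp)
  qed
  moreover have "e ^ j * \<bar>F j x\<bar> \<le> a * w x" if "j \<le> Suc n" "x \<in> {0..1}" for j x
  proof (cases j)
    case 0
    then show ?thesis using g' that by (simp add: F_def)
  next
    case (Suc i)
    then have "e ^ j * \<bar>F j x\<bar> = e ^ i * \<bar>D i x\<bar>"
      using assms(2) by (simp add: F_def abs_mult)
    moreover have "e ^ i * \<bar>D i x\<bar> \<le> a * w x" using D(3) that Suc by simp
    ultimately show ?thesis by simp
  qed
  moreover have "F 0 = g" by (simp add: F_def)
  ultimately show ?case by blast
qed

section \<open>Decomposition of the solution into a smooth part and layers\<close>

text \<open>The reduced solution s = f / c solves the equation up to the residual -e^2 s''. Adding
  e^2 times an approximate solution for the right-hand side s'' gains a factor e^2, which is the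
  induction on m with f arbitrary. S has unscaled derivative bounds, uniform in e; R may depend on e
  and is bounded with scaled derivatives only.\<close>

lemma asymptotic_expansion:
  assumes c: "\<And>n. Ck n c" "\<And>x. x \<in> {0..1} \<Longrightarrow> 0 < c x" and "0 < e0"
  shows "(\<And>n. Ck n f) \<Longrightarrow> \<exists>a\<ge>0. \<forall>e. 0 < e \<longrightarrow> e \<le> e0 \<longrightarrow> (\<exists>S S1 S2 R.
    (\<forall>x\<in>{0..1}. (S has_real_derivative S1 x) (at x within {0..1}) \<and>
       (S1 has_real_derivative S2 x) (at x within {0..1}) \<and>
       - e\<^sup>2 * S2 x + c x * S x - f x = e ^ (2 * m) * R x) \<and>
    Wd 1 (\<lambda>x. 1) n a S \<and> Wd e (\<lambda>x. 1) n a R)"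
proof (induction m arbitrary: f)
  case 0
  \<comment> \<open>For m = 0 the choice S = 0 has the residual -f.\<close>
  have "Ck n (\<lambda>x. (-1) * f x)" using Ck_mult[OF Ck_const 0] .
  then obtain a where a: "a \<ge> 0" "\<And>e. 0 < e \<Longrightarrow> e \<le> e0 \<Longrightarrow> Wd e (\<lambda>x. 1) n a (\<lambda>x. (-1) * f x)"
    using Ck_Wd assms(3) by blast
  obtain b where b: "b \<ge> 0" "Wd 1 (\<lambda>x. 1) n b (\<lambda>x. 0)"
    using Ck_Wd[OF Ck_const[of n 0], of 1] by auto
  show ?case
  proof (intro exI[of _ "a + b"] conjI allI impI)
    show "0 \<le> a + b" using a b by simp
    fix e assume e: "0 < e" "e \<le> e0"
    have "Wd e (\<lambda>x. 1) n (a + b) (\<lambda>x. (-1) * f x)" "Wd 1 (\<lambda>x. 1) n (a + b) (\<lambda>x. 0)"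
      using Wd_le[OF a(2)[OF e], of "a + b"] Wd_le[OF b(2), of "a + b"] a(1) b(1) by auto
    then show "\<exists>S S1 S2 R. (\<forall>x\<in>{0..1}. (S has_real_derivative S1 x) (at x within {0..1}) \<and>
       (S1 has_real_derivative S2 x) (at x within {0..1}) \<and>
       - e\<^sup>2 * S2 x + c x * S x - f x = e ^ (2 * 0) * R x) \<and>
      Wd 1 (\<lambda>x. 1) n (a + b) S \<and> Wd e (\<lambda>x. 1) n (a + b) R"
      by (intro exI[of _ "\<lambda>x. 0"] exI[of _ "\<lambda>x. (-1) * f x"]) auto
  qed
next
  case (Suc m)
  define s where "s = (\<lambda>x. f x * inverse (c x))"
  have s: "Ck n s" for n
    unfolding s_def using c Suc.prems by (intro Ck_mult Ck_inverse) (auto simp: less_imp_neq[THEN not_sym])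
  obtain s1 where s1: "\<forall>x\<in>{0..1}. (s has_real_derivative s1 x) (at x within {0..1})"
    using s[of "Suc 0"] by auto
  have s1C: "Ck n s1" for n using Ck_SucD[OF s] s1 by blast
  obtain s2 where s2: "\<forall>x\<in>{0..1}. (s1 has_real_derivative s2 x) (at x within {0..1})"
    using s1C[of "Suc 0"] by auto
  have s2C: "Ck n s2" for n using Ck_SucD[OF s1C] s2 by blast
  obtain a where a: "a \<ge> 0" and IH: "\<And>e. 0 < e \<Longrightarrow> e \<le> e0 \<Longrightarrow> (\<exists>S S1 S2 R.
    (\<forall>x\<in>{0..1}. (S has_real_derivative S1 x) (at x within {0..1}) \<and>
       (S1 has_real_derivative S2 x) (at x within {0..1}) \<and>
       - e\<^sup>2 * S2 x + c x * S x - s2 x = e ^ (2 * m) * R x) \<and>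
    Wd 1 (\<lambda>x. 1) n a S \<and> Wd e (\<lambda>x. 1) n a R)"
    using Suc.IH[OF s2C] by blast
  obtain b where b: "b \<ge> 0" "Wd 1 (\<lambda>x. 1) n b s"
    using Ck_Wd[OF s[of n], of 1] by auto
  show ?case
  proof (intro exI[of _ "b + e0\<^sup>2 * a + a"] conjI allI impI)
    show "0 \<le> b + e0\<^sup>2 * a + a" using a b by simp
    fix e assume e: "0 < e" "e \<le> e0"
    obtain S S1 S2 R where S: "\<And>x. x \<in> {0..1} \<Longrightarrow> (S has_real_derivative S1 x) (at x within {0..1})"
       "\<And>x. x \<in> {0..1} \<Longrightarrow> (S1 has_real_derivative S2 x) (at x within {0..1})"
       "\<And>x. x \<in> {0..1} \<Longrightarrow> - e\<^sup>2 * S2 x + c x * S x - s2 x = e ^ (2 * m) * R x"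
       "Wd 1 (\<lambda>x. 1) n a S" "Wd e (\<lambda>x. 1) n a R" using IH[OF e] by blast
    have "e\<^sup>2 * a \<le> e0\<^sup>2 * a" using e a by (intro mult_right_mono power_mono) auto
    then have W: "Wd 1 (\<lambda>x. 1) n (b + e0\<^sup>2 * a + a) (\<lambda>x. s x + e\<^sup>2 * S x)"
      using Wd_le[OF Wd_add[OF b(2) Wd_cmult[OF S(4), of "e\<^sup>2"]], of "b + e0\<^sup>2 * a + a"] a by simp
    have W': "Wd e (\<lambda>x. 1) n (b + e0\<^sup>2 * a + a) R"
      using Wd_le[OF S(5), of "b + e0\<^sup>2 * a + a"] a b by simp
    have eq: "- e\<^sup>2 * (s2 x + e\<^sup>2 * S2 x) + c x * (s x + e\<^sup>2 * S x) - f x = e ^ (2 * Suc m) * R x"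
      if "x \<in> {0..1}" for x
    proof -
      have "c x * s x = f x" using c(2)[OF that] by (simp add: s_def)
      then have "- e\<^sup>2 * (s2 x + e\<^sup>2 * S2 x) + c x * (s x + e\<^sup>2 * S x) - f x
        = e\<^sup>2 * (- e\<^sup>2 * S2 x + c x * S x - s2 x)" by (simp add: algebra_simps)
      also have "\<dots> = e\<^sup>2 * (e ^ (2 * m) * R x)" using S(3)[OF that] by simp
      finally show ?thesis by (simp add: power2_eq_square)
    qed
    show "\<exists>S S1 S2 R. (\<forall>x\<in>{0..1}. (S has_real_derivative S1 x) (at x within {0..1}) \<and>
       (S1 has_real_derivative S2 x) (at x within {0..1}) \<and>
       - e\<^sup>2 * S2 x + c x * S x - f x = e ^ (2 * Suc m) * R x) \<and>
      Wd 1 (\<lambda>x. 1) n (b + e0\<^sup>2 * a + a) S \<and> Wd e (\<lambda>x. 1) n (b + e0\<^sup>2 * a + a) R"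
      using S(1,2) s1 s2 eq W W'
      by (intro exI[of _ "\<lambda>x. s x + e\<^sup>2 * S x"] exI[of _ "\<lambda>x. s1 x + e\<^sup>2 * S1 x"]
          exI[of _ "\<lambda>x. s2 x + e\<^sup>2 * S2 x"] exI[of _ R] conjI ballI DERIV_add DERIV_cmult) auto
  qed
qed

section \<open>Regularity of the solution up to the boundary and the maximum principle\<close>

lemma ode_solution_C2_closed:
  fixes u g :: "real \<Rightarrow> real"
  assumes "continuous_on {0..1} u" "continuous_on {0..1} g"
    and "\<And>t. t \<in> {0<..<1} \<Longrightarrow> u differentiable (at t)"
    and "\<And>t. t \<in> {0<..<1} \<Longrightarrow> deriv u differentiable (at t)"
    and "\<And>t. t \<in> {0<..<1} \<Longrightarrow> deriv (deriv u) t = g t"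
  shows "\<exists>u1. \<forall>t\<in>{0..1}. (u has_real_derivative u1 t) (at t within {0..1}) \<and>
      (u1 has_real_derivative g t) (at t within {0..1})"
proof -
  \<comment> \<open>The hypotheses differentiate u in the open interval only. There u' differs by a
    constant from the antiderivative G of the continuous g, so G plus this constant extends u' to
    the end points; integrating once more recovers u on [0,1].\<close>
  define G where "G = (\<lambda>t. integral {0..t} g)"
  have G: "(G has_real_derivative g t) (at t within {0..1})" if "t \<in> {0..1}" for t
    using integral_has_real_derivative[OF assms(2) that] by (simp add: G_def)
  have Gi: "(G has_real_derivative g t) (at t)" if "t \<in> {0<..<1}" for t
    using G[of t] that by (simp add: at_within_Icc_at)
  have "((\<lambda>t. deriv u t - G t) has_real_derivative 0) (at t within {0<..<1})" if "t \<in> {0<..<1}" for t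
  proof -
    have "(deriv u has_real_derivative g t) (at t)"
      using assms(4,5) that DERIV_deriv_iff_real_differentiable by metis
    from DERIV_diff[OF this Gi[OF that]] show ?thesis by (simp add: has_field_derivative_at_within)
  qed
  then obtain C where C: "\<And>t. t \<in> {0<..<1} \<Longrightarrow> deriv u t - G t = C"
    using has_field_derivative_zero_constant[of "{0<..<1::real}" "\<lambda>t. deriv u t - G t"] by auto
  define u1 where "u1 = (\<lambda>t. G t + C)"
  have u1: "(u1 has_real_derivative g t) (at t within {0..1})" if "t \<in> {0..1}" for t
    using DERIV_add[OF G[OF that] DERIV_const[of C]] by (simp add: u1_def)
  define H where "H = (\<lambda>t. integral {0..t} u1)"
  have H: "(H has_real_derivative u1 t) (at t within {0..1})" if "t \<in> {0..1}" for t
    using integral_has_real_derivative[of 0 1 u1 t] continuous_on_if_has_real_derivative[OF u1] that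
    by (simp add: H_def)
  have "u t - H t = u 0 - H 0" if "t \<in> {0..1}" for t
  proof (rule DERIV_isconst2[of 0 1 "\<lambda>t. u t - H t"])
    show "continuous_on {0..1} (\<lambda>t. u t - H t)"
      using assms(1) continuous_on_if_has_real_derivative[OF H] by (intro continuous_on_diff)
    fix x :: real assume x: "0 < x" "x < 1"
    have "(u has_real_derivative deriv u x) (at x)"
      using assms(3) x by (simp add: DERIV_deriv_iff_real_differentiable)
    moreover have "deriv u x = u1 x" using C[of x] x by (simp add: u1_def)
    moreover have "(H has_real_derivative u1 x) (at x)"
      using H[of x] x by (simp add: at_within_Icc_at)
    ultimately show "((\<lambda>t. u t - H t) has_real_derivative 0) (at x)"
      using DERIV_diff[of u "u1 x" x UNIV H "u1 x"] by simp
  qed (use that in auto)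
  then have ueq: "H t + (u 0 - H 0) = u t" if "t \<in> {0..1}" for t using that by (metis diff_add_cancel add.commute)
  have "(u has_real_derivative u1 t) (at t within {0..1})" if "t \<in> {0..1}" for t
  proof (rule has_field_derivative_transform_within[of "\<lambda>t. H t + (u 0 - H 0)" _ _ _ 1])
    show "((\<lambda>t. H t + (u 0 - H 0)) has_real_derivative u1 t) (at t within {0..1})"
      using DERIV_add[OF H[OF that] DERIV_const[of "u 0 - H 0"]] by simp
  qed (use that ueq in auto)
  then show ?thesis using u1 by blast
qed

text \<open>At a negative minimum, which must be interior, z' = 0 and the differential inequality
  forces z'' < 0. Then z' is negative just to the right, and z drops below its minimum. Only the
  value of z'' at that point enters, not its continuity.\<close>

lemma maximum_principle:
  fixes z :: "real \<Rightarrow> real"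
  assumes z: "\<And>t. t \<in> {0..1} \<Longrightarrow> (z has_real_derivative z1 t) (at t within {0..1})"
    and z1: "\<And>t. t \<in> {0..1} \<Longrightarrow> (z1 has_real_derivative z2 t) (at t within {0..1})"
    and pos: "\<And>t. t \<in> {0..1} \<Longrightarrow> 0 < c t"
    and ge: "\<And>t. t \<in> {0..1} \<Longrightarrow> 0 \<le> - e\<^sup>2 * z2 t + c t * z t"
    and bd: "0 \<le> z 0" "0 \<le> z 1" and "x \<in> {0..1}"
  shows "0 \<le> z x"
proof -
  have "continuous_on {0..1} z" using z by (rule continuous_on_if_has_real_derivative)
  then obtain y where y: "y \<in> {0..1}" "\<And>t. t \<in> {0..1} \<Longrightarrow> z y \<le> z t"
    using continuous_attains_inf[of "{0..1::real}" z] by fastforce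
  have "0 \<le> z y"
  proof (rule ccontr)
    assume neg: "\<not> 0 \<le> z y"
    then have yi: "0 < y" "y < 1" using bd y(1) by (auto simp: less_le)
    have d: "(z has_real_derivative z1 t) (at t)" "(z1 has_real_derivative z2 t) (at t)"
      if "0 < t" "t < 1" for t
      using z[of t] z1[of t] that by (simp_all add: at_within_Icc_at)
    define \<delta> where "\<delta> = min y (1 - y)"
    have "z1 y = 0"
    proof (rule DERIV_local_min[OF d(1)[OF yi], of \<delta>])
      show "\<forall>t. \<bar>y - t\<bar> < \<delta> \<longrightarrow> z y \<le> z t" using y(2) yi by (auto simp: \<delta>_def abs_less_iff)
    qed (use yi in \<open>auto simp: \<delta>_def\<close>)
    have "c y * z y < 0" using pos[OF y(1)] neg by (simp add: mult_pos_neg)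
    then have "e\<^sup>2 * z2 y < 0" using ge[OF y(1)] by linarith
    then have "z2 y < 0" by (simp add: mult_less_0_iff)
    then obtain r where r: "0 < r" "\<And>h. 0 < h \<Longrightarrow> h < r \<Longrightarrow> z1 (y + h) < z1 y"
      using DERIV_neg_dec_right[OF d(2)[OF yi]] by blast
    define h where "h = min r (1 - y) / 2"
    have h: "0 < h" "h < r" "y + h < 1" using r(1) yi by (auto simp: h_def min_def field_simps)
    obtain t where t: "y < t" "t < y + h" "z (y + h) - z y = (y + h - y) * z1 t"
      using MVT2[of y "y + h" z z1] d(1) h yi by (smt (verit))
    have "z1 t < 0" using r(2)[of "t - y"] t h \<open>z1 y = 0\<close> by simp
    then have "h * z1 t < 0" using h by (intro mult_pos_neg)
    then have "z (y + h) < z y" using t(3) by simp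
    then show False using y(2)[of "y + h"] h yi by auto
  qed
  then show ?thesis using y(2)[OF assms(7)] by linarith
qed

text \<open>The exponentials solve e^2 W'' = gamma^2 W and model the two boundary layers. The last
  summand is the size of the expansion residual, which does not decay towards the interior.\<close>

definition layer_weight :: "real \<Rightarrow> real \<Rightarrow> nat \<Rightarrow> real \<Rightarrow> real" where
  "layer_weight \<gamma> e m x = exp (- \<gamma> * x / e) + exp (- \<gamma> * (1 - x) / e) + e ^ (2 * m)"

lemma layer_weight_pos: "0 < e \<Longrightarrow> 0 < layer_weight \<gamma> e m x"
  unfolding layer_weight_def by (intro add_pos_pos) auto

text \<open>A shift by at most e changes each exponent by at most gamma, so on the scale e the
  weight is constant up to the factor exp gamma.\<close>

lemma layer_weight_near:
  assumes "0 < e" "0 \<le> \<gamma>" "\<bar>y - x\<bar> \<le> e"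
  shows "layer_weight \<gamma> e m y \<le> exp \<gamma> * layer_weight \<gamma> e m x"
proof -
  have 1: "exp (- \<gamma> * s / e) \<le> exp \<gamma> * exp (- \<gamma> * t / e)" if "t \<le> s + e" for s t
  proof -
    have "\<gamma> * t \<le> \<gamma> * (s + e)" using that assms by (intro mult_left_mono) auto
    then have "- \<gamma> * s / e \<le> \<gamma> + - \<gamma> * t / e" using assms by (simp add: field_simps)
    then have "exp (- \<gamma> * s / e) \<le> exp (\<gamma> + - \<gamma> * t / e)" by (subst exp_le_cancel_iff)
    also have "\<dots> = exp \<gamma> * exp (- \<gamma> * t / e)" by (rule exp_add)
    finally show ?thesis .
  qed
  have "1 * e ^ (2 * m) \<le> exp \<gamma> * e ^ (2 * m)" using assms by (intro mult_right_mono) auto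
  moreover have "x \<le> y + e" "1 - x \<le> 1 - y + e" using assms(3) by auto
  ultimately show ?thesis
    using 1[of x y] 1[of "1 - x" "1 - y"] unfolding layer_weight_def distrib_left by linarith
qed

text \<open>Comparison with K (W + e^(2m)), for both signs of E. As c >= gamma^2, the differential
  operator maps this barrier to at least c K e^(2m), and the part b / gamma^2 of K makes that
  dominate the residual. The part b dominates the boundary values, since W >= 1 at both
  ends.\<close>

lemma layer_barrier:
  fixes E c :: "real \<Rightarrow> real"
  assumes E: "\<And>t. t \<in> {0..1} \<Longrightarrow> (E has_real_derivative E1 t) (at t within {0..1})"
    and E1: "\<And>t. t \<in> {0..1} \<Longrightarrow> (E1 has_real_derivative E2 t) (at t within {0..1})"
    and c: "\<And>t. t \<in> {0..1} \<Longrightarrow> \<gamma>\<^sup>2 \<le> c t" and "0 < \<gamma>" "0 < e"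
    and eq: "\<And>t. t \<in> {0..1} \<Longrightarrow> e\<^sup>2 * E2 t = c t * E t + \<rho> t"
    and rho: "\<And>t. t \<in> {0..1} \<Longrightarrow> \<bar>\<rho> t\<bar> \<le> b * e ^ (2 * m)"
    and bd: "\<bar>E 0\<bar> \<le> b" "\<bar>E 1\<bar> \<le> b" and "x \<in> {0..1}"
  shows "\<bar>E x\<bar> \<le> (b + b / \<gamma>\<^sup>2) * layer_weight \<gamma> e m x"
proof -
  define K where "K = b + b / \<gamma>\<^sup>2"
  define W where "W t = exp (- \<gamma> * t / e) + exp (- \<gamma> * (1 - t) / e)" for t :: real
  define W1 where "W1 t = - \<gamma> / e * exp (- \<gamma> * t / e) + \<gamma> / e * exp (- \<gamma> * (1 - t) / e)" for t :: real
  define \<delta> where "\<delta> = e ^ (2 * m)"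
  have b: "0 \<le> b" using bd by linarith
  have K: "b \<le> K" "0 \<le> K" "b / \<gamma>\<^sup>2 \<le> K" using b by (auto simp: K_def)
  have dW: "(W has_real_derivative W1 t) (at t within A)" for t A
    unfolding W_def[abs_def] W1_def using \<open>0 < e\<close>
    by (auto intro!: derivative_eq_intros simp: algebra_simps)
  have dW1: "(W1 has_real_derivative (\<gamma>\<^sup>2 / e\<^sup>2 * W t)) (at t within A)" for t A
    unfolding W_def W1_def[abs_def] using \<open>0 < e\<close>
    by (auto intro!: derivative_eq_intros simp: field_simps power2_eq_square)
  have W: "0 < W t" for t unfolding W_def by (intro add_pos_pos) auto
  have main: "0 \<le> K * (W x + \<delta>) + s * E x" if s: "s = 1 \<or> s = -1" for s
  proof (rule maximum_principle[where z = "\<lambda>t. K * (W t + \<delta>) + s * E t" and e = e and c = c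
        and ?z1.0 = "\<lambda>t. K * W1 t + s * E1 t" and ?z2.0 = "\<lambda>t. K * (\<gamma>\<^sup>2 / e\<^sup>2 * W t) + s * E2 t"])
    fix t :: real assume t: "t \<in> {0..1}"
    have "((\<lambda>t. W t + \<delta>) has_real_derivative W1 t + 0) (at t within {0..1})"
      by (intro DERIV_add dW DERIV_const)
    then show "((\<lambda>t. K * (W t + \<delta>) + s * E t) has_real_derivative K * W1 t + s * E1 t) (at t within {0..1})"
      by (intro DERIV_add DERIV_cmult E t) simp
    show "((\<lambda>t. K * W1 t + s * E1 t) has_real_derivative K * (\<gamma>\<^sup>2 / e\<^sup>2 * W t) + s * E2 t) (at t within {0..1})"
      by (intro DERIV_add DERIV_cmult dW1 E1 t)
    have "0 < \<gamma>\<^sup>2" using \<open>0 < \<gamma>\<close> by simp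
    then show "0 < c t" using c[OF t] by linarith
    have "- e\<^sup>2 * (K * (\<gamma>\<^sup>2 / e\<^sup>2 * W t) + s * E2 t) + c t * (K * (W t + \<delta>) + s * E t)
       = K * ((c t - \<gamma>\<^sup>2) * W t) + c t * K * \<delta> - s * (e\<^sup>2 * E2 t - c t * E t)"
      using \<open>0 < e\<close> by (simp add: field_simps)
    also have "\<dots> = K * ((c t - \<gamma>\<^sup>2) * W t) + c t * K * \<delta> - s * \<rho> t" using eq[OF t] by simp
    finally have 1: "- e\<^sup>2 * (K * (\<gamma>\<^sup>2 / e\<^sup>2 * W t) + s * E2 t) + c t * (K * (W t + \<delta>) + s * E t)
      = K * ((c t - \<gamma>\<^sup>2) * W t) + c t * K * \<delta> - s * \<rho> t" .
    have "0 \<le> K * ((c t - \<gamma>\<^sup>2) * W t)" using K(2) c[OF t] W[of t] by simp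
    moreover have "s * \<rho> t \<le> c t * K * \<delta>"
    proof -
      have "b = \<gamma>\<^sup>2 * (b / \<gamma>\<^sup>2)" using \<open>0 < \<gamma>\<close> by simp
      also have "\<dots> \<le> c t * K" using K b c[OF t] \<open>0 < c t\<close> by (intro mult_mono) auto
      finally have "b * \<delta> \<le> c t * K * \<delta>" using \<open>0 < e\<close> by (intro mult_right_mono) (auto simp: \<delta>_def)
      moreover have "s * \<rho> t \<le> \<bar>\<rho> t\<bar>" using s by auto
      ultimately show ?thesis using rho[OF t] by (simp add: \<delta>_def)
    qed
    ultimately show "0 \<le> - e\<^sup>2 * (K * (\<gamma>\<^sup>2 / e\<^sup>2 * W t) + s * E2 t) + c t * (K * (W t + \<delta>) + s * E t)"
      unfolding 1 by linarith
  next
    have "0 \<le> \<delta>" using \<open>0 < e\<close> by (simp add: \<delta>_def)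
    then have "1 \<le> W 0 + \<delta>" "1 \<le> W 1 + \<delta>" by (auto simp: W_def)
    then have "K * 1 \<le> K * (W 0 + \<delta>)" "K * 1 \<le> K * (W 1 + \<delta>)" using K(2) by (intro mult_left_mono; simp)+
    moreover have "- b \<le> s * E 0" "- b \<le> s * E 1" using s bd by auto
    ultimately show "0 \<le> K * (W 0 + \<delta>) + s * E 0" "0 \<le> K * (W 1 + \<delta>) + s * E 1" using K by linarith+
  qed (use assms in auto)
  show ?thesis
    using main[of 1] main[of "-1"] unfolding layer_weight_def K_def[symmetric] W_def \<delta>_def by auto
qed

text \<open>A Taylor step of length theta e expresses E' by a difference of two values of E and a
  second-order remainder. Each of these three contributions costs exp gamma for comparing the weight
  at different points, and dividing by the step length leaves 1 / theta.\<close>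

lemma layer_derivative_bound:
  fixes E :: "real \<Rightarrow> real"
  assumes E: "\<And>t. t \<in> {0..1} \<Longrightarrow> (E has_real_derivative E1 t) (at t within {0..1})"
    and E1: "\<And>t. t \<in> {0..1} \<Longrightarrow> (E1 has_real_derivative E2 t) (at t within {0..1})"
    and b0: "\<And>t. t \<in> {0..1} \<Longrightarrow> \<bar>E t\<bar> \<le> b * layer_weight \<gamma> e m t"
    and b2: "\<And>t. t \<in> {0..1} \<Longrightarrow> e\<^sup>2 * \<bar>E2 t\<bar> \<le> b * layer_weight \<gamma> e m t"
    and "0 \<le> b" "0 < \<gamma>" "0 < e" "0 < \<theta>" "\<theta> \<le> 1" "\<theta> * e \<le> 1/2" and x: "x \<in> {0..1}"
  shows "e * \<bar>E1 x\<bar> \<le> 3 / \<theta> * exp \<gamma> * b * layer_weight \<gamma> e m x"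
proof -
  let ?w = "layer_weight \<gamma> e m"
  \<comment> \<open>The step points away from the nearer end, so with theta e <= 1/2 it stays in
    [0,1].\<close>
  define h where "h = (if x \<le> 1/2 then \<theta> * e else - (\<theta> * e))"
  define y where "y = x + h"
  have h: "\<bar>h\<bar> = \<theta> * e" using assms by (simp add: h_def)
  have "0 < \<theta> * e" using assms by simp
  then have yin: "y \<in> {0..1}" using x \<open>\<theta> * e \<le> 1/2\<close> by (auto simp: y_def h_def)
  have he: "\<bar>h\<bar> \<le> e" using h assms by simp
  define B where "B = b * (exp \<gamma> * ?w x) / e\<^sup>2"
  have near: "b * ?w t \<le> b * (exp \<gamma> * ?w x)" if "\<bar>t - x\<bar> \<le> \<bar>h\<bar>" for t
    using layer_weight_near[of e \<gamma> t x m] that he assms by (intro mult_left_mono) auto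
  define F where "F j = (if j = 0 then E else if j = Suc 0 then E1 else E2)" for j :: nat
  let ?S = "closed_segment x y"
  have sub: "?S \<subseteq> {0..1}" using x yin by (simp add: closed_segment_eq_real_ivl)
  have "norm (F 0 y - (\<Sum>i\<le>1. F i x * (y - x) ^ i / fact i)) \<le> B * norm (y - x) ^ Suc 1 / fact 1"
  proof (rule field_Taylor[where S = "?S"])
    fix i t assume t: "t \<in> ?S" and i: "i \<le> (1::nat)"
    have "t \<in> {0..1}" using sub t by auto
    then show "(F i has_real_derivative F (Suc i) t) (at t within ?S)"
      using i E[of t] E1[of t] sub by (cases i) (auto simp: F_def intro: DERIV_subset)
  next
    fix t assume t: "t \<in> ?S"
    then have "t \<in> {0..1}" "\<bar>t - x\<bar> \<le> \<bar>h\<bar>"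
      using sub by (auto simp: y_def closed_segment_eq_real_ivl split: if_splits)
    then have "e\<^sup>2 * \<bar>E2 t\<bar> \<le> b * (exp \<gamma> * ?w x)" using b2 near by fastforce
    then show "norm (F (Suc 1) t) \<le> B"
      using \<open>0 < e\<close> by (simp add: F_def B_def field_simps)
  qed auto
  then have T: "\<bar>E y - E x - E1 x * h\<bar> \<le> B * h\<^sup>2"
    by (simp add: F_def y_def algebra_simps power2_eq_square)
  have "\<bar>E1 x * h\<bar> \<le> \<bar>E y\<bar> + \<bar>E x\<bar> + B * h\<^sup>2" using T by linarith
  also have "\<dots> \<le> b * (exp \<gamma> * ?w x) + b * (exp \<gamma> * ?w x) + B * h\<^sup>2"
    using b0[OF yin] b0[OF x] near[of y] near[of x] by (simp add: y_def)
  also have "B * h\<^sup>2 \<le> b * (exp \<gamma> * ?w x)"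
  proof -
    have "h\<^sup>2 \<le> e\<^sup>2" using he \<open>0 < e\<close> by (metis abs_ge_zero power2_abs power_mono)
    then have "b * (exp \<gamma> * ?w x) * (h\<^sup>2 / e\<^sup>2) \<le> b * (exp \<gamma> * ?w x) * 1"
      using assms layer_weight_pos[of e \<gamma> m x] by (intro mult_left_mono) (auto simp: field_simps)
    then show ?thesis by (simp add: B_def)
  qed
  finally have "\<theta> * (e * \<bar>E1 x\<bar>) \<le> 3 * (b * (exp \<gamma> * ?w x))" by (simp add: abs_mult h algebra_simps)
  then show ?thesis using \<open>0 < \<theta>\<close> by (simp add: field_simps)
qed

text \<open>The equation makes the second scaled derivative of E equal to c E + rho, so n scaled
  derivatives of E and rho yield n + 2 of E. The induction starts from E and e E', and the constant
  is fixed before e, E and rho.\<close>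

lemma layer_regularity:
  assumes c: "\<And>n. Ck n c" and "0 < e0" "0 \<le> b"
  shows "\<exists>A\<ge>0. \<forall>e E E1 \<rho>. 0 < e \<longrightarrow> e \<le> e0 \<longrightarrow>
    (\<forall>x\<in>{0..1}. (E has_real_derivative E1 x) (at x within {0..1}) \<and>
      (E1 has_real_derivative (c x * E x + \<rho> x) / e\<^sup>2) (at x within {0..1}) \<and>
      \<bar>E x\<bar> \<le> b * layer_weight \<gamma> e m x \<and> e * \<bar>E1 x\<bar> \<le> b * layer_weight \<gamma> e m x) \<longrightarrow>
    Wd e (layer_weight \<gamma> e m) n b \<rho> \<longrightarrow> Wd e (layer_weight \<gamma> e m) (Suc n) A E"
proof (induction n)
  case 0
  show ?case
  proof (intro exI[of _ b] conjI allI impI)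
    fix e E E1 and \<rho> :: "real \<Rightarrow> real"
    assume "0 < e" "\<forall>x\<in>{0..1}. (E has_real_derivative E1 x) (at x within {0..1}) \<and>
      (E1 has_real_derivative (c x * E x + \<rho> x) / e\<^sup>2) (at x within {0..1}) \<and>
      \<bar>E x\<bar> \<le> b * layer_weight \<gamma> e m x \<and> e * \<bar>E1 x\<bar> \<le> b * layer_weight \<gamma> e m x"
    then show "Wd e (layer_weight \<gamma> e m) (Suc 0) b E"
      unfolding Wd.simps by (intro exI[of _ E1]) (auto simp: abs_mult)
  qed (fact assms)
next
  case (Suc n)
  obtain A where A: "A \<ge> 0" and IH: "\<And>e E E1 \<rho>. 0 < e \<Longrightarrow> e \<le> e0 \<Longrightarrow>
    (\<forall>x\<in>{0..1}. (E has_real_derivative E1 x) (at x within {0..1}) \<and>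
      (E1 has_real_derivative (c x * E x + \<rho> x) / e\<^sup>2) (at x within {0..1}) \<and>
      \<bar>E x\<bar> \<le> b * layer_weight \<gamma> e m x \<and> e * \<bar>E1 x\<bar> \<le> b * layer_weight \<gamma> e m x) \<Longrightarrow>
    Wd e (layer_weight \<gamma> e m) n b \<rho> \<Longrightarrow> Wd e (layer_weight \<gamma> e m) (Suc n) A E"
    using Suc.IH by blast
  obtain a where a: "a \<ge> 0" "\<And>e. 0 < e \<Longrightarrow> e \<le> e0 \<Longrightarrow> Wd e (\<lambda>x. 1) n a c"
    using Ck_Wd[OF c \<open>0 < e0\<close>] by blast
  define B where "B = b + (2 ^ n * (a * A) + b)"
  have B: "b \<le> B" "2 ^ n * (a * A) + b \<le> B" "0 \<le> B"
    using a(1) A assms(3) by (auto simp: B_def)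
  show ?case
  proof (intro exI[of _ B] conjI allI impI)
    fix e E E1 and \<rho> :: "real \<Rightarrow> real"
    assume e: "0 < e" "e \<le> e0" and *: "\<forall>x\<in>{0..1}. (E has_real_derivative E1 x) (at x within {0..1}) \<and>
      (E1 has_real_derivative (c x * E x + \<rho> x) / e\<^sup>2) (at x within {0..1}) \<and>
      \<bar>E x\<bar> \<le> b * layer_weight \<gamma> e m x \<and> e * \<bar>E1 x\<bar> \<le> b * layer_weight \<gamma> e m x"
      and \<rho>: "Wd e (layer_weight \<gamma> e m) (Suc n) b \<rho>"
    let ?w = "layer_weight \<gamma> e m"
    have w: "0 \<le> ?w x" for x using layer_weight_pos[OF e(1)] by (simp add: less_imp_le)
    have "Wd e ?w n A E" using IH[OF e *] \<rho> Wd_mono by blast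
    then have "Wd e ?w n (2 ^ n * (a * A) + b) (\<lambda>x. c x * E x + \<rho> x)"
      using Wd_add Wd_mult[OF a(1) a(2)[OF e]] Wd_mono[OF \<rho>] by blast
    then have "Wd e ?w n B (\<lambda>x. c x * E x + \<rho> x)" using Wd_le B w by blast
    \<comment> \<open>This is e times the derivative of \<open>e * E1\<close>; the powers of e
      cancel exactly.\<close>
    then have 1: "Wd e ?w n B (\<lambda>x. e * (e * ((c x * E x + \<rho> x) / e\<^sup>2)))"
      using e(1) by (simp add: power2_eq_square)
    have le: "z \<le> b * ?w x \<Longrightarrow> z \<le> B * ?w x" for z x
      using mult_right_mono[OF B(1) w[of x]] by linarith
    have "Wd e ?w (Suc n) B (\<lambda>x. e * E1 x)"
      unfolding Wd.simps
      using 1 * le e(1)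
      by (intro exI[of _ "\<lambda>x. e * ((c x * E x + \<rho> x) / e\<^sup>2)"] conjI ballI DERIV_cmult)
        (auto simp: abs_mult)
    then show "Wd e ?w (Suc (Suc n)) B E"
      using * le unfolding Wd.simps(2)[of e ?w "Suc n"] by (intro exI[of _ E1]) blast
  qed (fact B(3))
qed

text \<open>E = u - S has the boundary values -S(0), -S(1) and satisfies e^2 E'' = c E + rho with
  rho = e^(2m) R, so the barrier, the bound on E' and the bootstrapping apply in turn. Every
  constant is built from bounds that precede e and u.\<close>

lemma solution_decomposition:
  fixes c f :: "real \<Rightarrow> real"
  assumes c: "\<And>n. Ck n c" and f: "\<And>n. Ck n f" and "0 < \<gamma>"
    and cge: "\<And>t. t \<in> {0..1} \<Longrightarrow> \<gamma>\<^sup>2 \<le> c t" and "0 < e0"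
  shows "\<exists>A\<ge>0. \<forall>e u u1. 0 < e \<longrightarrow> e \<le> e0 \<longrightarrow> u 0 = 0 \<longrightarrow> u 1 = 0 \<longrightarrow>
    (\<forall>t\<in>{0..1}. (u has_real_derivative u1 t) (at t within {0..1}) \<and>
       (u1 has_real_derivative (c t * u t - f t) / e\<^sup>2) (at t within {0..1})) \<longrightarrow>
    (\<exists>S E. (\<forall>j<n. \<forall>t\<in>{0..1}. (S j has_real_derivative S (Suc j) t) (at t within {0..1}) \<and>
          (E j has_real_derivative E (Suc j) t) (at t within {0..1})) \<and>
       (\<forall>j\<le>n. \<forall>t\<in>{0..1}. \<bar>S j t\<bar> \<le> A \<and> e ^ j * \<bar>E j t\<bar> \<le> A * layer_weight \<gamma> e m t) \<and>
       (\<forall>t\<in>{0..1}. u t = S 0 t + E 0 t))"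
proof -
  have cpos: "0 < c t" if "t \<in> {0..1}" for t
    using cge[OF that] zero_less_power[OF \<open>0 < \<gamma>\<close>, of 2] by linarith
  obtain a where a: "a \<ge> 0" and ex: "\<And>e. 0 < e \<Longrightarrow> e \<le> e0 \<Longrightarrow> (\<exists>S S1 S2 R.
    (\<forall>x\<in>{0..1}. (S has_real_derivative S1 x) (at x within {0..1}) \<and>
       (S1 has_real_derivative S2 x) (at x within {0..1}) \<and>
       - e\<^sup>2 * S2 x + c x * S x - f x = e ^ (2 * m) * R x) \<and>
    Wd 1 (\<lambda>x. 1) n a S \<and> Wd e (\<lambda>x. 1) n a R)"
    using asymptotic_expansion[OF c cpos \<open>0 < e0\<close> f, of m n] by blast
  obtain ac where ac: "ac \<ge> 0" "Wd 1 (\<lambda>x. 1) 0 ac c"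
    using Ck_Wd[OF c[of 0] zero_less_one] by (metis order_refl zero_less_one)
  \<comment> \<open>\<open>b0\<close> is the constant of the barrier, \<open>b2\<close> bounds c E +
    rho and hence e^2 E'', and \<open>b\<close> below dominates every bound that enters
    \<open>layer_regularity\<close>.\<close>
  define b0 where "b0 = a + a / \<gamma>\<^sup>2"
  define b2 where "b2 = ac * b0 + a + b0"
  \<comment> \<open>Chosen so that theta e <= 1/2 for all e <= \<open>e0\<close>, however large
    \<open>e0\<close> is.\<close>
  define \<theta> where "\<theta> = 1 / (2 * e0 + 1)"
  define b where "b = b2 + a + 3 / \<theta> * exp \<gamma> * b2"
  have th: "0 < \<theta>" "\<theta> \<le> 1" using \<open>0 < e0\<close> by (auto simp: \<theta>_def)
  have b0: "0 \<le> b0" and b2: "0 \<le> b2" "b0 \<le> b2" using a ac by (auto simp: b0_def b2_def)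
  have "0 \<le> 3 / \<theta> * exp \<gamma> * b2" using th b2 by simp
  then have b: "0 \<le> b" "b0 \<le> b" "a \<le> b" "3 / \<theta> * exp \<gamma> * b2 \<le> b" using a b0 b2 by (auto simp: b_def)
  obtain A where A: "A \<ge> 0" and reg: "\<And>e E E1 \<rho>. 0 < e \<Longrightarrow> e \<le> e0 \<Longrightarrow>
    (\<forall>x\<in>{0..1}. (E has_real_derivative E1 x) (at x within {0..1}) \<and>
      (E1 has_real_derivative (c x * E x + \<rho> x) / e\<^sup>2) (at x within {0..1}) \<and>
      \<bar>E x\<bar> \<le> b * layer_weight \<gamma> e m x \<and> e * \<bar>E1 x\<bar> \<le> b * layer_weight \<gamma> e m x) \<Longrightarrow>
    Wd e (layer_weight \<gamma> e m) n b \<rho> \<Longrightarrow> Wd e (layer_weight \<gamma> e m) (Suc n) A E"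
    using layer_regularity[OF c \<open>0 < e0\<close> b(1), of \<gamma> m n] by blast
  show ?thesis
  proof (intro exI[of _ "a + A"] conjI allI impI)
    show "0 \<le> a + A" using a A by simp
    fix e and u u1 :: "real \<Rightarrow> real"
    assume e: "0 < e" "e \<le> e0" and u0: "u 0 = 0" "u 1 = 0"
      and u: "\<forall>t\<in>{0..1}. (u has_real_derivative u1 t) (at t within {0..1}) \<and>
       (u1 has_real_derivative (c t * u t - f t) / e\<^sup>2) (at t within {0..1})"
    let ?w = "layer_weight \<gamma> e m"
    have w: "0 \<le> ?w x" for x using layer_weight_pos[OF e(1)] by (simp add: less_imp_le)
    obtain S S1 S2 R where S: "\<And>x. x \<in> {0..1} \<Longrightarrow> (S has_real_derivative S1 x) (at x within {0..1})"
       "\<And>x. x \<in> {0..1} \<Longrightarrow> (S1 has_real_derivative S2 x) (at x within {0..1})"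
       "\<And>x. x \<in> {0..1} \<Longrightarrow> - e\<^sup>2 * S2 x + c x * S x - f x = e ^ (2 * m) * R x"
       "Wd 1 (\<lambda>x. 1) n a S" "Wd e (\<lambda>x. 1) n a R" using ex[OF e] by blast
    define E E1 \<rho> where "E = (\<lambda>t. u t - S t)" and "E1 = (\<lambda>t. u1 t - S1 t)"
      and "\<rho> = (\<lambda>t. e ^ (2 * m) * R t)"
    have E: "(E has_real_derivative E1 t) (at t within {0..1})" if "t \<in> {0..1}" for t
      unfolding E_def E1_def using u S(1) that by (intro DERIV_diff) auto
    have eqE: "(c t * u t - f t) / e\<^sup>2 - S2 t = (c t * E t + \<rho> t) / e\<^sup>2" if "t \<in> {0..1}" for t
    proof -
      have "f t = c t * S t - e\<^sup>2 * S2 t - \<rho> t" using S(3)[OF that] by (simp add: \<rho>_def)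
      then show ?thesis using e(1) by (simp add: E_def field_simps)
    qed
    have E1: "(E1 has_real_derivative (c t * E t + \<rho> t) / e\<^sup>2) (at t within {0..1})" if "t \<in> {0..1}" for t
      using DERIV_diff[of u1 "(c t * u t - f t) / e\<^sup>2" t "{0..1}" S1 "S2 t"] u S(2) that
      unfolding eqE[OF that] by (simp add: E1_def)
    have Sb: "\<bar>S t\<bar> \<le> a" if "t \<in> {0..1}" for t using Wd_bound[OF S(4) that] by simp
    have \<rho>b: "\<bar>\<rho> t\<bar> \<le> a * e ^ (2 * m)" if "t \<in> {0..1}" for t
      using Wd_bound[OF S(5) that] e(1) by (simp add: \<rho>_def abs_mult mult_right_mono mult.commute)
    have wge: "e ^ (2 * m) \<le> ?w t" for t by (simp add: layer_weight_def)
    have Eb: "\<bar>E t\<bar> \<le> b0 * ?w t" if "t \<in> {0..1}" for t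
      unfolding b0_def
    proof (rule layer_barrier[of E E1 "\<lambda>t. (c t * E t + \<rho> t) / e\<^sup>2" \<gamma> c e \<rho> a m])
      show "\<bar>E 0\<bar> \<le> a" "\<bar>E 1\<bar> \<le> a" using Sb[of 0] Sb[of 1] u0 by (auto simp: E_def)
    qed (use E E1 cge \<rho>b assms e that in auto)
    have E2b: "e\<^sup>2 * \<bar>(c t * E t + \<rho> t) / e\<^sup>2\<bar> \<le> b2 * ?w t" if "t \<in> {0..1}" for t
    proof -
      have "\<bar>c t\<bar> * \<bar>E t\<bar> \<le> ac * (b0 * ?w t)"
        using Wd_bound[OF ac(2) that] Eb[OF that] ac(1) by (intro mult_mono) auto
      moreover have "\<bar>\<rho> t\<bar> \<le> a * ?w t"
        using \<rho>b[OF that] mult_left_mono[OF wge a] by (rule order_trans)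
      moreover have "\<bar>c t * E t + \<rho> t\<bar> \<le> \<bar>c t\<bar> * \<bar>E t\<bar> + \<bar>\<rho> t\<bar>"
        by (metis abs_mult abs_triangle_ineq)
      moreover have "0 \<le> b0 * ?w t" using b0 w by simp
      ultimately have "\<bar>c t * E t + \<rho> t\<bar> \<le> b2 * ?w t"
        unfolding b2_def distrib_right mult.assoc by linarith
      then show ?thesis using e(1) by simp
    qed
    have le: "z \<le> r * ?w x \<Longrightarrow> r \<le> s \<Longrightarrow> z \<le> s * ?w x" for z r s x
      using mult_right_mono[OF _ w[of x]] by (meson order_trans)
    have "\<theta> * e \<le> \<theta> * e0" using e th by simp
    also have "\<theta> * e0 \<le> 1/2" using \<open>0 < e0\<close> by (simp add: \<theta>_def field_simps)
    finally have the: "\<theta> * e \<le> 1/2" .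
    have E1b: "e * \<bar>E1 t\<bar> \<le> 3 / \<theta> * exp \<gamma> * b2 * ?w t" if "t \<in> {0..1}" for t
      by (rule layer_derivative_bound[OF E E1 _ E2b]) (use le[OF Eb b2(2)] b2 assms e th the that in auto)
    have "Wd e (\<lambda>x. e ^ (2 * m)) n a \<rho>"
    proof -
      \<comment> \<open>The small factor has to move into the weight; \<open>Wd_cmult\<close> would
        put it into the constant.\<close>
      have *: "Wd e (\<lambda>x. s) n a (\<lambda>t. s * g t)" if "Wd e (\<lambda>x. 1) n a g" "0 \<le> s" for s g
        using that
      proof (induction n arbitrary: g)
        case 0
        then show ?case by (auto simp: abs_mult mult.commute[of a] intro!: mult_left_mono)
      next
        case (Suc n)
        obtain g' where g': "\<forall>x\<in>{0..1}. (g has_real_derivative g' x) (at x within {0..1}) \<and> \<bar>g x\<bar> \<le> a"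
          "Wd e (\<lambda>x. 1) n a (\<lambda>x. e * g' x)" using Suc.prems by auto
        have "Wd e (\<lambda>x. s) n a (\<lambda>x. e * (s * g' x))"
          using Suc.IH[OF g'(2) Suc.prems(2)] by (simp add: algebra_simps)
        moreover have "\<bar>s * g x\<bar> \<le> a * s" if "x \<in> {0..1}" for x
          using g' that Suc.prems(2) by (auto simp: abs_mult mult.commute[of a] intro!: mult_left_mono)
        ultimately show ?case
          unfolding Wd.simps using g'(1) by (intro exI[of _ "\<lambda>x. s * g' x"] conjI ballI DERIV_cmult) auto
      qed
      show ?thesis unfolding \<rho>_def using *[OF S(5)] e(1) by simp
    qed
    then have "Wd e ?w n a \<rho>" by (rule Wd_weight_le) (use a wge in auto)
    then have "Wd e ?w n b \<rho>" using Wd_le b(3) w by blast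
    moreover have "\<forall>x\<in>{0..1}. (E has_real_derivative E1 x) (at x within {0..1}) \<and>
      (E1 has_real_derivative (c x * E x + \<rho> x) / e\<^sup>2) (at x within {0..1}) \<and>
      \<bar>E x\<bar> \<le> b * ?w x \<and> e * \<bar>E1 x\<bar> \<le> b * ?w x"
      using E E1 le[OF Eb b(2)] le[OF E1b b(4)] by blast
    ultimately have "Wd e ?w n A E" using reg[OF e] Wd_mono by blast
    then obtain DE where DE: "DE 0 = E"
      "\<And>j x. j < n \<Longrightarrow> x \<in> {0..1} \<Longrightarrow> (DE j has_real_derivative DE (Suc j) x) (at x within {0..1})"
      "\<And>j x. j \<le> n \<Longrightarrow> x \<in> {0..1} \<Longrightarrow> e ^ j * \<bar>DE j x\<bar> \<le> A * ?w x"
      using Wd_chain[OF _ e(1)] by metis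
    obtain DS where DS: "DS 0 = S"
      "\<And>j x. j < n \<Longrightarrow> x \<in> {0..1} \<Longrightarrow> (DS j has_real_derivative DS (Suc j) x) (at x within {0..1})"
      "\<And>j x. j \<le> n \<Longrightarrow> x \<in> {0..1} \<Longrightarrow> \<bar>DS j x\<bar> \<le> a"
      using Wd_chain[OF S(4) zero_less_one] by auto
    show "\<exists>S E. (\<forall>j<n. \<forall>t\<in>{0..1}. (S j has_real_derivative S (Suc j) t) (at t within {0..1}) \<and>
          (E j has_real_derivative E (Suc j) t) (at t within {0..1})) \<and>
       (\<forall>j\<le>n. \<forall>t\<in>{0..1}. \<bar>S j t\<bar> \<le> a + A \<and> e ^ j * \<bar>E j t\<bar> \<le> (a + A) * ?w t) \<and>
       (\<forall>t\<in>{0..1}. u t = S 0 t + E 0 t)"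
    proof (rule exI[of _ DS], rule exI[of _ DE], intro conjI ballI allI impI)
      fix j t assume j: "j \<le> n" "t \<in> {0..1::real}"
      show "\<bar>DS j t\<bar> \<le> a + A" using DS(3)[OF j] A by linarith
      show "e ^ j * \<bar>DE j t\<bar> \<le> (a + A) * ?w t" using le[OF DE(3)[OF j], of "a + A"] a by simp
    qed (use DS DE in \<open>auto simp: E_def\<close>)
  qed
qed

section \<open>The NIPG form on a mesh\<close>

locale mesh =
  fixes x :: "nat \<Rightarrow> real" and N :: nat
  assumes N_pos: "0 < N" and x_0: "x 0 = 0" and x_N: "x N = 1"
    and x_less: "\<And>i. i \<in> {1..N} \<Longrightarrow> x (i - 1) < x i"
begin

abbreviation elem :: "nat \<Rightarrow> real set" where "elem i \<equiv> {x (i - 1)..x i}"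

lemma x_mono: "i \<le> j \<Longrightarrow> j \<le> N \<Longrightarrow> x i \<le> x j"
proof (induction j)
  case 0 then show ?case by simp
next
  case (Suc j)
  then show ?case using x_less[of "Suc j"] by (cases "i = Suc j") auto
qed

lemma elem_subset: "i \<in> {1..N} \<Longrightarrow> elem i \<subseteq> {0..1}"
  using x_mono[of 0 "i - 1"] x_mono[of i N] x_0 x_N by auto

text \<open>Derivatives are carried as explicit data. They agree with \<open>bder\<close> on the
  closed elements, so the two one-sided traces at a mesh point are values of two neighbouring
  members of the family \<open>dw\<close>.\<close>

definition broken_C1 :: "broken \<Rightarrow> broken \<Rightarrow> bool" where
  "broken_C1 w dw \<longleftrightarrow> (\<forall>i\<in>{1..N}. continuous_on (elem i) (dw i) \<and>
     (\<forall>t\<in>elem i. (w i has_real_derivative dw i t) (at t within elem i)))"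

lemma broken_C1_D:
  assumes "broken_C1 w dw" "i \<in> {1..N}"
  shows "continuous_on (elem i) (dw i)" "continuous_on (elem i) (w i)"
    "t \<in> elem i \<Longrightarrow> (w i has_real_derivative dw i t) (at t within elem i)"
    "t \<in> elem i \<Longrightarrow> bder x w i t = dw i t"
proof -
  show 1: "continuous_on (elem i) (dw i)"
    and d: "t \<in> elem i \<Longrightarrow> (w i has_real_derivative dw i t) (at t within elem i)" for t
    using assms by (auto simp: broken_C1_def)
  show "continuous_on (elem i) (w i)" using d by (rule continuous_on_if_has_real_derivative)
  show "t \<in> elem i \<Longrightarrow> bder x w i t = dw i t"
    unfolding bder_def
    by (intro vector_derivative_within_closed_interval x_less assms)
      (use d in \<open>auto simp: has_real_derivative_iff_has_vector_derivative\<close>)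
qed

lemma broken_C1_diff:
  assumes "broken_C1 w dw" "broken_C1 v dv"
  shows "broken_C1 (\<lambda>i t. w i t - v i t) (\<lambda>i t. dw i t - dv i t)"
  using assms unfolding broken_C1_def by (auto intro!: continuous_on_diff DERIV_diff)

lemma broken_C1_poly: "broken_C1 (pw_fun P) (pw_fun (\<lambda>i. pderiv (P i)))"
  unfolding broken_C1_def pw_fun_def
  by (auto intro!: continuous_on_poly has_field_derivative_at_within poly_DERIV)

lemma broken_C1_global:
  assumes "\<And>t. t \<in> {0..1} \<Longrightarrow> (u has_real_derivative u1 t) (at t within {0..1})"
    and "continuous_on {0..1} u1"
  shows "broken_C1 (\<lambda>i. u) (\<lambda>i. u1)"
  unfolding broken_C1_def
proof (intro ballI conjI)
  fix i assume i: "i \<in> {1..N}"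
  show "continuous_on (elem i) u1" using assms(2) elem_subset[OF i] continuous_on_subset by blast
  fix t assume t: "t \<in> elem i"
  then show "(u has_real_derivative u1 t) (at t within elem i)"
    using DERIV_subset[OF assms(1) elem_subset[OF i]] elem_subset[OF i] by blast
qed

definition avg :: "broken \<Rightarrow> nat \<Rightarrow> real" where
  "avg dw i = (if i = 0 then dw 1 (x 0) else if i = N then dw N (x N)
     else (dw (i + 1) (x i) + dw i (x i)) / 2)"

lemma avg_der_eq:
  assumes "broken_C1 w dw" "i \<le> N"
  shows "avg_der x N w i = avg dw i"
proof -
  have "bder x w j (x (j - 1)) = dw j (x (j - 1))" "bder x w j (x j) = dw j (x j)" if "j \<in> {1..N}" for j
    using broken_C1_D(4)[OF assms(1) that] x_less[OF that] by auto
  from this[of 1] this[of N] this[of i] this[of "i + 1"] show ?thesis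
    unfolding avg_der_def avg_def using N_pos assms(2) by auto
qed

lemma jump_diff: "jump x N (\<lambda>i t. w i t - v i t) i = jump x N w i - jump x N v i"
  by (simp add: jump_def)

lemma avg_diff: "avg (\<lambda>i t. w i t - v i t) i = avg w i - avg v i"
  by (simp add: avg_def field_simps)

section \<open>The bilinear form: splitting, linearity, consistency and stability\<close>

definition vol :: "real \<Rightarrow> (real \<Rightarrow> real) \<Rightarrow> broken \<Rightarrow> broken \<Rightarrow> broken \<Rightarrow> broken \<Rightarrow> real" where
  "vol e c w dw v dv = (\<Sum>i=1..N. integral (elem i) (\<lambda>t. e\<^sup>2 * dw i t * dv i t + c t * w i t * v i t))"

lemma nipg_a_eq:
  assumes w: "broken_C1 w dw" and v: "broken_C1 v dv"
  shows "nipg_a x N e c \<sigma> w v = vol e c w dw v dv +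
    (\<Sum>i=0..N. e\<^sup>2 * avg dw i * jump x N v i - e\<^sup>2 * jump x N w i * avg dv i
       + \<sigma> i * jump x N w i * jump x N v i)"
proof -
  have "integral (elem i) (\<lambda>t. e\<^sup>2 * bder x w i t * bder x v i t + c t * w i t * v i t)
     = integral (elem i) (\<lambda>t. e\<^sup>2 * dw i t * dv i t + c t * w i t * v i t)" if "i \<in> {1..N}" for i
    using broken_C1_D(4)[OF w that] broken_C1_D(4)[OF v that] by (intro integral_cong) simp
  then show ?thesis
    unfolding nipg_a_def vol_def by (intro arg_cong2[of _ _ _ _ "(+)"] sum.cong refl)
      (auto simp: avg_der_eq[OF w] avg_der_eq[OF v])
qed

text \<open>The opposite signs of the two flux sums make them cancel on the diagonal, so the energy
  consists of the volume part and the penalised jumps.\<close>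

lemma nipg_a_self:
  assumes "broken_C1 w dw"
  shows "nipg_a x N e c \<sigma> w w = vol e c w dw w dw + (\<Sum>i=0..N. \<sigma> i * (jump x N w i)\<^sup>2)"
  unfolding nipg_a_eq[OF assms assms] by (simp add: power2_eq_square mult.commute mult.left_commute)

context
  fixes c :: "real \<Rightarrow> real" and e :: real
  assumes c_cont: "continuous_on {0..1} c"
begin

lemma vol_integrable:
  assumes "broken_C1 w dw" "broken_C1 v dv" "i \<in> {1..N}"
  shows "(\<lambda>t. e\<^sup>2 * dw i t * dv i t + c t * w i t * v i t) integrable_on elem i"
  using broken_C1_D(1,2)[OF assms(1,3)] broken_C1_D(1,2)[OF assms(2,3)]
    continuous_on_subset[OF c_cont elem_subset[OF assms(3)]]
  by (intro integrable_continuous_interval continuous_intros)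

lemma nipg_a_diff_left:
  assumes w: "broken_C1 w dw" and w': "broken_C1 w' dw'" and v: "broken_C1 v dv"
  shows "nipg_a x N e c \<sigma> (\<lambda>i t. w i t - w' i t) v = nipg_a x N e c \<sigma> w v - nipg_a x N e c \<sigma> w' v"
proof -
  have "integral (elem i) (\<lambda>t. e\<^sup>2 * (dw i t - dw' i t) * dv i t + c t * (w i t - w' i t) * v i t)
    = integral (elem i) (\<lambda>t. e\<^sup>2 * dw i t * dv i t + c t * w i t * v i t)
    - integral (elem i) (\<lambda>t. e\<^sup>2 * dw' i t * dv i t + c t * w' i t * v i t)" if "i \<in> {1..N}" for i
    using integral_diff[OF vol_integrable[OF w v that] vol_integrable[OF w' v that]]
    by (simp add: algebra_simps)
  then have "vol e c (\<lambda>i t. w i t - w' i t) (\<lambda>i t. dw i t - dw' i t) v dv = vol e c w dw v dv - vol e c w' dw' v dv"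
    unfolding vol_def by (simp add: sum_subtractf)
  then show ?thesis
    unfolding nipg_a_eq[OF w v] nipg_a_eq[OF w' v] nipg_a_eq[OF broken_C1_diff[OF w w'] v]
    by (simp add: jump_diff avg_diff sum_subtractf sum.distrib algebra_simps)
qed

text \<open>Discrete summation by parts: nodal terms are regrouped by element. The jump conventions
  at the two boundary nodes are what makes the end terms fit.\<close>

lemma sum_jump:
  "(\<Sum>i=0..N. p i * jump x N v i) = (\<Sum>i=1..N. p (i - 1) * v i (x (i - 1)) - p i * v i (x i))"
proof -
  have "(\<Sum>i=0..N. p i * jump x N v i)
    = (\<Sum>i=0..N. (if i < N then p i * v (i + 1) (x i) else 0) - (if 0 < i then p i * v i (x i) else 0))"
    using N_pos by (intro sum.cong) (auto simp: jump_def algebra_simps)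
  also have "\<dots> = (\<Sum>i=0..N. if i < N then p i * v (i + 1) (x i) else 0)
       - (\<Sum>i=0..N. if 0 < i then p i * v i (x i) else 0)"
    by (rule sum_subtractf)
  also have "(\<Sum>i=0..N. if i < N then p i * v (i + 1) (x i) else 0) = (\<Sum>i<N. p i * v (i + 1) (x i))"
    by (rule sum.mono_neutral_cong_right) auto
  also have "\<dots> = (\<Sum>i=1..N. p (i - 1) * v i (x (i - 1)))"
    by (rule sum.reindex_bij_witness[of _ "\<lambda>i. i - 1" Suc]) auto
  also have "(\<Sum>i=0..N. if 0 < i then p i * v i (x i) else 0) = (\<Sum>i=1..N. p i * v i (x i))"
    by (rule sum.mono_neutral_cong_right) auto
  finally show ?thesis by (simp add: sum_subtractf)
qed

text \<open>u has no jumps and vanishes at both ends, so the only surviving nodal terms are e^2 u'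
  [v]. After \<open>sum_jump\<close> they cancel the boundary terms of the elementwise integration
  by parts.\<close>

lemma nipg_consistency:
  assumes u: "\<And>t. t \<in> {0..1} \<Longrightarrow> (u has_real_derivative u1 t) (at t within {0..1})"
    and u1: "\<And>t. t \<in> {0..1} \<Longrightarrow> (u1 has_real_derivative u2 t) (at t within {0..1})"
    and u2: "continuous_on {0..1} u2" and bd: "u 0 = 0" "u 1 = 0"
    and f: "\<And>t. t \<in> {0..1} \<Longrightarrow> - e\<^sup>2 * u2 t + c t * u t = f t"
    and v: "broken_C1 v dv"
  shows "nipg_a x N e c \<sigma> (\<lambda>i. u) v = nipg_l x N f v"
proof -
  have C: "broken_C1 (\<lambda>i. u) (\<lambda>i. u1)" "broken_C1 (\<lambda>i. u1) (\<lambda>i. u2)"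
    using broken_C1_global u u1 u2 continuous_on_if_has_real_derivative by blast+
  have j: "jump x N (\<lambda>i. u) i = 0" for i using bd x_0 x_N by (simp add: jump_def)
  have a: "avg (\<lambda>i. u1) i = u1 (x i)" for i by (simp add: avg_def)
  have el: "integral (elem i) (\<lambda>t. e\<^sup>2 * u1 t * dv i t + c t * u t * v i t)
     = e\<^sup>2 * (u1 (x i) * v i (x i) - u1 (x (i - 1)) * v i (x (i - 1))) + integral (elem i) (\<lambda>t. f t * v i t)"
    if i: "i \<in> {1..N}" for i
  proof -
    have "((\<lambda>t. u1 t * dv i t + u2 t * v i t) has_integral
        u1 (x i) * v i (x i) - u1 (x (i - 1)) * v i (x (i - 1))) (elem i)"
      using x_less[OF i] broken_C1_D(3)[OF C(2) i] broken_C1_D(3)[OF v i]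
      by (intro fundamental_theorem_of_calculus)
        (auto simp: has_real_derivative_iff_has_vector_derivative[symmetric] intro!: DERIV_mult')
    from has_integral_mult_right[OF this, of "e\<^sup>2"]
    have 1: "((\<lambda>t. e\<^sup>2 * (u1 t * dv i t + u2 t * v i t)) has_integral
        e\<^sup>2 * (u1 (x i) * v i (x i) - u1 (x (i - 1)) * v i (x (i - 1)))) (elem i)" .
    have "(\<lambda>t. (- e\<^sup>2 * u2 t + c t * u t) * v i t) integrable_on elem i"
      using broken_C1_D(1,2)[OF C(2) i] broken_C1_D(1,2)[OF C(1) i] broken_C1_D(1,2)[OF v i]
        continuous_on_subset[OF c_cont elem_subset[OF i]]
      by (intro integrable_continuous_interval continuous_intros)
    then have 2: "((\<lambda>t. (- e\<^sup>2 * u2 t + c t * u t) * v i t) has_integral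
        integral (elem i) (\<lambda>t. (- e\<^sup>2 * u2 t + c t * u t) * v i t)) (elem i)"
      by (rule integrable_integral)
    have 3: "integral (elem i) (\<lambda>t. (- e\<^sup>2 * u2 t + c t * u t) * v i t) = integral (elem i) (\<lambda>t. f t * v i t)"
      using f elem_subset[OF i] by (intro integral_cong) (metis subsetD)
    have "(\<lambda>t. e\<^sup>2 * (u1 t * dv i t + u2 t * v i t) + (- e\<^sup>2 * u2 t + c t * u t) * v i t)
       = (\<lambda>t. e\<^sup>2 * u1 t * dv i t + c t * u t * v i t)" by (simp add: algebra_simps)
    with integral_unique[OF has_integral_add[OF 1 2]] show ?thesis unfolding 3 by simp
  qed
  have "vol e c (\<lambda>i. u) (\<lambda>i. u1) v dv = (\<Sum>i=1..N. e\<^sup>2 * (u1 (x i) * v i (x i) - u1 (x (i - 1)) * v i (x (i - 1)))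
      + integral (elem i) (\<lambda>t. f t * v i t))"
    unfolding vol_def by (intro sum.cong refl el)
  also have "\<dots> = - e\<^sup>2 * (\<Sum>i=1..N. u1 (x (i - 1)) * v i (x (i - 1)) - u1 (x i) * v i (x i)) + nipg_l x N f v"
    unfolding nipg_l_def sum_distrib_left sum.distrib[symmetric]
    by (intro sum.cong refl) (simp add: algebra_simps)
  also have "\<dots> = - e\<^sup>2 * (\<Sum>i=0..N. u1 (x i) * jump x N v i) + nipg_l x N f v"
    using sum_jump[of "\<lambda>i. u1 (x i)" v] by simp
  finally show ?thesis
    unfolding nipg_a_eq[OF C(1) v] by (simp add: j a sum_distrib_left sum_negf mult.assoc)
qed

text \<open>To be applied with the interpolation error eta = u - P and the discrete part xi = U - P.
  Without jumps of eta, a(eta, xi) consists of the volume term and the flux of eta against the jumps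
  of xi; Young's inequality lets part of both be absorbed into a(xi, xi) = a(eta, xi). The
  difference eta - xi then follows from (a - b)^2 <= 2 a^2 + 2 b^2.\<close>

lemma nipg_quasi_optimal:
  assumes \<eta>: "broken_C1 \<eta> d\<eta>" and \<xi>: "broken_C1 \<xi> d\<xi>"
    and c: "\<And>t. t \<in> {0..1} \<Longrightarrow> 0 \<le> c t" and \<sigma>: "\<And>i. i \<le> N \<Longrightarrow> 0 < \<sigma> i"
    and orth: "nipg_a x N e c \<sigma> \<eta> \<xi> = nipg_a x N e c \<sigma> \<xi> \<xi>"
    and j: "\<And>i. i \<le> N \<Longrightarrow> jump x N \<eta> i = 0"
  shows "nipg_a x N e c \<sigma> (\<lambda>i t. \<eta> i t - \<xi> i t) (\<lambda>i t. \<eta> i t - \<xi> i t)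
     \<le> 4 * (vol e c \<eta> d\<eta> \<eta> d\<eta> + (\<Sum>i=0..N. e ^ 4 / \<sigma> i * (avg d\<eta> i)\<^sup>2))"
proof -
  define Tr where "Tr = (\<Sum>i=0..N. e ^ 4 / \<sigma> i * (avg d\<eta> i)\<^sup>2)"
  define J where "J = (\<Sum>i=0..N. \<sigma> i * (jump x N \<xi> i)\<^sup>2)"
  let ?V = "vol e c \<eta> d\<eta> \<eta> d\<eta>" and ?X = "vol e c \<xi> d\<xi> \<xi> d\<xi>" and ?M = "vol e c \<eta> d\<eta> \<xi> d\<xi>"
  have J: "0 \<le> J" unfolding J_def using \<sigma> by (intro sum_nonneg) (simp add: less_imp_le)
  have Tr: "0 \<le> Tr" unfolding Tr_def using \<sigma> by (intro sum_nonneg) (simp add: less_imp_le)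
  have young: "2 * (a * b) \<le> a\<^sup>2 + b\<^sup>2" for a b :: real using sum_squares_bound[of a b] by simp
  have le: "2 * (e\<^sup>2 * d\<eta> i t * d\<xi> i t + c t * \<eta> i t * \<xi> i t)
     \<le> (e\<^sup>2 * d\<eta> i t * d\<eta> i t + c t * \<eta> i t * \<eta> i t) + (e\<^sup>2 * d\<xi> i t * d\<xi> i t + c t * \<xi> i t * \<xi> i t)"
    if "i \<in> {1..N}" "t \<in> elem i" for i t
  proof -
    have "0 \<le> c t" using c elem_subset that by blast
    then have "c t * (2 * (\<eta> i t * \<xi> i t)) \<le> c t * ((\<eta> i t)\<^sup>2 + (\<xi> i t)\<^sup>2)"
      using young by (intro mult_left_mono)
    moreover have "e\<^sup>2 * (2 * (d\<eta> i t * d\<xi> i t)) \<le> e\<^sup>2 * ((d\<eta> i t)\<^sup>2 + (d\<xi> i t)\<^sup>2)"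
      using young by (intro mult_left_mono) auto
    ultimately show ?thesis by (simp add: algebra_simps power2_eq_square)
  qed
  have M: "2 * ?M \<le> ?V + ?X"
    unfolding vol_def sum_distrib_left sum.distrib[symmetric]
  proof (rule sum_mono)
    fix i assume i: "i \<in> {1..N}"
    note int = vol_integrable[OF \<eta> \<eta> i] vol_integrable[OF \<xi> \<xi> i] vol_integrable[OF \<eta> \<xi> i]
    show "2 * integral (elem i) (\<lambda>t. e\<^sup>2 * d\<eta> i t * d\<xi> i t + c t * \<eta> i t * \<xi> i t)
       \<le> integral (elem i) (\<lambda>t. e\<^sup>2 * d\<eta> i t * d\<eta> i t + c t * \<eta> i t * \<eta> i t)
        + integral (elem i) (\<lambda>t. e\<^sup>2 * d\<xi> i t * d\<xi> i t + c t * \<xi> i t * \<xi> i t)"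
      unfolding integral_add[OF int(1,2), symmetric] integral_mult_right[symmetric]
      by (intro integral_le integrable_add[OF int(1,2)] integrable_on_mult_right[OF int(3)] le i)
  qed
  have tr: "2 * (e\<^sup>2 * avg d\<eta> i * jump x N \<xi> i) \<le> e ^ 4 / \<sigma> i * (avg d\<eta> i)\<^sup>2 + \<sigma> i * (jump x N \<xi> i)\<^sup>2"
    if "i \<le> N" for i
  proof -
    \<comment> \<open>Splitting sigma as r^2 makes Young's inequality produce e^4 / sigma on the
      trace and sigma on the jump.\<close>
    define r where "r = sqrt (\<sigma> i)"
    have r: "0 < r" "\<sigma> i = r\<^sup>2" using \<sigma>[OF that] by (auto simp: r_def)
    have "2 * ((e\<^sup>2 * avg d\<eta> i / r) * (r * jump x N \<xi> i))
       \<le> (e\<^sup>2 * avg d\<eta> i / r)\<^sup>2 + (r * jump x N \<xi> i)\<^sup>2" by (rule young)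
    then show ?thesis using r(1) unfolding r(2) by (simp add: power_mult_distrib power_divide)
  qed
  have "2 * (\<Sum>i=0..N. e\<^sup>2 * avg d\<eta> i * jump x N \<xi> i) \<le> Tr + J"
    unfolding Tr_def J_def sum_distrib_left sum.distrib[symmetric] using tr by (intro sum_mono) auto
  moreover have a1: "nipg_a x N e c \<sigma> \<eta> \<xi> = ?M + (\<Sum>i=0..N. e\<^sup>2 * avg d\<eta> i * jump x N \<xi> i)"
    unfolding nipg_a_eq[OF \<eta> \<xi>] by (simp add: j)
  moreover have a2: "nipg_a x N e c \<sigma> \<xi> \<xi> = ?X + J" unfolding nipg_a_self[OF \<xi>] J_def ..
  \<comment> \<open>Twice a(xi, xi) is at most the sum of both volume parts, \<open>Tr\<close> and
    \<open>J\<close>; one copy of a(xi, xi) is absorbed on the left.\<close>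
  ultimately have XB: "?X + J \<le> ?V + Tr" using M orth by linarith
  have d: "nipg_a x N e c \<sigma> (\<lambda>i t. \<eta> i t - \<xi> i t) (\<lambda>i t. \<eta> i t - \<xi> i t)
     = vol e c (\<lambda>i t. \<eta> i t - \<xi> i t) (\<lambda>i t. d\<eta> i t - d\<xi> i t) (\<lambda>i t. \<eta> i t - \<xi> i t) (\<lambda>i t. d\<eta> i t - d\<xi> i t) + J"
    unfolding nipg_a_self[OF broken_C1_diff[OF \<eta> \<xi>]] jump_diff J_def by (simp add: j)
  have le': "e\<^sup>2 * (d\<eta> i t - d\<xi> i t) * (d\<eta> i t - d\<xi> i t) + c t * (\<eta> i t - \<xi> i t) * (\<eta> i t - \<xi> i t)
     \<le> 2 * (e\<^sup>2 * d\<eta> i t * d\<eta> i t + c t * \<eta> i t * \<eta> i t) + 2 * (e\<^sup>2 * d\<xi> i t * d\<xi> i t + c t * \<xi> i t * \<xi> i t)"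
    if "i \<in> {1..N}" "t \<in> elem i" for i t
  proof -
    have "0 \<le> c t" using c elem_subset that by blast
    have sq: "(a - b)\<^sup>2 \<le> 2 * a\<^sup>2 + 2 * b\<^sup>2" for a b :: real
      using zero_le_power2[of "a + b"] by (simp add: power2_eq_square algebra_simps)
    have "c t * (\<eta> i t - \<xi> i t)\<^sup>2 \<le> c t * (2 * (\<eta> i t)\<^sup>2 + 2 * (\<xi> i t)\<^sup>2)"
      using sq \<open>0 \<le> c t\<close> by (intro mult_left_mono)
    moreover have "e\<^sup>2 * (d\<eta> i t - d\<xi> i t)\<^sup>2 \<le> e\<^sup>2 * (2 * (d\<eta> i t)\<^sup>2 + 2 * (d\<xi> i t)\<^sup>2)"
      using sq by (intro mult_left_mono) auto
    ultimately show ?thesis by (simp add: algebra_simps power2_eq_square)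
  qed
  have D: "vol e c (\<lambda>i t. \<eta> i t - \<xi> i t) (\<lambda>i t. d\<eta> i t - d\<xi> i t) (\<lambda>i t. \<eta> i t - \<xi> i t) (\<lambda>i t. d\<eta> i t - d\<xi> i t)
     \<le> 2 * ?V + 2 * ?X"
    unfolding vol_def sum_distrib_left sum.distrib[symmetric]
  proof (rule sum_mono)
    fix i assume i: "i \<in> {1..N}"
    note int = vol_integrable[OF \<eta> \<eta> i] vol_integrable[OF \<xi> \<xi> i]
    note int2 = int[THEN integrable_on_mult_right, of 2]
    show "integral (elem i) (\<lambda>t. e\<^sup>2 * (d\<eta> i t - d\<xi> i t) * (d\<eta> i t - d\<xi> i t) + c t * (\<eta> i t - \<xi> i t) * (\<eta> i t - \<xi> i t))
       \<le> 2 * integral (elem i) (\<lambda>t. e\<^sup>2 * d\<eta> i t * d\<eta> i t + c t * \<eta> i t * \<eta> i t)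
        + 2 * integral (elem i) (\<lambda>t. e\<^sup>2 * d\<xi> i t * d\<xi> i t + c t * \<xi> i t * \<xi> i t)"
      unfolding integral_mult_right[symmetric] integral_add[OF int2, symmetric]
      by (intro integral_le integrable_add[OF int2] le' i
          vol_integrable[OF broken_C1_diff[OF \<eta> \<xi>] broken_C1_diff[OF \<eta> \<xi>] i])
  qed
  have "a \<le> 4 * (V + T)"
    if "a = W + J'" "W \<le> 2 * V + 2 * X" "X + J' \<le> V + T" "0 \<le> J'" "0 \<le> T" for a W J' V X T :: real
    using that by argo
  from this[OF d D XB J Tr] show ?thesis unfolding Tr_def .
qed

text \<open>With V = U - P discrete, consistency and the Galerkin equations give a(u - U, V) = 0,
  and u - U = eta - V for eta = u - P. Interpolation at the mesh points removes the jumps of eta,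
  also at the boundary nodes, where the jump is the value up to sign.\<close>

lemma nipg_error_bound:
  assumes "0 < e" and u: "\<And>t. t \<in> {0..1} \<Longrightarrow> (u has_real_derivative u1 t) (at t within {0..1})"
    and u1: "\<And>t. t \<in> {0..1} \<Longrightarrow> (u1 has_real_derivative (c t * u t - f t) / e\<^sup>2) (at t within {0..1})"
    and bd: "u 0 = 0" "u 1 = 0" and f: "continuous_on {0..1} f"
    and c: "\<And>t. t \<in> {0..1} \<Longrightarrow> 0 \<le> c t" and \<sigma>: "\<And>i. i \<le> N \<Longrightarrow> 0 < \<sigma> i"
    and U: "in_VN N k U" and P: "in_VN N k P"
    and gal: "\<And>V. in_VN N k V \<Longrightarrow> nipg_a x N e c \<sigma> (pw_fun U) (pw_fun V) = nipg_l x N f (pw_fun V)"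
    and ip: "\<And>i. i \<in> {1..N} \<Longrightarrow> poly (P i) (x (i - 1)) = u (x (i - 1)) \<and> poly (P i) (x i) = u (x i)"
  shows "nipg_a x N e c \<sigma> (\<lambda>i t. u t - poly (U i) t) (\<lambda>i t. u t - poly (U i) t)
    \<le> 4 * ((\<Sum>i=1..N. integral (elem i) (\<lambda>t. e\<^sup>2 * (u1 t - poly (pderiv (P i)) t)\<^sup>2 + c t * (u t - poly (P i) t)\<^sup>2))
       + (\<Sum>i=0..N. e ^ 4 / \<sigma> i * (avg (\<lambda>i t. u1 t - poly (pderiv (P i)) t) i)\<^sup>2))"
proof -
  define V where "V = (\<lambda>i. U i - P i)"
  define \<eta> where "\<eta> = (\<lambda>i t. u t - pw_fun P i t)"
  define d\<eta> where "d\<eta> = (\<lambda>i t. u1 t - pw_fun (\<lambda>i. pderiv (P i)) i t)"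
  have V: "in_VN N k V" using U P unfolding in_VN_def V_def by (auto intro: degree_diff_le)
  have ucont: "continuous_on {0..1} u" "continuous_on {0..1} u1"
    by (rule continuous_on_if_has_real_derivative, erule u u1)+
  have uC: "broken_C1 (\<lambda>i. u) (\<lambda>i. u1)" using broken_C1_global u ucont by blast
  have \<eta>: "broken_C1 \<eta> d\<eta>" unfolding \<eta>_def d\<eta>_def by (intro broken_C1_diff uC broken_C1_poly)
  note VC = broken_C1_poly[of V]
  have e1: "(\<lambda>i t. \<eta> i t - pw_fun V i t) = (\<lambda>i t. u t - poly (U i) t)"
    by (simp add: \<eta>_def V_def pw_fun_def)
  have "nipg_a x N e c \<sigma> (\<lambda>i t. u t - pw_fun U i t) (pw_fun V) = 0"
    unfolding nipg_a_diff_left[OF uC broken_C1_poly VC] gal[OF V]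
    using \<open>0 < e\<close> ucont f
    by (subst nipg_consistency[OF u u1 _ bd _ VC, where f = f])
      (auto intro!: continuous_intros c_cont)
  then have "nipg_a x N e c \<sigma> (\<lambda>i t. \<eta> i t - pw_fun V i t) (pw_fun V) = 0"
    unfolding e1 by (simp add: pw_fun_def)
  then have orth: "nipg_a x N e c \<sigma> \<eta> (pw_fun V) = nipg_a x N e c \<sigma> (pw_fun V) (pw_fun V)"
    unfolding nipg_a_diff_left[OF \<eta> VC VC] by simp
  have j: "jump x N \<eta> i = 0" if "i \<le> N" for i
    using ip[of 1] ip[of N] ip[of i] ip[of "i + 1"] that N_pos x_0 x_N bd
    unfolding jump_def \<eta>_def pw_fun_def by auto
  have "nipg_a x N e c \<sigma> (\<lambda>i t. u t - poly (U i) t) (\<lambda>i t. u t - poly (U i) t)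
     \<le> 4 * (vol e c \<eta> d\<eta> \<eta> d\<eta> + (\<Sum>i=0..N. e ^ 4 / \<sigma> i * (avg d\<eta> i)\<^sup>2))"
    using nipg_quasi_optimal[OF \<eta> VC c \<sigma> orth j] unfolding e1 by simp
  then show ?thesis
    by (simp add: vol_def \<eta>_def d\<eta>_def pw_fun_def power2_eq_square mult.assoc)
qed

end

end

section \<open>Interpolation on a single element\<close>

text \<open>The Taylor polynomial at the left end plus a multiple of t - alpha, which keeps the left
  value and repairs the right one. Matching the end points thus costs only a factor 2 against the
  Taylor remainder; k >= 1 makes the linear term admissible.\<close>

lemma taylor_interpolant:
  fixes v :: "nat \<Rightarrow> real \<Rightarrow> real"
  assumes "\<alpha> < \<beta>" "1 \<le> k"
    and v: "\<And>j t. j \<le> k \<Longrightarrow> t \<in> {\<alpha>..\<beta>} \<Longrightarrow> (v j has_real_derivative v (Suc j) t) (at t within {\<alpha>..\<beta>})"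
    and B: "\<And>t. t \<in> {\<alpha>..\<beta>} \<Longrightarrow> \<bar>v (Suc k) t\<bar> \<le> B"
  shows "\<exists>p. degree p \<le> k \<and> poly p \<alpha> = v 0 \<alpha> \<and> poly p \<beta> = v 0 \<beta> \<and>
    (\<forall>t\<in>{\<alpha>..\<beta>}. \<bar>v 0 t - poly p t\<bar> \<le> 2 * B * (\<beta> - \<alpha>) ^ Suc k \<and>
       \<bar>v 1 t - poly (pderiv p) t\<bar> \<le> 2 * B * (\<beta> - \<alpha>) ^ k)"
proof -
  obtain m where k: "k = Suc m" using assms(2) by (cases k) auto
  define T where "T = (\<Sum>i\<le>k. smult (v i \<alpha> / fact i) ([:-\<alpha>, 1:] ^ i))"
  define h where "h = \<beta> - \<alpha>"
  have h: "0 < h" using assms by (simp add: h_def)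
  have B0: "0 \<le> B" using B[of \<alpha>] assms(1) by (auto intro: order_trans[OF abs_ge_zero])
  have T: "poly T t = (\<Sum>i\<le>k. v i \<alpha> * (t - \<alpha>) ^ i / fact i)" for t
    by (simp add: T_def poly_sum algebra_simps)
  have T': "poly (pderiv T) t = (\<Sum>i\<le>m. v (Suc i) \<alpha> * (t - \<alpha>) ^ i / fact i)" for t
  proof -
    have "(poly T has_real_derivative (\<Sum>i\<le>Suc m. v i \<alpha> / fact i * (real i * (t - \<alpha>) ^ (i - 1)))) (at t)"
      unfolding T[abs_def] k by (auto intro!: derivative_eq_intros sum.cong simp del: sum.atMost_Suc)
    then have "poly (pderiv T) t = (\<Sum>i\<le>Suc m. v i \<alpha> / fact i * (real i * (t - \<alpha>) ^ (i - 1)))"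
      using poly_DERIV DERIV_unique by blast
    also have "\<dots> = (\<Sum>i\<le>m. v (Suc i) \<alpha> / fact (Suc i) * (real (Suc i) * (t - \<alpha>) ^ i))"
      unfolding sum.atMost_Suc_shift by simp
    also have "\<dots> = (\<Sum>i\<le>m. v (Suc i) \<alpha> * (t - \<alpha>) ^ i / fact i)"
      by (intro sum.cong) (auto simp: field_simps simp del: of_nat_Suc)
    finally show ?thesis .
  qed
  have pw: "B * \<bar>t - \<alpha>\<bar> ^ Suc n / fact n \<le> B * h ^ Suc n" if "t \<in> {\<alpha>..\<beta>}" for t n
  proof -
    have "\<bar>t - \<alpha>\<bar> ^ Suc n \<le> h ^ Suc n" using that by (intro power_mono) (auto simp: h_def)
    moreover have "\<bar>t - \<alpha>\<bar> ^ Suc n / fact n \<le> \<bar>t - \<alpha>\<bar> ^ Suc n / 1"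
      by (intro divide_left_mono) auto
    ultimately have "\<bar>t - \<alpha>\<bar> ^ Suc n / fact n \<le> h ^ Suc n" by linarith
    from mult_left_mono[OF this B0] show ?thesis by simp
  qed
  have R: "\<bar>v 0 t - poly T t\<bar> \<le> B * h ^ Suc k" if "t \<in> {\<alpha>..\<beta>}" for t
  proof -
    have "norm (v 0 t - (\<Sum>i\<le>k. v i \<alpha> * (t - \<alpha>) ^ i / fact i)) \<le> B * norm (t - \<alpha>) ^ Suc k / fact k"
      by (rule field_Taylor[where S = "{\<alpha>..\<beta>}"]) (use v B that assms in auto)
    then show ?thesis using pw[OF that, of k] unfolding T by (simp del: power_Suc)
  qed
  have R': "\<bar>v 1 t - poly (pderiv T) t\<bar> \<le> B * h ^ k" if "t \<in> {\<alpha>..\<beta>}" for t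
  proof -
    have "norm (v (Suc 0) t - (\<Sum>i\<le>m. v (Suc i) \<alpha> * (t - \<alpha>) ^ i / fact i)) \<le> B * norm (t - \<alpha>) ^ Suc m / fact m"
      by (rule field_Taylor[where S = "{\<alpha>..\<beta>}" and f = "\<lambda>i. v (Suc i)"])
        (use v B that assms in \<open>auto simp: k\<close>)
    then show ?thesis using pw[OF that, of m] unfolding T' k by (simp del: power_Suc)
  qed
  \<comment> \<open>The defect at the right end is of order h^(k+1), so this slope is of order h^k
    and spoils neither estimate.\<close>
  define r where "r = (v 0 \<beta> - poly T \<beta>) / h"
  have r: "\<bar>r\<bar> \<le> B * h ^ k"
    using R[of \<beta>] assms(1) h by (simp add: r_def abs_mult field_simps)
  define p where "p = T + smult r [:-\<alpha>, 1:]"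
  have p: "poly p t = poly T t + r * (t - \<alpha>)" "poly (pderiv p) t = poly (pderiv T) t + r" for t
    by (simp_all add: p_def pderiv_add pderiv_smult pderiv_pCons algebra_simps)
  have "degree T \<le> k" unfolding T_def
    by (intro degree_sum_le) (auto intro!: order_trans[OF degree_smult_le] order_trans[OF degree_power_le])
  moreover have "degree (smult r [:-\<alpha>, 1:]) \<le> k" using assms(2) by (intro order_trans[OF degree_smult_le]) simp
  ultimately have "degree p \<le> k" unfolding p_def by (intro degree_add_le)
  moreover have "poly p \<alpha> = v 0 \<alpha>" unfolding p T by (simp add: sum.atMost_shift)
  moreover have "poly p \<beta> = v 0 \<beta>" unfolding p using h by (simp add: r_def h_def)
  moreover have "\<bar>v 0 t - poly p t\<bar> \<le> 2 * B * h ^ Suc k" if "t \<in> {\<alpha>..\<beta>}" for t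
  proof -
    have "\<bar>r * (t - \<alpha>)\<bar> \<le> (B * h ^ k) * h"
      unfolding abs_mult using r that by (intro mult_mono) (auto simp: h_def intro: order_trans[OF abs_ge_zero])
    then show ?thesis using R[OF that] unfolding p by (simp add: algebra_simps)
  qed
  moreover have "\<bar>v 1 t - poly (pderiv p) t\<bar> \<le> 2 * B * h ^ k" if "t \<in> {\<alpha>..\<beta>}" for t
    using R'[OF that] r unfolding p by (simp add: algebra_simps)
  ultimately show ?thesis unfolding h_def by blast
qed

text \<open>Values are convex combinations of the two end values, so only the size of E enters and
  none of its derivatives. This is what is wanted where h / e is large.\<close>

lemma linear_interpolant:
  fixes E :: "real \<Rightarrow> real"
  assumes "\<alpha> < \<beta>" and E: "\<And>t. t \<in> {\<alpha>..\<beta>} \<Longrightarrow> \<bar>E t\<bar> \<le> b"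
  shows "\<exists>p. degree p \<le> 1 \<and> poly p \<alpha> = E \<alpha> \<and> poly p \<beta> = E \<beta> \<and>
    (\<forall>t\<in>{\<alpha>..\<beta>}. \<bar>poly p t\<bar> \<le> b \<and> \<bar>poly (pderiv p) t\<bar> \<le> 2 * b / (\<beta> - \<alpha>))"
proof -
  define r where "r = (E \<beta> - E \<alpha>) / (\<beta> - \<alpha>)"
  define p where "p = [:E \<alpha> - r * \<alpha>, r:]"
  have p: "poly p t = E \<alpha> + r * (t - \<alpha>)" "poly (pderiv p) t = r" for t
    by (simp_all add: p_def pderiv_pCons algebra_simps)
  have ends: "\<bar>E \<alpha>\<bar> \<le> b" "\<bar>E \<beta>\<bar> \<le> b" using E assms(1) by auto
  have "\<bar>poly p t\<bar> \<le> b" if "t \<in> {\<alpha>..\<beta>}" for t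
  proof -
    define s where "s = (t - \<alpha>) / (\<beta> - \<alpha>)"
    have s: "0 \<le> s" "s \<le> 1" using that assms(1) by (auto simp: s_def field_simps)
    have "r * (t - \<alpha>) = s * (E \<beta> - E \<alpha>)" by (simp add: r_def s_def)
    then have "poly p t = (1 - s) * E \<alpha> + s * E \<beta>"
      by (simp add: p algebra_simps)
    also have "\<bar>\<dots>\<bar> \<le> (1 - s) * b + s * b"
      using s ends by (intro order_trans[OF abs_triangle_ineq] add_mono) (auto simp: abs_mult intro!: mult_left_mono)
    finally show ?thesis by (simp add: algebra_simps)
  qed
  moreover have "\<bar>r\<bar> \<le> 2 * b / (\<beta> - \<alpha>)"
    using ends assms(1) by (auto simp: r_def abs_divide intro!: divide_right_mono)
  moreover have "poly p \<beta> = E \<beta>" using assms(1) by (simp add: p r_def)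
  ultimately show ?thesis by (intro exI[of _ p]) (auto simp: p, auto simp: p_def)
qed

text \<open>The first of the two final estimates controls the normal derivative traces on element \<open>[\<alpha>, \<beta>]\<close>,
  the second the squared volume norms; \<open>n\<close> stands for \<open>1 / N\<close>.\<close>
definition good_approx :: "real \<Rightarrow> nat \<Rightarrow> real \<Rightarrow> real \<Rightarrow> real \<Rightarrow> (real \<Rightarrow> real) \<Rightarrow> (real \<Rightarrow> real)
    \<Rightarrow> real \<Rightarrow> real \<Rightarrow> real poly \<Rightarrow> bool" where
  "good_approx K k e n M u u1 \<alpha> \<beta> p \<longleftrightarrow> degree p \<le> k \<and> poly p \<alpha> = u \<alpha> \<and> poly p \<beta> = u \<beta> \<and>
     (\<exists>D\<ge>0. \<exists>G\<ge>0. (\<forall>t\<in>{\<alpha>..\<beta>}. \<bar>u t - poly p t\<bar> \<le> G \<and> \<bar>u1 t - poly (pderiv p) t\<bar> \<le> D) \<and>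
        e * D \<le> K * (n ^ Suc k + (M * n) ^ k) \<and>
        (\<beta> - \<alpha>) * ((e * D)\<^sup>2 + G\<^sup>2)
          \<le> K * ((\<beta> - \<alpha>) * (n ^ Suc k)\<^sup>2 + e * (n * M) * ((M * n) ^ k)\<^sup>2))"

lemma good_approx_mono:
  assumes "good_approx K k e n M u u1 \<alpha> \<beta> p" "K \<le> K'" "0 \<le> e" "0 \<le> n" "0 \<le> M" "\<alpha> \<le> \<beta>"
  shows "good_approx K' k e n M u u1 \<alpha> \<beta> p"
proof -
  have *: "z \<le> K' * r" if "z \<le> K * r" "0 \<le> r" for z r
    using mult_right_mono[OF assms(2) that(2)] that(1) by linarith
  have "0 \<le> n ^ Suc k + (M * n) ^ k"
    "0 \<le> (\<beta> - \<alpha>) * (n ^ Suc k)\<^sup>2 + e * (n * M) * ((M * n) ^ k)\<^sup>2"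
    using assms by (auto intro!: add_nonneg_nonneg mult_nonneg_nonneg)
  then show ?thesis
    using assms(1) * unfolding good_approx_def by blast
qed

text \<open>\<open>E0\<close> stands for exp(-phi) at the element end nearer to the boundary; the
  layer function is its power k + 1. Of these factors, k are paired with (h / e)^k by the last
  hypothesis and give (M n)^k. The remaining one is kept: in the squared norm it meets the element
  length h and yields the summable factor e n M.\<close>

lemma fine_element:
  fixes v :: "nat \<Rightarrow> real \<Rightarrow> real"
  assumes "\<alpha> < \<beta>" "1 \<le> k"
    and v: "\<And>j t. j \<le> k \<Longrightarrow> t \<in> {\<alpha>..\<beta>} \<Longrightarrow> (v j has_real_derivative v (Suc j) t) (at t within {\<alpha>..\<beta>})"
    and B: "\<And>t. t \<in> {\<alpha>..\<beta>} \<Longrightarrow> e ^ Suc k * \<bar>v (Suc k) t\<bar> \<le> A * (e ^ Suc k + E0 ^ Suc k + b * n ^ Suc k)"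
    and pos: "0 < e" "0 < n" "0 \<le> M" "0 \<le> E0" "E0 \<le> 1" "0 \<le> A" "0 \<le> b" "0 \<le> L" "0 \<le> e0"
    and en: "e \<le> e0 * n" and h1: "\<beta> - \<alpha> \<le> L * e" and h2: "(\<beta> - \<alpha>) * E0 \<le> L * e * (n * M)"
  shows "\<exists>p. good_approx (2 * A * L ^ k * (e0 ^ Suc k + b + 1) +
      2 * (1 + L\<^sup>2) * (1 + L) * (2 * A * L ^ k * (e0 ^ Suc k + b + 1))\<^sup>2) k e n M (v 0) (v 1) \<alpha> \<beta> p"
proof -
  define h where "h = \<beta> - \<alpha>"
  define Q where "Q = A * (e ^ Suc k + E0 ^ Suc k + b * n ^ Suc k) / e ^ Suc k"
  define K where "K = 2 * A * L ^ k * (e0 ^ Suc k + b + 1)"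
  define s where "s = (M * n) ^ k"
  have h: "0 < h" "h \<le> L * e" "h * E0 \<le> L * e * (n * M)" using assms by (auto simp: h_def)
  have K: "0 \<le> K" and s: "0 \<le> s" using pos by (auto simp: K_def s_def)
  have Q: "0 \<le> Q" using pos by (auto simp: Q_def)
  have "\<bar>v (Suc k) t\<bar> \<le> Q" if "t \<in> {\<alpha>..\<beta>}" for t
    using B[OF that] pos by (simp add: Q_def field_simps del: power_Suc)
  from taylor_interpolant[OF assms(1,2) v this] obtain p where
    p: "degree p \<le> k" "poly p \<alpha> = v 0 \<alpha>" "poly p \<beta> = v 0 \<beta>"
      "\<And>t. t \<in> {\<alpha>..\<beta>} \<Longrightarrow> \<bar>v 0 t - poly p t\<bar> \<le> 2 * Q * h ^ Suc k \<and> \<bar>v 1 t - poly (pderiv p) t\<bar> \<le> 2 * Q * h ^ k"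
    unfolding h_def by blast
  define D where "D = 2 * Q * h ^ k"
  have D: "0 \<le> D" using Q h by (simp add: D_def)
  \<comment> \<open>The value error is h times the derivative error and h <= L e, so a bound on e D
    controls both.\<close>
  have G: "2 * Q * h ^ Suc k = h * D" by (simp add: D_def)
  have eD0: "e * D = 2 * A * ((h / e) ^ k * (e ^ Suc k + E0 ^ Suc k + b * n ^ Suc k))"
    using pos by (simp add: D_def Q_def power_divide field_simps)
  \<comment> \<open>One factor \<open>E0\<close> is split off before the rest is estimated by powers
    of n and M n.\<close>
  have "(h / e) ^ k * (e ^ Suc k + E0 ^ Suc k + b * n ^ Suc k)
     = (h / e) ^ k * (e ^ Suc k + b * n ^ Suc k) + (h * E0 / e) ^ k * E0"
    by (simp add: power_mult_distrib power_divide algebra_simps)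
  also have "\<dots> \<le> L ^ k * ((e0 * n) ^ Suc k + b * n ^ Suc k) + (L * (n * M)) ^ k * E0"
    using pos en h by (intro add_mono mult_mono power_mono mult_left_mono order_refl add_nonneg_nonneg)
      (auto simp: field_simps)
  also have "\<dots> = L ^ k * ((e0 ^ Suc k + b) * n ^ Suc k + s * E0)"
    by (simp add: s_def power_mult_distrib algebra_simps)
  also have "\<dots> \<le> L ^ k * ((e0 ^ Suc k + b + 1) * n ^ Suc k + (e0 ^ Suc k + b + 1) * (s * E0))"
  proof -
    have "1 * (s * E0) \<le> (e0 ^ Suc k + b + 1) * (s * E0)" using pos s by (intro mult_right_mono) auto
    moreover have "(e0 ^ Suc k + b) * n ^ Suc k \<le> (e0 ^ Suc k + b + 1) * n ^ Suc k"
      using pos by (intro mult_right_mono) auto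
    ultimately show ?thesis using pos by (intro mult_left_mono add_mono) auto
  qed
  finally have "2 * A * ((h / e) ^ k * (e ^ Suc k + E0 ^ Suc k + b * n ^ Suc k))
    \<le> 2 * A * (L ^ k * ((e0 ^ Suc k + b + 1) * n ^ Suc k + (e0 ^ Suc k + b + 1) * (s * E0)))"
    using pos by (intro mult_left_mono) auto
  also have "\<dots> = K * (n ^ Suc k + s * E0)" unfolding K_def by (simp only: algebra_simps)
  finally have eD: "e * D \<le> K * (n ^ Suc k + s * E0)" unfolding eD0 .
  \<comment> \<open>For the trace estimate the spare factor is simply bounded by 1.\<close>
  have sE: "s * E0 \<le> s" using mult_left_mono[OF pos(5) s] by simp
  have r1: "e * D \<le> K * (n ^ Suc k + s)"
    using eD mult_left_mono[OF _ K, of "n ^ Suc k + s * E0" "n ^ Suc k + s"] sE by linarith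
  have "(e * D)\<^sup>2 \<le> (K * (n ^ Suc k + s * E0))\<^sup>2" using eD pos D by (intro power_mono) auto
  also have "\<dots> \<le> 2 * K\<^sup>2 * ((n ^ Suc k)\<^sup>2 + s\<^sup>2 * E0)"
  proof -
    have "(a + c)\<^sup>2 \<le> 2 * (a\<^sup>2 + c\<^sup>2)" for a c :: real
      using zero_le_power2[of "a - c"] by (simp add: power2_eq_square algebra_simps)
    then have 1: "(n ^ Suc k + s * E0)\<^sup>2 \<le> 2 * ((n ^ Suc k)\<^sup>2 + (s * E0)\<^sup>2)" .
    \<comment> \<open>Only one of the two factors is kept after squaring, as h occurs to the first
      power.\<close>
    have "E0\<^sup>2 \<le> E0" using pos mult_left_mono[of E0 1 E0] by (simp add: power2_eq_square)
    then have "(s * E0)\<^sup>2 \<le> s\<^sup>2 * E0" unfolding power_mult_distrib by (intro mult_left_mono) auto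
    then have "2 * ((n ^ Suc k)\<^sup>2 + (s * E0)\<^sup>2) \<le> 2 * ((n ^ Suc k)\<^sup>2 + s\<^sup>2 * E0)"
      by (intro mult_left_mono add_left_mono) auto
    with 1 have "(n ^ Suc k + s * E0)\<^sup>2 \<le> 2 * ((n ^ Suc k)\<^sup>2 + s\<^sup>2 * E0)" by (rule order_trans)
    from mult_left_mono[OF this zero_le_power2[of K]] show ?thesis
      by (simp only: power_mult_distrib[of K] mult.assoc mult.left_commute[of 2])
  qed
  finally have sq: "(e * D)\<^sup>2 \<le> 2 * K\<^sup>2 * ((n ^ Suc k)\<^sup>2 + s\<^sup>2 * E0)" .
  have hsq: "h * (e * D)\<^sup>2 \<le> 2 * (1 + L) * K\<^sup>2 * (h * (n ^ Suc k)\<^sup>2 + e * (n * M) * s\<^sup>2)"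
  proof -
    have "h * (e * D)\<^sup>2 \<le> h * (2 * K\<^sup>2 * ((n ^ Suc k)\<^sup>2 + s\<^sup>2 * E0))" using h sq by (intro mult_left_mono) auto
    also have "\<dots> = 2 * K\<^sup>2 * (h * (n ^ Suc k)\<^sup>2 + s\<^sup>2 * (h * E0))" by (simp add: algebra_simps)
    also have "\<dots> \<le> 2 * K\<^sup>2 * ((1 + L) * (h * (n ^ Suc k)\<^sup>2) + (1 + L) * (e * (n * M) * s\<^sup>2))"
    proof -
      have "1 * (h * (n ^ Suc k)\<^sup>2) \<le> (1 + L) * (h * (n ^ Suc k)\<^sup>2)"
        using h pos by (intro mult_right_mono) auto
      moreover have "s\<^sup>2 * (h * E0) \<le> s\<^sup>2 * (L * e * (n * M))" using h by (intro mult_left_mono) auto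
      moreover have "0 \<le> e * (n * M) * s\<^sup>2" using pos by auto
      then have "s\<^sup>2 * (L * e * (n * M)) \<le> (1 + L) * (e * (n * M) * s\<^sup>2)" by (simp add: algebra_simps)
      ultimately show ?thesis by (intro mult_left_mono) auto
    qed
    finally show ?thesis by (simp add: algebra_simps)
  qed
  have "(h * D)\<^sup>2 \<le> (L * (e * D))\<^sup>2"
    using h D pos mult_right_mono[OF h(2) D] by (intro power_mono) (auto simp: algebra_simps)
  then have "(e * D)\<^sup>2 + (h * D)\<^sup>2 \<le> (1 + L\<^sup>2) * (e * D)\<^sup>2" by (simp add: power_mult_distrib algebra_simps)
  then have "h * ((e * D)\<^sup>2 + (h * D)\<^sup>2) \<le> h * ((1 + L\<^sup>2) * (e * D)\<^sup>2)" using h by (intro mult_left_mono) auto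
  also have "\<dots> = (1 + L\<^sup>2) * (h * (e * D)\<^sup>2)" by simp
  also have "\<dots> \<le> (1 + L\<^sup>2) * (2 * (1 + L) * K\<^sup>2 * (h * (n ^ Suc k)\<^sup>2 + e * (n * M) * s\<^sup>2))"
    using hsq by (intro mult_left_mono) auto
  finally have r2: "h * ((e * D)\<^sup>2 + (h * D)\<^sup>2) \<le>
      (2 * (1 + L\<^sup>2) * (1 + L) * K\<^sup>2) * (h * (n ^ Suc k)\<^sup>2 + e * (n * M) * s\<^sup>2)" by (simp add: algebra_simps)
  have K2: "0 \<le> 2 * (1 + L\<^sup>2) * (1 + L) * K\<^sup>2" using pos by auto
  have up: "z \<le> a * r \<Longrightarrow> 0 \<le> r \<Longrightarrow> 0 \<le> c \<Longrightarrow> z \<le> (a + c) * r" for z a c r :: real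
    by (metis add_increasing2 distrib_right mult_nonneg_nonneg)
  have nn: "0 \<le> n ^ Suc k + s" "0 \<le> h * (n ^ Suc k)\<^sup>2 + e * (n * M) * s\<^sup>2"
    using pos h s by auto
  have "e * D \<le> (K + 2 * (1 + L\<^sup>2) * (1 + L) * K\<^sup>2) * (n ^ Suc k + s)"
    using up[OF r1 nn(1) K2] .
  moreover have "h * ((e * D)\<^sup>2 + (h * D)\<^sup>2) \<le>
      (K + 2 * (1 + L\<^sup>2) * (1 + L) * K\<^sup>2) * (h * (n ^ Suc k)\<^sup>2 + e * (n * M) * s\<^sup>2)"
    using up[OF r2 nn(2) K] by (simp only: add.commute)
  moreover have "0 \<le> h * D" using h D by simp
  ultimately show ?thesis
    unfolding good_approx_def K_def[symmetric] h_def[symmetric] s_def[symmetric]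
    using p(1-3) p(4)[unfolded G D_def[symmetric]] D by blast
qed

text \<open>Between the transition points E and e E' are already of order n^(k+1), so E needs
  matching end values but no approximation power. As h is comparable to n, the Taylor error of S has
  the right order, and e / h <= e0 makes the slope of the interpolant of E harmless.\<close>

lemma coarse_element:
  fixes S E :: "nat \<Rightarrow> real \<Rightarrow> real"
  assumes "\<alpha> < \<beta>" "1 \<le> k"
    and S: "\<And>j t. j \<le> k \<Longrightarrow> t \<in> {\<alpha>..\<beta>} \<Longrightarrow> (S j has_real_derivative S (Suc j) t) (at t within {\<alpha>..\<beta>})"
    and B: "\<And>t. t \<in> {\<alpha>..\<beta>} \<Longrightarrow> \<bar>S (Suc k) t\<bar> \<le> A"
    and E: "\<And>t. t \<in> {\<alpha>..\<beta>} \<Longrightarrow> \<bar>E 0 t\<bar> \<le> b * n ^ Suc k \<and> e * \<bar>E 1 t\<bar> \<le> b * n ^ Suc k"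
    and pos: "0 < e" "0 < n" "0 \<le> M" "0 \<le> A" "0 \<le> b" "0 \<le> e0"
    and en: "e \<le> e0 * n" and h1: "n \<le> \<beta> - \<alpha>" and h2: "\<beta> - \<alpha> \<le> 2 * n"
  shows "\<exists>p. good_approx ((2 * A * 2 ^ k * e0 + b + 2 * b * e0) + ((2 * A * 2 ^ k * e0 + b + 2 * b * e0)\<^sup>2
     + (2 * A * 2 ^ Suc k + 2 * b)\<^sup>2)) k e n M (\<lambda>t. S 0 t + E 0 t) (\<lambda>t. S 1 t + E 1 t) \<alpha> \<beta> p"
proof -
  define h where "h = \<beta> - \<alpha>"
  define K where "K = 2 * A * 2 ^ k * e0 + b + 2 * b * e0"
  define K' where "K' = 2 * A * 2 ^ Suc k + 2 * b"
  define w where "w = n ^ Suc k"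
  have h: "0 < h" "n \<le> h" "h \<le> 2 * n" using assms by (auto simp: h_def)
  have K: "0 \<le> K" "0 \<le> K'" and w: "0 \<le> w" using pos by (auto simp: K_def K'_def w_def)
  obtain p where p: "degree p \<le> k" "poly p \<alpha> = S 0 \<alpha>" "poly p \<beta> = S 0 \<beta>"
      "\<And>t. t \<in> {\<alpha>..\<beta>} \<Longrightarrow> \<bar>S 0 t - poly p t\<bar> \<le> 2 * A * h ^ Suc k"
      "\<And>t. t \<in> {\<alpha>..\<beta>} \<Longrightarrow> \<bar>S 1 t - poly (pderiv p) t\<bar> \<le> 2 * A * h ^ k"
    using taylor_interpolant[OF assms(1,2) S B] unfolding h_def by blast
  obtain q where q: "degree q \<le> 1" "poly q \<alpha> = E 0 \<alpha>" "poly q \<beta> = E 0 \<beta>"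
      "\<And>t. t \<in> {\<alpha>..\<beta>} \<Longrightarrow> \<bar>poly q t\<bar> \<le> b * w"
      "\<And>t. t \<in> {\<alpha>..\<beta>} \<Longrightarrow> \<bar>poly (pderiv q) t\<bar> \<le> 2 * (b * w) / h"
    using linear_interpolant[OF assms(1), of "E 0" "b * w"] E unfolding h_def w_def by blast
  \<comment> \<open>The contributions are the Taylor error for S', E' itself, and the slope of the
    linear interpolant of E. The second is divided by e, so it is e D that has order
    n^(k+1).\<close>
  define D where "D = 2 * A * h ^ k + b * w / e + 2 * (b * w) / h"
  define G where "G = 2 * A * h ^ Suc k + 2 * (b * w)"
  have D: "0 \<le> D" and G: "0 \<le> G" using pos h w by (auto simp: D_def G_def)
  have deg: "degree (p + q) \<le> k" using p(1) q(1) assms(2) by (intro degree_add_le) auto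
  have b1: "\<bar>S 0 t + E 0 t - poly (p + q) t\<bar> \<le> G" if "t \<in> {\<alpha>..\<beta>}" for t
    using p(4)[OF that] q(4)[OF that] E[OF that, THEN conjunct1]
    unfolding G_def w_def poly_add abs_le_iff by linarith
  have b2: "\<bar>S 1 t + E 1 t - poly (pderiv (p + q)) t\<bar> \<le> D" if "t \<in> {\<alpha>..\<beta>}" for t
  proof -
    have "\<bar>E 1 t\<bar> \<le> b * w / e" using E[OF that] pos by (simp add: w_def field_simps)
    then show ?thesis using p(5)[OF that] q(5)[OF that] by (simp add: D_def pderiv_add)
  qed
  have eD: "e * D \<le> K * w"
  proof -
    have "e * h ^ k \<le> e0 * n * (2 * n) ^ k" using h en pos by (intro mult_mono power_mono) auto
    then have 1: "2 * A * (e * h ^ k) \<le> 2 * A * (e0 * n * (2 * n) ^ k)" using pos by (intro mult_left_mono) auto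
    have "e / h \<le> e0 * n / n" using h en pos by (intro frac_le) auto
    then have "e / h \<le> e0" using pos by simp
    then have 2: "(2 * (b * w)) * (e / h) \<le> (2 * (b * w)) * e0" using pos w by (intro mult_left_mono) auto
    have "e * D = 2 * A * (e * h ^ k) + b * w + (2 * (b * w)) * (e / h)"
      using pos h by (simp add: D_def field_simps)
    also have "\<dots> \<le> 2 * A * (e0 * n * (2 * n) ^ k) + b * w + (2 * (b * w)) * e0" using 1 2 by linarith
    also have "\<dots> = K * w" by (simp add: K_def w_def power_mult_distrib algebra_simps)
    finally show ?thesis .
  qed
  have GK: "G \<le> K' * w"
  proof -
    have "h ^ Suc k \<le> (2 * n) ^ Suc k" using h by (intro power_mono) auto
    then have "2 * A * h ^ Suc k \<le> 2 * A * (2 * n) ^ Suc k" using pos by (intro mult_left_mono) auto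
    then show ?thesis by (simp add: G_def K'_def w_def power_mult_distrib algebra_simps)
  qed
  have "(e * D)\<^sup>2 \<le> (K * w)\<^sup>2" "G\<^sup>2 \<le> (K' * w)\<^sup>2" using eD GK D G pos by (auto intro!: power_mono)
  then have "(e * D)\<^sup>2 + G\<^sup>2 \<le> (K\<^sup>2 + K'\<^sup>2) * w\<^sup>2" by (simp add: power_mult_distrib algebra_simps)
  then have r2: "h * ((e * D)\<^sup>2 + G\<^sup>2) \<le> (K\<^sup>2 + K'\<^sup>2) * (h * w\<^sup>2)"
    using h mult_left_mono[of _ _ h] by (fastforce simp: algebra_simps)
  have up: "z \<le> a * r \<Longrightarrow> 0 \<le> a \<Longrightarrow> 0 \<le> r \<Longrightarrow> 0 \<le> c \<Longrightarrow> 0 \<le> y \<Longrightarrow> z \<le> (a + c) * (r + y)" for z a c r y :: real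
    by (rule order_trans[of _ "a * r"], assumption, rule mult_mono) auto
  have "e * D \<le> (K + (K\<^sup>2 + K'\<^sup>2)) * (w + (M * n) ^ k)"
    using up[OF eD K(1) w] pos by simp
  moreover have "h * ((e * D)\<^sup>2 + G\<^sup>2) \<le> ((K\<^sup>2 + K'\<^sup>2) + K) * (h * w\<^sup>2 + e * (n * M) * ((M * n) ^ k)\<^sup>2)"
    by (rule up[OF r2]) (use K h pos in auto)
  ultimately show ?thesis
    unfolding good_approx_def K_def[symmetric] K'_def[symmetric] h_def[symmetric] w_def[symmetric]
    using deg b1 b2 D G p(2,3) q(2,3)
    by (intro exI[of _ "p + q"] conjI exI[of _ D] exI[of _ G]) (auto simp: add.commute[of K])
qed

section \<open>Layer-adapted meshes\<close>

text \<open>The mesh generating functions may have finitely many kinks; the fundamental theorem of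
  calculus with a finite exceptional set takes the place of the mean value theorem.\<close>

lemma piecewise_derivative_bound:
  fixes g :: "real \<Rightarrow> real"
  assumes "finite F" "continuous_on {a..b} g"
    and d: "\<And>t. t \<in> {a<..<b} - F \<Longrightarrow> g differentiable (at t)"
    and B: "\<And>t. t \<in> {a<..<b} \<Longrightarrow> g differentiable (at t) \<Longrightarrow> \<bar>deriv g t\<bar> \<le> B" and "0 \<le> B"
    and st: "a \<le> s" "s \<le> t" "t \<le> b"
  shows "\<bar>g t - g s\<bar> \<le> B * (t - s)"
proof -
  \<comment> \<open>Exceptional points get the value 0, which respects the bound B and is invisible
    to the integral.\<close>
  define g' where "g' y = (if y \<in> {a<..<b} - F then deriv g y else 0)" for y
  have "(g' has_integral (g t - g s)) {s..t}"
  proof (rule fundamental_theorem_of_calculus_interior_strong[OF assms(1) st(2)])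
    show "continuous_on {s..t} g" using assms(2) st by (auto intro: continuous_on_subset)
    fix y assume "y \<in> {s<..<t} - F"
    then have y: "y \<in> {a<..<b} - F" using st by auto
    show "(g has_vector_derivative g' y) (at y)"
      using d[OF y] y
      by (simp add: g'_def DERIV_deriv_iff_real_differentiable flip: has_real_derivative_iff_has_vector_derivative)
  qed
  then have "norm (g t - g s) \<le> B * measure lborel {s..t}"
  proof (rule has_integral_bound_real[OF assms(5) assms(1)])
    show "norm (g' y) \<le> B" for y using B d \<open>0 \<le> B\<close> by (auto simp: g'_def)
  qed
  then show ?thesis using st by simp
qed

text \<open>One of the two sets in \<open>max_dpsi\<close>, parametrised so that both layers share
  one lemma.\<close>

definition dpsi_set :: "(real \<Rightarrow> real) \<Rightarrow> real \<Rightarrow> real \<Rightarrow> real set" where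
  "dpsi_set \<phi> a b = {\<bar>deriv (\<lambda>s. exp (- \<phi> s)) t\<bar> | t. t \<in> {a<..<b} \<and> (\<lambda>s. exp (- \<phi> s)) differentiable (at t)}"

text \<open>From psi' = -phi' psi and psi <= 1 the derivatives of psi inherit the bound Cd N. This
  makes the set under \<open>Sup\<close> bounded, without which the supremum would carry no
  information.\<close>

lemma mesh_gen_bounds:
  assumes mg: "mesh_gen_conds a b N Cd Cl \<phi>" and "0 < N" "a < b" "0 \<le> Cd"
    and nonneg: "\<And>t. t \<in> {a..b} \<Longrightarrow> 0 \<le> \<phi> t"
  shows "0 \<le> Sup (dpsi_set \<phi> a b)" "Sup (dpsi_set \<phi> a b) \<le> Cd * real N"
    and "\<lbrakk>a \<le> s; s \<le> t; t \<le> b\<rbrakk> \<Longrightarrow> \<bar>\<phi> t - \<phi> s\<bar> \<le> Cd * real N * (t - s)"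
    and "\<lbrakk>a \<le> s; s \<le> t; t \<le> b\<rbrakk> \<Longrightarrow> \<bar>exp (- \<phi> t) - exp (- \<phi> s)\<bar> \<le> Sup (dpsi_set \<phi> a b) * (t - s)"
proof -
  obtain F where F: "finite F" "\<phi> C1_differentiable_on ({a..b} - F)" and cont: "continuous_on {a..b} \<phi>"
    using mg unfolding mesh_gen_conds_def piecewise_C1_differentiable_on_def by blast
  have dphi: "\<phi> differentiable (at t)" if "t \<in> {a<..<b} - F" for t
    using F(2) that unfolding C1_differentiable_on_eq by auto
  have Bphi: "\<bar>deriv \<phi> t\<bar> \<le> Cd * real N" if "t \<in> {a<..<b}" "\<phi> differentiable (at t)" for t
    using mg that \<open>0 < N\<close> unfolding mesh_gen_conds_def by (auto simp: field_simps)
  show "\<bar>\<phi> t - \<phi> s\<bar> \<le> Cd * real N * (t - s)" if "a \<le> s" "s \<le> t" "t \<le> b" for s t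
    using that assms by (intro piecewise_derivative_bound[OF F(1) cont dphi Bphi]) auto
  define \<psi> where "\<psi> = (\<lambda>s. exp (- \<phi> s))"
  have S: "dpsi_set \<phi> a b = {\<bar>deriv \<psi> t\<bar> | t. t \<in> {a<..<b} \<and> \<psi> differentiable (at t)}"
    by (simp add: dpsi_set_def \<psi>_def)
  have dpsi: "\<psi> differentiable (at t)" if t: "t \<in> {a<..<b} - F" for t
  proof -
    obtain d where "(\<phi> has_real_derivative d) (at t)" using dphi[OF t] unfolding real_differentiable_def by blast
    then have "(\<psi> has_real_derivative exp (- \<phi> t) * (- d)) (at t)"
      unfolding \<psi>_def by (auto intro!: derivative_eq_intros)
    then show ?thesis using real_differentiable_def by blast
  qed
  have ub: "\<bar>deriv \<psi> t\<bar> \<le> Cd * real N" if t: "t \<in> {a<..<b}" "\<psi> differentiable (at t)" for t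
  proof -
    have d: "(\<psi> has_real_derivative deriv \<psi> t) (at t)"
      using t(2) by (simp add: DERIV_deriv_iff_real_differentiable)
    have pos: "0 < \<psi> y" for y by (simp add: \<psi>_def)
    have "((\<lambda>s. - ln (\<psi> s)) has_real_derivative - (deriv \<psi> t / \<psi> t)) (at t)"
      using pos[of t] by (auto intro!: derivative_eq_intros d)
    then have dp: "(\<phi> has_real_derivative - (deriv \<psi> t / \<psi> t)) (at t)" by (simp add: \<psi>_def)
    then have "\<phi> differentiable (at t)" using real_differentiable_def by blast
    then have "\<bar>deriv \<psi> t\<bar> / \<psi> t \<le> Cd * real N"
      using Bphi[OF t(1)] DERIV_imp_deriv[OF dp] pos[of t] by (simp add: abs_divide)
    then have "\<bar>deriv \<psi> t\<bar> \<le> Cd * real N * \<psi> t" using pos[of t] by (simp add: field_simps)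
    also have "\<dots> \<le> Cd * real N * 1"
      using nonneg[of t] t assms by (intro mult_left_mono) (auto simp: \<psi>_def)
    finally show ?thesis by simp
  qed
  have bdd: "bdd_above (dpsi_set \<phi> a b)" unfolding S using ub by (intro bdd_aboveI) blast
  \<comment> \<open>The set under \<open>Sup\<close> must also be nonempty; an open interval minus
    finitely many points supplies a member.\<close>
  have "infinite {a<..<b}" using \<open>a < b\<close> by simp
  then have "{a<..<b} - F \<noteq> {}" using F(1) by (metis finite.emptyI finite_Diff2)
  then obtain t0 where t0: "t0 \<in> {a<..<b} - F" by blast
  then have mem: "\<bar>deriv \<psi> t0\<bar> \<in> dpsi_set \<phi> a b" unfolding S using dpsi by blast
  show ge: "0 \<le> Sup (dpsi_set \<phi> a b)"
    using cSup_upper[OF mem bdd] by (intro order_trans[OF abs_ge_zero])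
  show "Sup (dpsi_set \<phi> a b) \<le> Cd * real N"
    using mem ub unfolding S by (intro cSup_least) auto
  have up: "\<bar>deriv \<psi> t\<bar> \<le> Sup (dpsi_set \<phi> a b)" if "t \<in> {a<..<b}" "\<psi> differentiable (at t)" for t
    using that unfolding S by (intro cSup_upper bdd[unfolded S]) blast
  have "continuous_on {a..b} \<psi>" unfolding \<psi>_def by (intro continuous_intros cont)
  then have "\<bar>\<psi> t - \<psi> s\<bar> \<le> Sup (dpsi_set \<phi> a b) * (t - s)" if "a \<le> s" "s \<le> t" "t \<le> b" for s t
    using that by (intro piecewise_derivative_bound[OF F(1) _ dpsi up ge])
  then show "\<lbrakk>a \<le> s; s \<le> t; t \<le> b\<rbrakk> \<Longrightarrow> \<bar>exp (- \<phi> t) - exp (- \<phi> s)\<bar> \<le> Sup (dpsi_set \<phi> a b) * (t - s)"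
    by (simp add: \<psi>_def)
qed

text \<open>Discrete form of phi' exp(-phi) = -psi'. The inequality q - p <= exp(q - p) - 1 gives
  the estimate with the smaller factor exp(-q); passing to exp(-p) costs exp C because the increment
  is at most C.\<close>

lemma phi_increment:
  fixes p q :: real
  assumes "p \<le> q" "q - p \<le> C" "exp (- p) - exp (- q) \<le> r" "0 \<le> r"
  shows "(q - p) * exp (- p) \<le> exp C * r"
proof -
  have "q - p \<le> exp (q - p) - 1" using exp_ge_add_one_self[of "q - p"] by linarith
  then have "(q - p) * exp (- q) \<le> (exp (q - p) - 1) * exp (- q)" by (intro mult_right_mono) auto
  also have "\<dots> = exp (- p) - exp (- q)" by (simp add: left_diff_distrib flip: exp_add)
  finally have "(q - p) * exp (- q) \<le> r" using assms by linarith
  then have "exp (q - p) * ((q - p) * exp (- q)) \<le> exp C * r" using assms by (intro mult_mono) auto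
  moreover have "exp (q - p) * ((q - p) * exp (- q)) = (q - p) * exp (- p)"
    by (simp add: mult.left_commute[of "exp (q - p)"] flip: exp_add)
  ultimately show ?thesis by simp
qed

section \<open>Step sizes and layer values on the Shishkin-type mesh\<close>

locale layer_mesh =
  fixes k N :: nat and e \<gamma> Cd Cl :: real and \<phi>1 \<phi>2 :: "real \<Rightarrow> real"
  assumes e: "0 < e" and \<gamma>: "0 < \<gamma>" and Cd: "0 < Cd" and Cl: "0 < Cl"
    and N: "4 dvd N" "4 \<le> N" and lam: "trans_pt k e \<gamma> N < 1/4"
    and g1: "mesh_gen_conds 0 (1/4) N Cd Cl \<phi>1" "mono_on {0..1/4} \<phi>1" "\<phi>1 0 = 0" "\<phi>1 (1/4) = ln (real N)"
    and g2: "mesh_gen_conds (3/4) 1 N Cd Cl \<phi>2" "antimono_on {3/4..1} \<phi>2" "\<phi>2 1 = 0" "\<phi>2 (3/4) = ln (real N)"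
begin

abbreviation "x \<equiv> mesh_pt k e \<gamma> N \<phi>1 \<phi>2"
abbreviation "tau \<equiv> trans_pt k e \<gamma> N"
abbreviation "M \<equiv> max_dpsi \<phi>1 \<phi>2"
definition "q = N div 4"
definition "\<kappa> = (real k + 1) * e / \<gamma>"
definition "n = 1 / real N"
text \<open>The sum covers both step estimates: \<open>Cd\<close> serves h <= L e, and
  \<open>exp Cd\<close> serves h exp(-phi) <= L e n M. The value depends on neither e nor N.\<close>

definition "L = (real k + 1) / \<gamma> * (Cd + exp Cd)"

lemma Nq: "N = 4 * q" "1 \<le> q" using N by (auto simp: q_def)
lemma Ndiv: "N div 4 = q" "3 * N div 4 = 3 * q" using Nq by auto
lemma Nreal: "real N = 4 * real q" using Nq by simp
lemma n: "0 < n" "n \<le> 1" "real N * n = 1" using N by (auto simp: n_def)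
lemma \<kappa>: "0 < \<kappa>" using e \<gamma> by (simp add: \<kappa>_def)
lemma lam_eq: "tau = \<kappa> * ln (real N)" by (simp add: trans_pt_def \<kappa>_def)
lemma lam_pos: "0 < tau" using \<kappa> N by (simp add: lam_eq)

lemma x_left: "i \<le> q \<Longrightarrow> x i = \<kappa> * \<phi>1 (real i * n)"
  by (simp add: mesh_pt_def q_def \<kappa>_def n_def)

text \<open>The branches of \<open>mesh_pt\<close> agree at the transition nodes because phi equals
  ln N there. With each formula valid on its closed index range, both ends of every element lie in
  one branch.\<close>

lemma x_coarse:
  assumes "q \<le> i" "i \<le> 3 * q"
  shows "x i = tau + 2 * (1 - 2 * tau) * (real i * n - 1/4)"
proof (cases "i = q")
  case True
  have a: "real i * n = 1/4" using Nq True by (simp add: n_def Nreal)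
  have "x i = \<kappa> * \<phi>1 (1/4)" using x_left[of i] True unfolding a by simp
  then show ?thesis unfolding a by (simp add: g1(4) lam_eq)
next
  case False
  then show ?thesis using assms Ndiv by (simp add: mesh_pt_def n_def)
qed

lemma x_right:
  assumes "3 * q \<le> i" "i \<le> N"
  shows "x i = 1 - \<kappa> * \<phi>2 (real i * n)"
proof (cases "i = 3 * q")
  case True
  have a: "real i * n = 3/4" using Nq True by (simp add: n_def Nreal)
  have "x i = 1 - tau" using x_coarse[of i] True unfolding a by (simp add: field_simps)
  then show ?thesis unfolding a g2(4) lam_eq .
next
  case False
  then show ?thesis using assms Ndiv Nq by (simp add: mesh_pt_def n_def \<kappa>_def)
qed

lemma left_arg:
  assumes "i \<in> {1..q}"
  shows "0 \<le> real (i - 1) * n" "real (i - 1) * n \<le> real i * n" "real i * n \<le> 1/4"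
    "real i * n - real (i - 1) * n = n" "Cl * n \<le> \<bar>\<phi>1 (real i * n) - \<phi>1 (real (i - 1) * n)\<bar>"
proof -
  show 0: "0 \<le> real (i - 1) * n" "real (i - 1) * n \<le> real i * n"
    using n by (auto intro: mult_right_mono)
  show 1: "real i * n \<le> 1/4" using assms Nq by (simp add: n_def Nreal)
  show "real i * n - real (i - 1) * n = n" using assms by (simp add: algebra_simps of_nat_diff)
  show "Cl * n \<le> \<bar>\<phi>1 (real i * n) - \<phi>1 (real (i - 1) * n)\<bar>"
    using g1(1) 0 1 assms unfolding mesh_gen_conds_def n_def by auto
qed

lemma right_arg:
  assumes "i \<in> {3 * q + 1..N}"
  shows "3/4 \<le> real (i - 1) * n" "real (i - 1) * n \<le> real i * n" "real i * n \<le> 1"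
    "real i * n - real (i - 1) * n = n" "Cl * n \<le> \<bar>\<phi>2 (real i * n) - \<phi>2 (real (i - 1) * n)\<bar>"
proof -
  have "3 * real q \<le> real (i - 1)" using assms by (simp flip: of_nat_le_iff)
  then show 0: "3/4 \<le> real (i - 1) * n" using Nq by (simp add: n_def Nreal field_simps)
  show 1: "real (i - 1) * n \<le> real i * n" using n by (auto intro: mult_right_mono)
  show 2: "real i * n \<le> 1" using assms Nq by (simp add: n_def)
  show "real i * n - real (i - 1) * n = n" using assms by (simp add: algebra_simps of_nat_diff)
  show "Cl * n \<le> \<bar>\<phi>2 (real i * n) - \<phi>2 (real (i - 1) * n)\<bar>"
    using g2(1) 0 1 2 assms unfolding mesh_gen_conds_def n_def by auto
qed

lemma phi_nonneg:
  "t \<in> {0..1/4} \<Longrightarrow> 0 \<le> \<phi>1 t" "t \<in> {3/4..1} \<Longrightarrow> 0 \<le> \<phi>2 t"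
  using mono_onD[OF g1(2), of 0 t] g1(3) monotone_onD[OF g2(2), of t 1] g2(3) by auto

lemma M_eq: "M = max (Sup (dpsi_set \<phi>1 0 (1/4))) (Sup (dpsi_set \<phi>2 (3/4) 1))"
  by (simp add: max_dpsi_def dpsi_set_def)

lemmas gen1 = mesh_gen_bounds[OF g1(1) _ _ _ phi_nonneg(1)]
lemmas gen2 = mesh_gen_bounds[OF g2(1) _ _ _ phi_nonneg(2)]

lemma M_le: "M \<le> Cd * real N"
  using gen1(2) gen2(2) N Cd unfolding M_eq by simp

text \<open>psi1 falls from 1 to 1/N over an interval of length 1/4, so the supremum of its slope is
  at least 4 (1 - 1/N) >= 3.\<close>

lemma M_ge: "1 \<le> M"
proof -
  have "1 - 1 / real N \<le> Sup (dpsi_set \<phi>1 0 (1/4)) * (1/4)"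
    using gen1(4)[of 0 "1/4"] N Cd g1(3,4) by (simp add: exp_minus inverse_eq_divide)
  moreover have "1 / real N \<le> 1/4" using N by (simp add: field_simps)
  ultimately show ?thesis unfolding M_eq by linarith
qed

lemma left_increment:
  assumes "i \<in> {1..q}"
  defines "a \<equiv> \<phi>1 (real (i - 1) * n)" and "b \<equiv> \<phi>1 (real i * n)"
  shows "0 \<le> a" "a < b" "b - a \<le> Cd" "(b - a) * exp (- a) \<le> exp Cd * (n * M)"
proof -
  note l = left_arg[OF assms(1)]
  show "0 \<le> a" unfolding a_def using l by (intro phi_nonneg) auto
  have "0 < Cl * n" using Cl n by simp
  moreover have ab: "a \<le> b" unfolding a_def b_def using l by (intro mono_onD[OF g1(2)]) auto
  ultimately show "a < b" using l(5) unfolding a_def b_def by linarith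
  have "\<bar>b - a\<bar> \<le> Cd * real N * (real i * n - real (i - 1) * n)"
    unfolding a_def b_def using N Cd by (intro gen1(3) l(1-3)) auto
  also have "\<dots> = Cd" unfolding l(4) using n(3) by simp
  finally show le: "b - a \<le> Cd" by linarith
  have "\<bar>exp (- b) - exp (- a)\<bar> \<le> Sup (dpsi_set \<phi>1 0 (1/4)) * (real i * n - real (i - 1) * n)"
    unfolding a_def b_def using N Cd by (intro gen1(4) l(1-3)) auto
  also have "\<dots> \<le> M * n" unfolding l(4) using n by (intro mult_right_mono) (auto simp: M_eq)
  finally have "exp (- a) - exp (- b) \<le> n * M" by (simp add: mult.commute abs_le_iff)
  then show "(b - a) * exp (- a) \<le> exp Cd * (n * M)"
    using n M_ge by (intro phi_increment ab le) auto
qed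

text \<open>Mirror image of \<open>left_increment\<close>: phi2 decreases, so the end nearer to the
  boundary, at which \<open>a\<close> is taken, has index i instead of i - 1.\<close>

lemma right_increment:
  assumes "i \<in> {3 * q + 1..N}"
  defines "a \<equiv> \<phi>2 (real i * n)" and "b \<equiv> \<phi>2 (real (i - 1) * n)"
  shows "0 \<le> a" "a < b" "b - a \<le> Cd" "(b - a) * exp (- a) \<le> exp Cd * (n * M)"
proof -
  note l = right_arg[OF assms(1)]
  have l': "3/4 \<le> real i * n" using l(1,2) by (rule order_trans)
  have m: "real (i - 1) * n \<in> {3/4..1}" "real i * n \<in> {3/4..1}"
    unfolding atLeastAtMost_iff using l(1-3) l' by (blast intro: order_trans)+
  show "0 \<le> a" unfolding a_def by (rule phi_nonneg(2)[OF m(2)])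
  have "0 < Cl * n" using Cl n by simp
  moreover have ab: "a \<le> b" unfolding a_def b_def by (rule monotone_onD[OF g2(2) m l(2)])
  ultimately show "a < b" using l(5) unfolding a_def b_def by linarith
  have "\<bar>a - b\<bar> \<le> Cd * real N * (real i * n - real (i - 1) * n)"
    unfolding a_def b_def using N Cd by (intro gen2(3) l(1-3)) auto
  also have "\<dots> = Cd" unfolding l(4) using n(3) by simp
  finally show le: "b - a \<le> Cd" by linarith
  have "\<bar>exp (- a) - exp (- b)\<bar> \<le> Sup (dpsi_set \<phi>2 (3/4) 1) * (real i * n - real (i - 1) * n)"
    unfolding a_def b_def using N Cd by (intro gen2(4) l(1-3)) auto
  also have "\<dots> \<le> M * n" unfolding l(4) using n by (intro mult_right_mono) (auto simp: M_eq)
  finally have "exp (- a) - exp (- b) \<le> n * M" by (simp add: mult.commute abs_le_iff)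
  then show "(b - a) * exp (- a) \<le> exp Cd * (n * M)"
    using n M_ge by (intro phi_increment ab le) auto
qed

lemma step_left: "i \<in> {1..q} \<Longrightarrow> x i - x (i - 1) = \<kappa> * (\<phi>1 (real i * n) - \<phi>1 (real (i - 1) * n))"
  by (subst (1 2) x_left) (auto simp: right_diff_distrib)

lemma step_right: "i \<in> {3 * q + 1..N} \<Longrightarrow> x i - x (i - 1) = \<kappa> * (\<phi>2 (real (i - 1) * n) - \<phi>2 (real i * n))"
  by (subst (1 2) x_right) (auto simp: right_diff_distrib)

lemma step_coarse:
  assumes "i \<in> {q + 1..3 * q}"
  shows "x i - x (i - 1) = 2 * (1 - 2 * tau) * n"
proof -
  have "real (i - 1) = real i - 1" using assms by (simp add: of_nat_diff)
  then show ?thesis using assms x_coarse[of i] x_coarse[of "i - 1"] by (simp add: algebra_simps)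
qed

sublocale mesh x N
proof
  show "0 < N" using N by simp
  show "x 0 = 0" using x_left[of 0] g1(3) by simp
  show "x N = 1" using x_right[of N] n Nq g2(3) by simp
  fix i assume i: "i \<in> {1..N}"
  consider "i \<in> {1..q}" | "i \<in> {q + 1..3 * q}" | "i \<in> {3 * q + 1..N}" using i by fastforce
  then have "0 < x i - x (i - 1)"
  proof cases
    case 1 then show ?thesis unfolding step_left[OF 1] using left_increment(2)[OF 1] \<kappa> by simp
  next
    case 2 then show ?thesis unfolding step_coarse[OF 2] using lam n by simp
  next
    case 3 then show ?thesis unfolding step_right[OF 3] using right_increment(2)[OF 3] \<kappa> by simp
  qed
  then show "x (i - 1) < x i" by simp
qed

lemma x_q: "x q = tau" "x (3 * q) = 1 - tau"
  using x_coarse[of q] x_coarse[of "3 * q"] Nq by (simp_all add: n_def Nreal algebra_simps)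

text \<open>The purpose of the factor (k+1)/gamma in the mesh: in terms of phi the layer function is
  the power k + 1 of exp(-phi), one factor for each order of approximation.\<close>

lemma exp_kappa: "exp (- \<gamma> * (\<kappa> * s) / e) = exp (- s) ^ Suc k"
proof -
  have "- \<gamma> * (\<kappa> * s) / e = real (Suc k) * (- s)" using e \<gamma> by (simp add: \<kappa>_def)
  then show ?thesis by (simp only: exp_of_nat_mult)
qed

text \<open>At the transition point, where phi = ln N, the layer function has decayed to the target
  accuracy.\<close>

lemma exp_lam: "exp (- \<gamma> * tau / e) = n ^ Suc k"
  using N exp_kappa[of "ln (real N)"] by (simp add: lam_eq n_def exp_minus inverse_eq_divide)

lemma exp_layer_mono: "s \<le> t \<Longrightarrow> exp (- \<gamma> * t / e) \<le> exp (- \<gamma> * s / e)"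
  using e \<gamma> by (simp add: divide_right_mono)

definition "layer t = exp (- \<gamma> * t / e) + exp (- \<gamma> * (1 - t) / e)"

text \<open>The first alternative covers both layer regions, with \<open>E0\<close> the value of
  exp(-phi) at the end nearer to the boundary, where the layer function is largest; the opposite
  layer contributes only n^(k+1). In the second, both layers have decayed.\<close>

lemma element_cases:
  assumes i: "i \<in> {1..N}"
  shows "(\<exists>E0. 0 \<le> E0 \<and> E0 \<le> 1 \<and> x i - x (i - 1) \<le> L * e \<and> (x i - x (i - 1)) * E0 \<le> L * e * (n * M) \<and>
       (\<forall>t\<in>elem i. layer t \<le> E0 ^ Suc k + n ^ Suc k)) \<or>
     (n \<le> x i - x (i - 1) \<and> x i - x (i - 1) \<le> 2 * n \<and> (\<forall>t\<in>elem i. layer t \<le> 2 * n ^ Suc k))"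
proof -
  have fine: "\<kappa> * d \<le> L * e" "\<kappa> * d * exp (- a) \<le> L * e * (n * M)"
    if "d \<le> Cd" "d * exp (- a) \<le> exp Cd * (n * M)" for d a
  proof -
    have nM: "0 \<le> n * M" using n M_ge by simp
    have "\<kappa> * d \<le> \<kappa> * (Cd + exp Cd)" using that(1) \<kappa> by (intro mult_left_mono) (auto intro: add_increasing2)
    moreover have Le: "L * e = \<kappa> * (Cd + exp Cd)" by (simp add: L_def \<kappa>_def)
    ultimately show "\<kappa> * d \<le> L * e" by simp
    have "exp Cd * (n * M) \<le> (Cd + exp Cd) * (n * M)" using nM Cd by (intro mult_right_mono) auto
    then have "\<kappa> * (d * exp (- a)) \<le> \<kappa> * ((Cd + exp Cd) * (n * M))"
      using that(2) \<kappa> by (intro mult_left_mono) auto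
    then show "\<kappa> * d * exp (- a) \<le> L * e * (n * M)" unfolding Le by (simp only: mult.assoc)
  qed
  have far1: "exp (- \<gamma> * t / e) \<le> n ^ Suc k" if "tau \<le> t" for t
    using exp_layer_mono[OF that] unfolding exp_lam .
  have far2: "exp (- \<gamma> * (1 - t) / e) \<le> n ^ Suc k" if "t \<le> 1 - tau" for t
    using far1[of "1 - t"] that by simp
  consider "i \<in> {1..q}" | "i \<in> {q + 1..3 * q}" | "i \<in> {3 * q + 1..N}" using i by fastforce
  then show ?thesis
  proof cases
    case 1
    define a where "a = \<phi>1 (real (i - 1) * n)"
    have "layer t \<le> exp (- a) ^ Suc k + n ^ Suc k" if "t \<in> elem i" for t
    proof -
      have "x (i - 1) = \<kappa> * a" unfolding a_def by (rule x_left) (use 1 in auto)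
      then have "\<kappa> * a \<le> t" using that by simp
      moreover have i: "i \<le> q" "q \<le> N" using 1 Nq by auto
      then have "t \<le> 1 - tau" using that x_mono[OF i] lam unfolding x_q by simp
      ultimately show ?thesis
        unfolding layer_def exp_kappa[symmetric] by (intro add_mono exp_layer_mono far2)
    qed
    moreover have "exp (- a) \<le> 1" "0 \<le> exp (- a)" using left_increment(1)[OF 1] by (auto simp: a_def)
    ultimately show ?thesis
      using fine[OF left_increment(3,4)[OF 1]] unfolding step_left[OF 1] a_def by blast
  next
    case 2
    have "layer t \<le> 2 * n ^ Suc k" if "t \<in> elem i" for t
    proof -
      have i: "q \<le> i - 1" "i - 1 \<le> N" "i \<le> 3 * q" "3 * q \<le> N" using 2 Nq by auto
      have "tau \<le> t" "t \<le> 1 - tau"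
        using that x_mono[OF i(1,2)] x_mono[OF i(3,4)] unfolding x_q by auto
      from far1[OF this(1)] far2[OF this(2)] show ?thesis unfolding layer_def by linarith
    qed
    moreover have "n \<le> 2 * (1 - 2 * tau) * n" "2 * (1 - 2 * tau) * n \<le> 2 * n"
      using lam lam_pos n by auto
    ultimately show ?thesis unfolding step_coarse[OF 2] by blast
  next
    case 3
    define a where "a = \<phi>2 (real i * n)"
    have "layer t \<le> exp (- a) ^ Suc k + n ^ Suc k" if "t \<in> elem i" for t
    proof -
      have "x i = 1 - \<kappa> * a" unfolding a_def by (rule x_right) (use 3 in auto)
      then have "\<kappa> * a \<le> 1 - t" using that by simp
      moreover have i: "3 * q \<le> i - 1" "i - 1 \<le> N" using 3 by auto
      then have "tau \<le> t" using that x_mono[OF i] lam unfolding x_q by simp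
      ultimately have "exp (- \<gamma> * t / e) + exp (- \<gamma> * (1 - t) / e) \<le> n ^ Suc k + exp (- a) ^ Suc k"
        unfolding exp_kappa[symmetric] by (intro add_mono exp_layer_mono far1)
      then show ?thesis unfolding layer_def by linarith
    qed
    moreover have "exp (- a) \<le> 1" "0 \<le> exp (- a)" using right_increment(1)[OF 3] by (auto simp: a_def)
    ultimately show ?thesis
      using fine[OF right_increment(3,4)[OF 3]] unfolding step_right[OF 3] a_def by blast
  qed
qed

text \<open>Since M >= 1, the penalty used in the closed layer regions is the smallest interior one,
  so its reciprocal covers all interior nodes. The end nodes are kept apart, being only two terms of
  the later sum.\<close>

lemma penalty_bounds:
  assumes "i \<le> N"
  defines "\<sigma> \<equiv> penalty N e tau M x"
  shows "0 < \<sigma> i" "i = 0 \<or> i = N \<Longrightarrow> \<sigma> i = e" "i \<noteq> 0 \<Longrightarrow> i \<noteq> N \<Longrightarrow> 1 / \<sigma> i \<le> M * n / e"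
proof -
  have M: "0 < M" using M_ge by linarith
  show "0 < \<sigma> i" using e N M by (auto simp: \<sigma>_def penalty_def)
  show "i = 0 \<or> i = N \<Longrightarrow> \<sigma> i = e" by (auto simp: \<sigma>_def penalty_def)
  have "1 / (e * real N) \<le> M / (e * real N)" using M_ge e N by (intro divide_right_mono) auto
  then show "i \<noteq> 0 \<Longrightarrow> i \<noteq> N \<Longrightarrow> 1 / \<sigma> i \<le> M * n / e"
    by (auto simp: \<sigma>_def penalty_def n_def mult.commute)
qed

end

section \<open>The error estimate\<close>

lemma good_approx_cong:
  assumes "good_approx K k e n M u u1 \<alpha> \<beta> p" "\<alpha> \<le> \<beta>"
    and "\<And>t. t \<in> {\<alpha>..\<beta>} \<Longrightarrow> u t = v t \<and> u1 t = v1 t"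
  shows "good_approx K k e n M v v1 \<alpha> \<beta> p"
  using assms unfolding good_approx_def by auto

text \<open>In \<open>2 + e0 ^ (2 * Suc k)\<close> the 2 accounts for the two layer functions and
  the power for the floor e^(2k+2) of the weight, both in units of n^(k+1).\<close>

definition fine_const :: "nat \<Rightarrow> real \<Rightarrow> real \<Rightarrow> real \<Rightarrow> real" where
  "fine_const k L A e0 = 2 * A * L ^ k * (e0 ^ Suc k + (2 + e0 ^ (2 * Suc k)) + 1) +
      2 * (1 + L\<^sup>2) * (1 + L) * (2 * A * L ^ k * (e0 ^ Suc k + (2 + e0 ^ (2 * Suc k)) + 1))\<^sup>2"

definition coarse_const :: "nat \<Rightarrow> real \<Rightarrow> real \<Rightarrow> real" where
  "coarse_const k A e0 = (let b = A * (2 + e0 ^ (2 * Suc k)) in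
     (2 * A * 2 ^ k * e0 + b + 2 * b * e0) + ((2 * A * 2 ^ k * e0 + b + 2 * b * e0)\<^sup>2
     + (2 * A * 2 ^ Suc k + 2 * b)\<^sup>2))"

lemma element_consts_nonneg:
  assumes "0 \<le> L" "0 \<le> A" "0 \<le> e0"
  shows "0 \<le> fine_const k L A e0" "0 \<le> coarse_const k A e0"
  using assms unfolding fine_const_def coarse_const_def Let_def
  by (auto intro!: add_nonneg_nonneg mult_nonneg_nonneg)

section \<open>Local approximation and summation over the elements\<close>

context layer_mesh
begin

lemma L_nonneg: "0 \<le> L"
  using \<gamma> Cd by (simp add: L_def)

lemma good_approx_exists:
  fixes S E :: "nat \<Rightarrow> real \<Rightarrow> real"
  assumes "1 \<le> k" "0 \<le> A" "0 \<le> e0" and en: "e \<le> e0 * n"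
    and d: "\<And>j t. j < Suc k \<Longrightarrow> t \<in> {0..1} \<Longrightarrow> (S j has_real_derivative S (Suc j) t) (at t within {0..1}) \<and>
          (E j has_real_derivative E (Suc j) t) (at t within {0..1})"
    and b: "\<And>j t. j \<le> Suc k \<Longrightarrow> t \<in> {0..1} \<Longrightarrow> \<bar>S j t\<bar> \<le> A \<and> e ^ j * \<bar>E j t\<bar> \<le> A * layer_weight \<gamma> e (Suc k) t"
    and u: "\<And>t. t \<in> {0..1} \<Longrightarrow> S 0 t + E 0 t = u t \<and> S 1 t + E 1 t = u1 t"
    and i: "i \<in> {1..N}"
  shows "\<exists>p. good_approx (fine_const k L A e0 + coarse_const k A e0) k e n M u u1 (x (i - 1)) (x i) p"
proof -
  define w where "w = 2 + e0 ^ (2 * Suc k)"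
  have sub: "elem i \<subseteq> {0..1}" using elem_subset[OF i] .
  have lt: "x (i - 1) < x i" using x_less[OF i] .
  note nonneg = element_consts_nonneg[OF L_nonneg assms(2,3), of k]
  have M: "0 \<le> M" using M_ge by simp
  \<comment> \<open>The floor of the weight has twice as many powers of n as needed; n <= 1 drops
    the surplus.\<close>
  have res: "e ^ (2 * Suc k) \<le> e0 ^ (2 * Suc k) * n ^ Suc k"
  proof -
    have "e ^ (2 * Suc k) \<le> (e0 * n) ^ (2 * Suc k)" using e en by (intro power_mono) auto
    also have "\<dots> = e0 ^ (2 * Suc k) * n ^ (2 * Suc k)" by (rule power_mult_distrib)
    also have "\<dots> \<le> e0 ^ (2 * Suc k) * n ^ Suc k"
      using n assms by (intro mult_left_mono power_decreasing) auto
    finally show ?thesis .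
  qed
  have lw: "layer_weight \<gamma> e (Suc k) t = layer t + e ^ (2 * Suc k)" for t
    by (simp add: layer_weight_def layer_def)
  have dS: "(S j has_real_derivative S (Suc j) t) (at t within elem i)"
    and dE: "(E j has_real_derivative E (Suc j) t) (at t within elem i)"
    if "j \<le> k" "t \<in> elem i" for j t
    using d[of j t] that sub by (auto intro: DERIV_subset)
  have "\<exists>p. good_approx (fine_const k L A e0 + coarse_const k A e0) k e n M
      (\<lambda>t. S 0 t + E 0 t) (\<lambda>t. S 1 t + E 1 t) (x (i - 1)) (x i) p"
    using element_cases[OF i]
  proof (elim disjE exE conjE)
    fix E0 assume E0: "0 \<le> E0" "E0 \<le> 1" "x i - x (i - 1) \<le> L * e" "(x i - x (i - 1)) * E0 \<le> L * e * (n * M)"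
      "\<forall>t\<in>elem i. layer t \<le> E0 ^ Suc k + n ^ Suc k"
    \<comment> \<open>Layer element: the derivative of order k + 1 is bounded for S + E as a whole,
      S contributing the summand e^(k+1).\<close>
    have "\<exists>p. good_approx (2 * A * L ^ k * (e0 ^ Suc k + w + 1) +
      2 * (1 + L\<^sup>2) * (1 + L) * (2 * A * L ^ k * (e0 ^ Suc k + w + 1))\<^sup>2) k e n M
      ((\<lambda>j t. S j t + E j t) 0) ((\<lambda>j t. S j t + E j t) 1) (x (i - 1)) (x i) p"
    proof (rule fine_element[OF lt assms(1)])
      fix t assume t: "t \<in> elem i"
      then have t1: "t \<in> {0..1}" using sub by blast
      have "layer_weight \<gamma> e (Suc k) t \<le> E0 ^ Suc k + w * n ^ Suc k"
      proof -
        have "layer t \<le> E0 ^ Suc k + n ^ Suc k" "0 \<le> n ^ Suc k" using E0(5) t n by auto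
        then show ?thesis using res unfolding lw w_def distrib_right by linarith
      qed
      then have "A * layer_weight \<gamma> e (Suc k) t \<le> A * (E0 ^ Suc k + w * n ^ Suc k)"
        using assms(2) by (rule mult_left_mono)
      moreover have "e ^ Suc k * \<bar>S (Suc k) t\<bar> \<le> e ^ Suc k * A"
        using b[OF order_refl t1] e by (intro mult_left_mono) auto
      moreover have "e ^ Suc k * \<bar>S (Suc k) t + E (Suc k) t\<bar> \<le> e ^ Suc k * \<bar>S (Suc k) t\<bar> + e ^ Suc k * \<bar>E (Suc k) t\<bar>"
        unfolding distrib_left[symmetric] using e by (intro mult_left_mono abs_triangle_ineq) simp
      ultimately have "e ^ Suc k * \<bar>S (Suc k) t + E (Suc k) t\<bar> \<le> e ^ Suc k * A + A * (E0 ^ Suc k + w * n ^ Suc k)"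
        using b[OF order_refl t1] by linarith
      then show "e ^ Suc k * \<bar>S (Suc k) t + E (Suc k) t\<bar> \<le> A * (e ^ Suc k + E0 ^ Suc k + w * n ^ Suc k)"
        by (simp only: distrib_left mult.commute[of _ A] add.assoc)
    next
      show "0 \<le> w" using assms by (simp add: w_def)
      fix j t assume "j \<le> k" "t \<in> elem i"
      then show "((\<lambda>t. S j t + E j t) has_real_derivative S (Suc j) t + E (Suc j) t) (at t within elem i)"
        by (intro DERIV_add dS dE)
    qed (use E0 e n M assms L_nonneg in auto)
    then show ?thesis
      unfolding w_def fine_const_def[symmetric]
      using good_approx_mono[of "fine_const k L A e0" k e n M _ _ "x (i - 1)" "x i" _
          "fine_const k L A e0 + coarse_const k A e0"] nonneg e n M lt
      by (meson add_increasing2 less_imp_le order_refl)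
  next
    assume c: "n \<le> x i - x (i - 1)" "x i - x (i - 1) \<le> 2 * n" "\<forall>t\<in>elem i. layer t \<le> 2 * n ^ Suc k"
    have lw2: "A * layer_weight \<gamma> e (Suc k) t \<le> A * w * n ^ Suc k" if t: "t \<in> elem i" for t
    proof -
      have "layer_weight \<gamma> e (Suc k) t \<le> w * n ^ Suc k"
        using c(3) t res unfolding lw w_def distrib_right by fastforce
      from mult_left_mono[OF this assms(2)] show ?thesis by (simp only: mult.assoc)
    qed
    \<comment> \<open>Coarse element: S and E enter separately, E with its values and first
      derivative only.\<close>
    have "\<exists>p. good_approx ((2 * A * 2 ^ k * e0 + (A * w) + 2 * (A * w) * e0) + ((2 * A * 2 ^ k * e0 + (A * w) + 2 * (A * w) * e0)\<^sup>2
     + (2 * A * 2 ^ Suc k + 2 * (A * w))\<^sup>2)) k e n M (\<lambda>t. S 0 t + E 0 t) (\<lambda>t. S 1 t + E 1 t) (x (i - 1)) (x i) p"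
    proof (rule coarse_element[where S = S and E = E, OF lt assms(1) dS])
      fix t assume t: "t \<in> elem i"
      then have t1: "t \<in> {0..1}" using sub by blast
      show "\<bar>S (Suc k) t\<bar> \<le> A" using b[OF order_refl t1] by simp
      show "\<bar>E 0 t\<bar> \<le> A * w * n ^ Suc k \<and> e * \<bar>E 1 t\<bar> \<le> A * w * n ^ Suc k"
        using b[of 0, OF _ t1] b[of 1, OF _ t1] lw2[OF t] by (auto simp del: power_Suc)
    next
      show "0 \<le> A * w" using assms by (simp add: w_def)
    qed (use c e n M assms in auto)
    then show ?thesis
      unfolding w_def coarse_const_def[unfolded Let_def, symmetric]
      using good_approx_mono[of "coarse_const k A e0" k e n M _ _ "x (i - 1)" "x i" _
          "fine_const k L A e0 + coarse_const k A e0"] nonneg e n M lt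
      by (meson add_increasing less_imp_le order_refl)
  qed
  then obtain p where p: "good_approx (fine_const k L A e0 + coarse_const k A e0) k e n M
      (\<lambda>t. S 0 t + E 0 t) (\<lambda>t. S 1 t + E 1 t) (x (i - 1)) (x i) p" ..
  show ?thesis
    by (rule exI[of _ p], rule good_approx_cong[OF p less_imp_le[OF lt]], rule u) (use sub in blast)
qed

text \<open>Terms proportional to the element length add up to length 1, and N terms with the factor
  n M add up to M. The same count controls the traces through 1 / sigma <= M n / e.\<close>

lemma nipg_layer_estimate:
  assumes u: "\<And>t. t \<in> {0..1} \<Longrightarrow> (u has_real_derivative u1 t) (at t within {0..1})"
    and u1: "\<And>t. t \<in> {0..1} \<Longrightarrow> (u1 has_real_derivative (c t * u t - f t) / e\<^sup>2) (at t within {0..1})"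
    and bd: "u 0 = 0" "u 1 = 0" and f: "continuous_on {0..1} f" and cc: "continuous_on {0..1} c"
    and c: "\<And>t. t \<in> {0..1} \<Longrightarrow> 0 \<le> c t \<and> c t \<le> cm"
    and U: "in_VN N k U"
    and gal: "\<And>V. in_VN N k V \<Longrightarrow>
       nipg_a x N e c (penalty N e tau M x) (pw_fun U) (pw_fun V) = nipg_l x N f (pw_fun V)"
    and good: "\<And>i. i \<in> {1..N} \<Longrightarrow> \<exists>p. good_approx K k e n M u u1 (x (i - 1)) (x i) p"
    and K: "0 \<le> K" and e0: "0 \<le> e0" "e \<le> e0 * n"
  shows "nipg_a x N e c (penalty N e tau M x) (\<lambda>i t. u t - poly (U i) t) (\<lambda>i t. u t - poly (U i) t)
     \<le> 4 * ((1 + cm) * K + 8 * K\<^sup>2 * (1 + e0 * Cd)) * ((n ^ Suc k)\<^sup>2 + e * M * ((M * n) ^ k)\<^sup>2)"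
proof -
  define \<sigma> where "\<sigma> = penalty N e tau M x"
  define W where "W = n ^ Suc k"
  define s where "s = (M * n) ^ k"
  have M: "1 \<le> M" using M_ge .
  have Ws: "0 \<le> W" "0 \<le> s" using n M by (auto simp: W_def s_def)
  have cm: "0 \<le> cm" using c[of 0] by simp
  obtain P where P: "\<And>i. i \<in> {1..N} \<Longrightarrow> good_approx K k e n M u u1 (x (i - 1)) (x i) (P i)"
    using good by metis
  have "\<forall>i\<in>{1..N}. \<exists>D G. 0 \<le> D \<and> 0 \<le> G \<and>
      (\<forall>t\<in>elem i. \<bar>u t - poly (P i) t\<bar> \<le> G \<and> \<bar>u1 t - poly (pderiv (P i)) t\<bar> \<le> D) \<and>
      e * D \<le> K * (W + s) \<and> (x i - x (i - 1)) * ((e * D)\<^sup>2 + G\<^sup>2) \<le> K * ((x i - x (i - 1)) * W\<^sup>2 + e * (n * M) * s\<^sup>2)"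
    using P unfolding good_approx_def W_def s_def by blast
  then obtain D G where DG: "\<And>i. i \<in> {1..N} \<Longrightarrow> 0 \<le> D i \<and> 0 \<le> G i \<and>
      (\<forall>t\<in>elem i. \<bar>u t - poly (P i) t\<bar> \<le> G i \<and> \<bar>u1 t - poly (pderiv (P i)) t\<bar> \<le> D i) \<and>
      e * D i \<le> K * (W + s) \<and>
      (x i - x (i - 1)) * ((e * D i)\<^sup>2 + (G i)\<^sup>2) \<le> K * ((x i - x (i - 1)) * W\<^sup>2 + e * (n * M) * s\<^sup>2)"
    by metis
  have PV: "in_VN N k P" using P unfolding in_VN_def good_approx_def by blast
  have ip: "poly (P i) (x (i - 1)) = u (x (i - 1)) \<and> poly (P i) (x i) = u (x i)" if "i \<in> {1..N}" for i
    using P[OF that] unfolding good_approx_def by blast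
  have \<sigma>pos: "0 < \<sigma> i" if "i \<le> N" for i using penalty_bounds(1)[OF that] by (simp add: \<sigma>_def)
  have ucont: "continuous_on {0..1} u" "continuous_on {0..1} u1"
    by (rule continuous_on_if_has_real_derivative, erule u u1)+
  let ?I = "\<lambda>i. integral (elem i) (\<lambda>t. e\<^sup>2 * (u1 t - poly (pderiv (P i)) t)\<^sup>2 + c t * (u t - poly (P i) t)\<^sup>2)"
  let ?d = "\<lambda>i t. u1 t - poly (pderiv (P i)) t"
  have main: "nipg_a x N e c \<sigma> (\<lambda>i t. u t - poly (U i) t) (\<lambda>i t. u t - poly (U i) t)
    \<le> 4 * ((\<Sum>i=1..N. ?I i) + (\<Sum>i=0..N. e ^ 4 / \<sigma> i * (avg ?d i)\<^sup>2))"
    by (rule nipg_error_bound[where \<sigma> = \<sigma>, OF cc e u u1 bd f _ \<sigma>pos U PV _ ip])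
      (use c gal[folded \<sigma>_def] in auto)
  have vol: "?I i \<le> (1 + cm) * (K * ((x i - x (i - 1)) * W\<^sup>2 + e * (n * M) * s\<^sup>2))" if i: "i \<in> {1..N}" for i
  proof -
    note sub = elem_subset[OF i] and d = DG[OF i]
    have bound: "e\<^sup>2 * (?d i t)\<^sup>2 + c t * (u t - poly (P i) t)\<^sup>2 \<le> (1 + cm) * ((e * D i)\<^sup>2 + (G i)\<^sup>2)"
      if t: "t \<in> elem i" for t
    proof -
      have sq: "a\<^sup>2 \<le> b\<^sup>2" if "\<bar>a\<bar> \<le> b" for a b :: real
        using power_mono[OF that, of 2] by simp
      have 1: "(?d i t)\<^sup>2 \<le> (D i)\<^sup>2" "(u t - poly (P i) t)\<^sup>2 \<le> (G i)\<^sup>2"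
        using d t by (intro sq; blast)+
      have "e\<^sup>2 * (?d i t)\<^sup>2 \<le> e\<^sup>2 * (D i)\<^sup>2" using 1 by (intro mult_left_mono) auto
      moreover have "c t * (u t - poly (P i) t)\<^sup>2 \<le> cm * (G i)\<^sup>2"
        using 1 c[of t] cm t sub by (intro mult_mono) auto
      moreover have "0 \<le> cm * (e * D i)\<^sup>2" "0 \<le> (G i)\<^sup>2" using cm by auto
      ultimately show ?thesis
        unfolding power_mult_distrib distrib_left distrib_right mult_1_left by linarith
    qed
    have "?I i \<le> integral (elem i) (\<lambda>t. (1 + cm) * ((e * D i)\<^sup>2 + (G i)\<^sup>2))"
      using bound
      by (intro integral_le integrable_continuous_interval continuous_intros
          continuous_on_subset[OF cc sub] continuous_on_subset[OF ucont(1) sub] continuous_on_subset[OF ucont(2) sub]) auto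
    also have "\<dots> = (1 + cm) * ((x i - x (i - 1)) * ((e * D i)\<^sup>2 + (G i)\<^sup>2))"
      using x_less[OF i] by simp
    also have "\<dots> \<le> (1 + cm) * (K * ((x i - x (i - 1)) * W\<^sup>2 + e * (n * M) * s\<^sup>2))"
      using d cm by (intro mult_left_mono) auto
    finally show ?thesis .
  qed
  have tel: "(\<Sum>i=1..N. x i - x (i - 1)) = 1"
    using sum_telescope''[of 0 N x] x_0 x_N by simp
  have "(\<Sum>i=1..N. ?I i) \<le> (\<Sum>i=1..N. (1 + cm) * (K * ((x i - x (i - 1)) * W\<^sup>2 + e * (n * M) * s\<^sup>2)))"
    by (intro sum_mono vol)
  also have "\<dots> = (1 + cm) * K * ((\<Sum>i=1..N. x i - x (i - 1)) * W\<^sup>2 + real N * n * (e * M * s\<^sup>2))"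
    unfolding sum_distrib_left[symmetric] sum.distrib sum_distrib_right[symmetric] by (simp add: algebra_simps)
  also have "\<dots> = (1 + cm) * K * (W\<^sup>2 + e * M * s\<^sup>2)" unfolding tel n(3) by simp
  finally have V: "(\<Sum>i=1..N. ?I i) \<le> (1 + cm) * K * (W\<^sup>2 + e * M * s\<^sup>2)" .
  define Q where "Q = K * (W + s)"
  have ends: "\<bar>?d i (x (i - 1))\<bar> \<le> D i" "\<bar>?d i (x i)\<bar> \<le> D i" if "i \<in> {1..N}" for i
    using DG[OF that] x_less[OF that] by auto
  have eD: "e * D i \<le> Q" if "i \<in> {1..N}" for i using DG[OF that] by (simp add: Q_def)
  have av: "e * \<bar>avg ?d i\<bar> \<le> Q" if "i \<le> N" for i
  proof -
    have *: "e * r \<le> Q" if "r \<le> D j" "j \<in> {1..N}" for r j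
      using eD[OF that(2)] mult_left_mono[OF that(1), of e] e by linarith
    consider "i = 0" | "i = N" | "i \<noteq> 0" "i \<noteq> N" by blast
    then show ?thesis
    proof cases
      case 1 then show ?thesis using *[OF ends(1)[of 1]] N by (simp add: avg_def)
    next
      case 2 then show ?thesis using *[OF ends(2)[of N]] N by (simp add: avg_def)
    next
      case 3
      then have "i \<in> {1..N}" "i + 1 \<in> {1..N}" using that by auto
      from *[OF ends(2) this(1), OF this(1)] *[OF ends(1) this(2), OF this(2)]
      have "e * ((\<bar>?d (i + 1) (x i)\<bar> + \<bar>?d i (x i)\<bar>) / 2) \<le> Q" by (simp add: algebra_simps)
      moreover have "\<bar>avg ?d i\<bar> \<le> (\<bar>?d (i + 1) (x i)\<bar> + \<bar>?d i (x i)\<bar>) / 2"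
        using 3 by (simp add: avg_def)
      then have "e * \<bar>avg ?d i\<bar> \<le> e * ((\<bar>?d (i + 1) (x i)\<bar> + \<bar>?d i (x i)\<bar>) / 2)"
        using e by (intro mult_left_mono) auto
      ultimately show ?thesis by linarith
    qed
  qed
  have Q2: "Q\<^sup>2 \<le> 2 * K\<^sup>2 * (W\<^sup>2 + s\<^sup>2)"
  proof -
    have "(W + s)\<^sup>2 \<le> 2 * (W\<^sup>2 + s\<^sup>2)"
      using zero_le_power2[of "W - s"] by (simp add: power2_eq_square algebra_simps)
    from mult_left_mono[OF this zero_le_power2[of K]] show ?thesis
      unfolding Q_def power_mult_distrib by (simp only: mult.assoc mult.left_commute[of 2])
  qed
  \<comment> \<open>Written as (e^2 / sigma) times (e avg)^2, a trace costs e at a boundary node and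
    e M n at an interior one; the indicators put both into one formula.\<close>
  have tr: "e ^ 4 / \<sigma> i * (avg ?d i)\<^sup>2
      \<le> e * Q\<^sup>2 * ((if i = 0 then 1 else 0) + (if i = N then 1 else 0) + M * n)" if i: "i \<le> N" for i
  proof -
    have "(e * \<bar>avg ?d i\<bar>)\<^sup>2 \<le> Q\<^sup>2" using av[OF i] e by (intro power_mono) auto
    then have sq: "(e * avg ?d i)\<^sup>2 \<le> Q\<^sup>2" by (simp add: power_mult_distrib)
    define r where "r = (if i = 0 then 1 else 0) + (if i = N then 1 else 0) + M * n"
    have r: "0 \<le> r" using M n by (simp add: r_def)
    have "e\<^sup>2 / \<sigma> i \<le> e * r"
    proof (cases "i = 0 \<or> i = N")
      case True
      then have "e\<^sup>2 / \<sigma> i = e * 1" using penalty_bounds(2)[OF i] by (simp add: \<sigma>_def power2_eq_square)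
      also have "\<dots> \<le> e * r" using True e M n by (intro mult_left_mono) (auto simp: r_def)
      finally show ?thesis .
    next
      case False
      then have "1 / \<sigma> i \<le> M * n / e" using penalty_bounds(3)[OF i] by (simp add: \<sigma>_def)
      from mult_left_mono[OF this zero_le_power2[of e]] show ?thesis
        using False e by (simp add: r_def power2_eq_square)
    qed
    then have "e\<^sup>2 / \<sigma> i * (e * avg ?d i)\<^sup>2 \<le> e * r * Q\<^sup>2"
      using sq r e by (intro mult_mono) auto
    moreover have "e\<^sup>2 / \<sigma> i * (e * avg ?d i)\<^sup>2 = e ^ 4 / \<sigma> i * (avg ?d i)\<^sup>2"
      by (simp add: power_mult_distrib power2_eq_square power4_eq_xxxx)
    ultimately show ?thesis unfolding r_def[symmetric] by (simp only: mult.assoc mult.commute[of r])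
  qed
  have "(\<Sum>i=0..N. e ^ 4 / \<sigma> i * (avg ?d i)\<^sup>2)
     \<le> (\<Sum>i=0..N. e * Q\<^sup>2 * ((if i = 0 then 1 else 0) + (if i = N then 1 else 0) + M * n))"
    using tr by (intro sum_mono) simp
  also have "\<dots> = e * Q\<^sup>2 * (2 + (real N + 1) * (M * n))"
    unfolding sum_distrib_left[symmetric] by (simp add: sum.distrib sum.delta)
  also have "\<dots> \<le> e * (2 * K\<^sup>2 * (W\<^sup>2 + s\<^sup>2)) * (4 * M)"
  proof -
    have "(real N + 1) * n \<le> 2" using n by (simp add: algebra_simps)
    from mult_left_mono[OF this, of M] have "2 + (real N + 1) * (M * n) \<le> 4 * M" using M by (simp add: algebra_simps)
    then show ?thesis using e M n Q2 by (intro mult_mono mult_left_mono) auto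
  qed
  also have "\<dots> = 8 * K\<^sup>2 * (e * M * W\<^sup>2 + e * M * s\<^sup>2)" by (simp add: algebra_simps)
  also have "\<dots> \<le> 8 * K\<^sup>2 * ((1 + e0 * Cd) * (W\<^sup>2 + e * M * s\<^sup>2))"
  proof -
    \<comment> \<open>The product e M stays bounded although M may grow like N, because e <= e0 n.
      Hence the part of the traces with n^(2k+2) keeps its order.\<close>
    have "e * M \<le> (e0 * n) * (Cd * real N)" using e0 e M M_le by (intro mult_mono) auto
    also have "\<dots> = e0 * Cd * (real N * n)" by (simp only: mult.assoc mult.left_commute mult.commute)
    also have "\<dots> = e0 * Cd" by (simp add: n(3))
    finally have "e * M * W\<^sup>2 \<le> e0 * Cd * W\<^sup>2" by (intro mult_right_mono) auto
    moreover have "0 \<le> e0 * Cd * (e * M * s\<^sup>2)" using e0 Cd e M by simp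
    ultimately have "e * M * W\<^sup>2 + e * M * s\<^sup>2 \<le> (1 + e0 * Cd) * (W\<^sup>2 + e * M * s\<^sup>2)"
      using zero_le_power2[of W] unfolding distrib_left distrib_right by linarith
    then show ?thesis by (intro mult_left_mono) auto
  qed
  finally have T: "(\<Sum>i=0..N. e ^ 4 / \<sigma> i * (avg ?d i)\<^sup>2)
    \<le> 8 * K\<^sup>2 * (1 + e0 * Cd) * (W\<^sup>2 + e * M * s\<^sup>2)" by (simp only: mult.assoc)
  have "4 * ((\<Sum>i=1..N. ?I i) + (\<Sum>i=0..N. e ^ 4 / \<sigma> i * (avg ?d i)\<^sup>2))
     \<le> 4 * ((1 + cm) * K * (W\<^sup>2 + e * M * s\<^sup>2) + 8 * K\<^sup>2 * (1 + e0 * Cd) * (W\<^sup>2 + e * M * s\<^sup>2))"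
    using V T by (intro mult_left_mono add_mono) auto
  also have "\<dots> = 4 * ((1 + cm) * K + 8 * K\<^sup>2 * (1 + e0 * Cd)) * (W\<^sup>2 + e * M * s\<^sup>2)"
    by (simp only: distrib_right mult.assoc)
  finally show ?thesis using main unfolding \<sigma>_def W_def s_def by linarith
qed

text \<open>The root of e M (M n)^(2k) contains M to the power k + 1/2; as M >= 1 this is rounded up
  to k + 1.\<close>

lemma final_rate:
  assumes "0 \<le> C"
  shows "sqrt (C * ((n ^ Suc k)\<^sup>2 + e * M * ((M * n) ^ k)\<^sup>2))
    \<le> sqrt C * real N powr (- (real k + 1)) + sqrt C * sqrt e * real N powr (- real k) * M ^ (k + 1)"
proof -
  have M: "1 \<le> M" using M_ge .
  have N0: "0 < real N" using N by simp
  have p: "real N powr (- (real j)) = n ^ j" for j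
    using N0 by (simp add: powr_minus powr_realpow n_def power_one_over inverse_eq_divide)
  have "M \<le> M\<^sup>2" using M by (simp add: power2_eq_square)
  then have "((M * n) ^ k)\<^sup>2 * M \<le> ((M * n) ^ k)\<^sup>2 * M\<^sup>2" by (intro mult_left_mono) auto
  moreover have "n ^ k * M ^ Suc k = (M * n) ^ k * M" by (simp add: power_mult_distrib)
  ultimately have "M * ((M * n) ^ k)\<^sup>2 \<le> (n ^ k * M ^ Suc k)\<^sup>2"
    by (simp only: power_mult_distrib[of _ M] mult.commute[of M])
  then have "e * (M * ((M * n) ^ k)\<^sup>2) \<le> e * (n ^ k * M ^ Suc k)\<^sup>2" using e by (intro mult_left_mono) auto
  then have "(n ^ Suc k)\<^sup>2 + e * M * ((M * n) ^ k)\<^sup>2 \<le> (n ^ Suc k)\<^sup>2 + (sqrt e * (n ^ k * M ^ Suc k))\<^sup>2"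
    using e by (simp add: power_mult_distrib mult.assoc)
  then have "sqrt ((n ^ Suc k)\<^sup>2 + e * M * ((M * n) ^ k)\<^sup>2) \<le> sqrt ((n ^ Suc k)\<^sup>2 + (sqrt e * (n ^ k * M ^ Suc k))\<^sup>2)"
    by (rule real_sqrt_le_mono)
  also have "\<dots> \<le> n ^ Suc k + sqrt e * (n ^ k * M ^ Suc k)"
    using e n M by (intro sqrt_sum_squares_le_sum) auto
  finally have "sqrt C * sqrt ((n ^ Suc k)\<^sup>2 + e * M * ((M * n) ^ k)\<^sup>2)
     \<le> sqrt C * (n ^ Suc k + sqrt e * (n ^ k * M ^ Suc k))" using assms by (intro mult_left_mono) auto
  moreover have "- (real k + 1) = - real (Suc k)" by simp
  ultimately show ?thesis
    unfolding p[of k] \<open>- (real k + 1) = - real (Suc k)\<close> p[of "Suc k"] real_sqrt_mult[of C]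
    by (simp only: distrib_left mult.assoc Suc_eq_plus1)
qed

end

section \<open>Choice of the constants and assembly\<close>

theorem theorem1:
  fixes c f :: "real \<Rightarrow> real" and S :: "real set"
    and \<gamma>t \<gamma> :: real and k :: nat and Cd Cl Ceps :: real
  assumes "open S" and "{0..1} \<subseteq> S"
    and "smooth_on S c" and "smooth_on S f"
    and "\<gamma>t > 0" and "\<forall>t\<in>{0..1}. c t \<ge> \<gamma>t\<^sup>2"
    and "0 < \<gamma>" and "\<gamma> < \<gamma>t" and "k \<ge> 1"
    and "Cd > 0" and "Cl > 0" and "Ceps > 0"
  shows "\<exists>C>0. \<forall>(\<epsilon>::real) (N::nat) (\<phi>1::real\<Rightarrow>real) (\<phi>2::real\<Rightarrow>real)
            (u::real\<Rightarrow>real) (U::nat \<Rightarrow> real poly).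
     0 < \<epsilon> \<and> 4 dvd N \<and> N \<ge> 4 \<and> \<epsilon> \<le> Ceps / real N \<and> trans_pt k \<epsilon> \<gamma> N < 1/4 \<and>
     mesh_gen_conds 0 (1/4) N Cd Cl \<phi>1 \<and> mono_on {0..1/4} \<phi>1 \<and>
     \<phi>1 0 = 0 \<and> \<phi>1 (1/4) = ln (real N) \<and>
     mesh_gen_conds (3/4) 1 N Cd Cl \<phi>2 \<and> antimono_on {3/4..1} \<phi>2 \<and>
     \<phi>2 1 = 0 \<and> \<phi>2 (3/4) = ln (real N) \<and>
     continuous_on {0..1} u \<and> u 0 = 0 \<and> u 1 = 0 \<and>
     (\<forall>t\<in>{0<..<1}. u differentiable (at t) \<and> deriv u differentiable (at t) \<and>
        - \<epsilon>\<^sup>2 * deriv (deriv u) t + c t * u t = f t) \<and>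
     in_VN N k U \<and>
     (\<forall>V. in_VN N k V \<longrightarrow>
        nipg_a (mesh_pt k \<epsilon> \<gamma> N \<phi>1 \<phi>2) N \<epsilon> c
          (penalty N \<epsilon> (trans_pt k \<epsilon> \<gamma> N) (max_dpsi \<phi>1 \<phi>2) (mesh_pt k \<epsilon> \<gamma> N \<phi>1 \<phi>2))
          (pw_fun U) (pw_fun V)
        = nipg_l (mesh_pt k \<epsilon> \<gamma> N \<phi>1 \<phi>2) N f (pw_fun V))
     \<longrightarrow>
     dG_norm (mesh_pt k \<epsilon> \<gamma> N \<phi>1 \<phi>2) N \<epsilon> c
        (penalty N \<epsilon> (trans_pt k \<epsilon> \<gamma> N) (max_dpsi \<phi>1 \<phi>2) (mesh_pt k \<epsilon> \<gamma> N \<phi>1 \<phi>2))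
        (\<lambda>i t. u t - poly (U i) t)
     \<le> C * real N powr (- (real k + 1))
       + C * sqrt \<epsilon> * real N powr (- real k) * max_dpsi \<phi>1 \<phi>2 ^ (k + 1)"
proof -
  have c: "Ck n c" and f: "Ck n f" for n using smooth_on_Ck assms(2-4) by blast+
  have "\<gamma>\<^sup>2 \<le> \<gamma>t\<^sup>2" using assms by (intro power_mono) auto
  then have cge: "\<gamma>\<^sup>2 \<le> c t" if "t \<in> {0..1}" for t using assms(6) that by force
  obtain cm where cm: "0 \<le> cm" "\<forall>t\<in>{0..1}. \<bar>c t\<bar> \<le> cm"
    using Ck_Wd[OF c[of 0] zero_less_one] by (auto dest: spec[of _ 1])
  \<comment> \<open>Degree k calls for derivatives up to order k + 1, and k + 1 expansion terms
    leave the residual e^(2k+2). The range of e is bounded by Ceps, since e <= Ceps / N.\<close>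
  obtain A where A: "0 \<le> A" and dec: "\<And>e u u1. 0 < e \<Longrightarrow> e \<le> Ceps \<Longrightarrow> u 0 = 0 \<Longrightarrow> u 1 = 0 \<Longrightarrow>
    (\<forall>t\<in>{0..1}. (u has_real_derivative u1 t) (at t within {0..1}) \<and>
       (u1 has_real_derivative (c t * u t - f t) / e\<^sup>2) (at t within {0..1})) \<Longrightarrow>
    (\<exists>S E. (\<forall>j<Suc k. \<forall>t\<in>{0..1}. (S j has_real_derivative S (Suc j) t) (at t within {0..1}) \<and>
          (E j has_real_derivative E (Suc j) t) (at t within {0..1})) \<and>
       (\<forall>j\<le>Suc k. \<forall>t\<in>{0..1}. \<bar>S j t\<bar> \<le> A \<and> e ^ j * \<bar>E j t\<bar> \<le> A * layer_weight \<gamma> e (Suc k) t) \<and>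
       (\<forall>t\<in>{0..1}. u t = S 0 t + E 0 t))"
    using solution_decomposition[OF c f assms(7) cge assms(12), of "Suc k" "Suc k"] by blast
  \<comment> \<open>The value of \<open>L\<close>, written out because the final constant must
    precede every mesh.\<close>
  define l where "l = (real k + 1) / \<gamma> * (Cd + exp Cd)"
  have l: "0 \<le> l" using assms by (simp add: l_def)
  define K where "K = fine_const k l A Ceps + coarse_const k A Ceps"
  define C0 where "C0 = 4 * ((1 + cm) * K + 8 * K\<^sup>2 * (1 + Ceps * Cd))"
  have K: "0 \<le> K"
    using element_consts_nonneg[OF l A, of Ceps k] assms by (simp add: K_def)
  then have C0: "0 \<le> C0" using cm assms by (simp add: C0_def)
  show ?thesis
  \<comment> \<open>\<open>C0\<close> is only known to be nonnegative; adding 1 gives a positive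
    constant.\<close>
  proof (intro exI[of _ "sqrt C0 + 1"] conjI allI impI, goal_cases)
    case 1
    show ?case using C0 by (simp add: add_nonneg_pos)
  next
    case (2 \<epsilon> N \<phi>1 \<phi>2 u U)
    interpret layer_mesh k N \<epsilon> \<gamma> Cd Cl \<phi>1 \<phi>2
      using 2 assms by unfold_locales auto
    have en: "\<epsilon> \<le> Ceps * n" using 2 by (simp add: n_def)
    have "Ceps * n \<le> Ceps * 1" using n assms by (intro mult_left_mono) auto
    then have eC: "\<epsilon> \<le> Ceps" using en by simp
    have cc: "continuous_on {0..1} c" and fc: "continuous_on {0..1} f" using c f Ck_continuous by blast+
    have u0: "u 0 = 0" "u 1 = 0" using 2 by auto
    have ode: "deriv (deriv u) t = (c t * u t - f t) / \<epsilon>\<^sup>2" if "t \<in> {0<..<1}" for t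
    proof -
      have "- \<epsilon>\<^sup>2 * deriv (deriv u) t + c t * u t = f t" using 2 that by blast
      then have "\<epsilon>\<^sup>2 * deriv (deriv u) t = c t * u t - f t" by linarith
      then show ?thesis using e by (simp add: field_simps)
    qed
    have "\<exists>u1. \<forall>t\<in>{0..1}. (u has_real_derivative u1 t) (at t within {0..1}) \<and>
      (u1 has_real_derivative (c t * u t - f t) / \<epsilon>\<^sup>2) (at t within {0..1})"
    proof (rule ode_solution_C2_closed)
      show uc: "continuous_on {0..1} u" using 2 by blast
      show "continuous_on {0..1} (\<lambda>t. (c t * u t - f t) / \<epsilon>\<^sup>2)"
        using e by (intro continuous_intros cc fc uc) auto
    qed (use 2 ode in blast)+
    then obtain u1 where u1: "\<forall>t\<in>{0..1}. (u has_real_derivative u1 t) (at t within {0..1}) \<and>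
      (u1 has_real_derivative (c t * u t - f t) / \<epsilon>\<^sup>2) (at t within {0..1})" ..
    obtain S E where SE: "\<And>j t. j < Suc k \<Longrightarrow> t \<in> {0..1} \<Longrightarrow> (S j has_real_derivative S (Suc j) t) (at t within {0..1}) \<and>
          (E j has_real_derivative E (Suc j) t) (at t within {0..1})"
      "\<And>j t. j \<le> Suc k \<Longrightarrow> t \<in> {0..1} \<Longrightarrow> \<bar>S j t\<bar> \<le> A \<and> \<epsilon> ^ j * \<bar>E j t\<bar> \<le> A * layer_weight \<gamma> \<epsilon> (Suc k) t"
      "\<And>t. t \<in> {0..1} \<Longrightarrow> u t = S 0 t + E 0 t"
      using dec[OF e eC u0 u1] by blast
    \<comment> \<open>The decomposition speaks of values of u only. Differentiating it, uniqueness
      of one-sided derivatives identifies S' + E' with \<open>u1\<close>, also at the end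
      points.\<close>
    have SEu: "S 0 t + E 0 t = u t \<and> S 1 t + E 1 t = u1 t" if t: "t \<in> {0..1}" for t
    proof -
      have "((\<lambda>t. S 0 t + E 0 t) has_real_derivative S (Suc 0) t + E (Suc 0) t) (at t within {0..1})"
        using SE(1)[of 0 t] t by (intro DERIV_add) auto
      then have "(u has_real_derivative S (Suc 0) t + E (Suc 0) t) (at t within {0..1})"
        by (rule has_field_derivative_transform_within[of _ _ _ _ 1]) (use SE(3) t in auto)
      then show ?thesis
        using has_real_derivative_within_unique[of 0 1 t u] u1 t SE(3) by fastforce
    qed
    have good: "\<exists>p. good_approx K k \<epsilon> n M u u1 (x (i - 1)) (x i) p" if "i \<in> {1..N}" for i
      unfolding K_def l_def L_def[symmetric]
      by (rule good_approx_exists[OF assms(9) A _ en SE(1,2) SEu that]) (use assms in auto)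
    have "nipg_a x N \<epsilon> c (penalty N \<epsilon> tau M x) (\<lambda>i t. u t - poly (U i) t) (\<lambda>i t. u t - poly (U i) t)
      \<le> C0 * ((n ^ Suc k)\<^sup>2 + \<epsilon> * M * ((M * n) ^ k)\<^sup>2)"
      unfolding C0_def
    proof (rule nipg_layer_estimate[where f = f and ?u1.0 = u1])
      show "0 \<le> c t \<and> c t \<le> cm" if "t \<in> {0..1}" for t
      proof
        show "0 \<le> c t" using cge[OF that] zero_le_power2[of \<gamma>] by linarith
        show "c t \<le> cm" using cm(2) that by (meson abs_le_D1)
      qed
    qed (use u1 u0 fc cc 2 good K en assms in auto)
    then have "dG_norm x N \<epsilon> c (penalty N \<epsilon> tau M x) (\<lambda>i t. u t - poly (U i) t)
      \<le> sqrt (C0 * ((n ^ Suc k)\<^sup>2 + \<epsilon> * M * ((M * n) ^ k)\<^sup>2))"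
      unfolding dG_norm_def by (rule real_sqrt_le_mono)
    also have "\<dots> \<le> sqrt C0 * real N powr (- (real k + 1)) + sqrt C0 * sqrt \<epsilon> * real N powr (- real k) * M ^ (k + 1)"
      by (rule final_rate[OF C0])
    also have "\<dots> \<le> (sqrt C0 + 1) * real N powr (- (real k + 1))
        + (sqrt C0 + 1) * sqrt \<epsilon> * real N powr (- real k) * M ^ (k + 1)"
      using e M_ge by (intro add_mono mult_right_mono) auto
    finally show ?case .
  qed
qed

end
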